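(* Assume that: (A.1) $A$ is irreducible; (A.2) $X_M$ has a periodic point for $\sigma$; (A.3) $\varphi:X\to\mathbb{R}$ is summable and $[\varphi]_{k+1}<\infty$ for some fixed integer $k\ge1$. Assume moreover that the matrix $M$ is irreducible. Let $p\ge1$ be the period of $M$ and put $\kappa=\exp(2\pi\sqrt{-1}/p)$. Let $(\lambda,g,\nu)$ be a triplet such that $\lambda=\exp(P(\varphi|_{X_M}))$ is the (positive) spectral radius of $\mathcal{L}_M$ on $F_b^k(X)$, $g\in\Lambda^k_{c_1}(X)$ with $c_1=[\varphi]_{k+1}\theta/(1-\theta)$, $\|g\|_\infty=1$, $\mathcal{L}_Mg=\lambda g$, and $\nu$ is a Borel probability measure on $X$ supported on $X_M$ with $\mathcal{L}_M^*\nu=\lambda\nu$ (such a triplet exists), and put $h=g/\nu(g)$. Then the operator $\mathcal{L}_M:F^k_b(X)\to F^k_b(X)$ has the spectral decomposition $$\mathcal{L}_M=\sum_{i=0}^{p-1}\lambda_i\mathcal{P}_i+\mathcal{R}$$ such that each $\lambda_i=\lambda\kappa^i$ is a simple eigenvalue of $\mathcal{L}_M$, each $\mathcal{P}_i$ is a projection and has the form $\mathcal{P}_i=h_i\otimes\nu_i$ with the eigenfunction $h_i=\sum_{j=0}^{p-1}\kappa^{-ji}h\chi_{\Sigma_j}$ and the eigenvector $\nu_i=\sum_{j=0}^{p-1}\kappa^{ji}\nu|_{\Sigma_j}$ (that is, $\mathcal{L}_Mh_i=\lambda_ih_i$ and $\mathcal{L}_M^*\nu_i=\lambda_i\nu_i$),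 and the spectral radius of $\mathcal{R}$ is less than $\lambda$.
   Context: Let $S$ be a countable set, $A=(A(ij))_{i,j\in S}$ a zero-one matrix, and $X=X_A=\{\omega=\omega_0\omega_1\cdots\in\prod_{n\ge0}S: A(\omega_i\omega_{i+1})=1 \text{ for all } i\ge 0\}$ with shift $(\sigma\omega)_n=\omega_{n+1}$. For $w\in S^n$, $[w]=\{\omega\in X:\omega_0\cdots\omega_{n-1}=w\}$. Fix $\theta\in(0,1)$ and the metric $d_\theta(\omega,\upsilon)=\theta^{\min\{n\ge0:\omega_n\ne\upsilon_n\}}$ for $\omega\ne\upsilon$, $d_\theta(\omega,\omega)=0$. For a function $f$ on $X$, $\mathrm{var}_n f=\sup\{|f(\omega)-f(\upsilon)|:\omega_i=\upsilon_i,\ 0\le i\le n-1\}$ and $[f]_k=\sup_{n\ge k}\mathrm{var}_nf/\theta^n$. $C(X)$ is the set of complex-valued continuous functions on $X$; $C_b(X)$ is the Banach space of bounded ones with norm $\|\cdot\|_\infty$; $F^k_b(X)$ is the Banach space of bounded $f\in C(X)$ with $[f]_k<\infty$, with norm $\|f\|_k=\|f\|_\infty+[f]_k$. $S_0\subset S$ is nonempty and $M=(M(ij))_{i,j\in S_0}$ is a zero-one matrix with $M(ij)\le A(ij)$; put $M(ij)=0$ if $i\notin S_0$ or $j\notin S_0$. $X_M=\{\omega\in\prod_{n\ge0}S_0: M(\omega_n\omega_{n+1})=1\ \forall n\ge0\}\subset X$. A zero-one matrix $B$ indexed by a set $T$ is irreducible if for all $a,b\in T$ there are $n\ge1$ and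 a word $w_1\cdots w_{n+1}$ with $w_1=a$, $w_{n+1}=b$ and $B(w_iw_{i+1})=1$ for $1\le i\le n$; its period is the greatest common divisor of all $n\geq 1$ occurring for $a=b$. A function $\varphi:X\to\mathbb{R}$ is summable if $\sum_{s\in S:[s]\ne\emptyset}\exp(\sup_{[s]}\varphi)<\infty$. With $S_n\varphi=\sum_{i=0}^{n-1}\varphi\circ\sigma^i$, $P(\varphi|_{X_M})=\lim_{n\to\infty}\frac1n\log\sum_{w\in S_0^n:[w]\cap X_M\neq\emptyset}\exp(\sup_{[w]\cap X_M}S_n\varphi)$. The operator $\mathcal{L}_M=\mathcal{L}_{M,\varphi}$ is $\mathcal{L}_Mf(\omega)=\sum_{a\in S:M(a\omega_0)=1}e^{\varphi(a\cdot\omega)}f(a\cdot\omega)$, where $a\cdot\omega=a\omega_0\omega_1\cdots$. It is bounded on $C_b(X)$ and on $F_b^k(X)$. $\mathcal{L}_M^*$ denotes the dual operator: $\mathcal{L}_M^*\nu=\lambda\nu$ means $\int\mathcal{L}_Mf\,d\nu=\lambda\int f\,d\nu$ for all $f\in C_b(X)$; $\nu(f)=\int f\,d\nu$. For $c\ge0$, $\Lambda^k_c(X)=\{f\in C(X): f\ge0,\ f(\omega)\le e^{c\,d_\theta(\omega,\upsilon)}f(\upsilon)\text{ whenever }\omega\in[\upsilon_0\cdots\upsilon_{k-1}]\}$. When $M$ is irreducible with period $p$, there is a decomposition $S_0=S_{0,0}\cup\cdots\cup S_{0,p-1}$ into disjoint sets such that, with $\Sigma_i=\bigcup_{s\in S_{0,i}}[s]$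 and $X_M^i=X_M\cap\Sigma_i$, one has $\sigma(X_M^i)=X_M^{i+1\bmod p}$ and each $(X_M^i,\sigma^p)$ is topologically mixing. $\chi_{\Sigma_j}$ is the indicator function of $\Sigma_j$, $\nu|_{\Sigma_j}$ is the restriction of $\nu$ to $\Sigma_j$, and $(h\otimes\nu)f=\nu(f)h$. *)

theory Defs
  imports "HOL-Analysis.Analysis" "HOL-Probability.Probability_Measure"
begin

section \<open>Topological Markov shifts\<close>

text \<open>
  The countable alphabet is the type \<open>'s\<close>; a matrix indexed by a subset \<open>T\<close> of it is a function
  on all of \<open>'s \<times> 's\<close> together with \<open>T\<close>.
\<close>

type_synonym 's point = "nat \<Rightarrow> 's"

definition zero_one_matrix :: "('s \<Rightarrow> 's \<Rightarrow> nat) \<Rightarrow> bool" where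
  "zero_one_matrix B \<longleftrightarrow> (\<forall>i j. B i j \<in> {0, 1})"

definition subshift :: "'s set \<Rightarrow> ('s \<Rightarrow> 's \<Rightarrow> nat) \<Rightarrow> 's point set" where
  "subshift T B = {\<omega>. (\<forall>n. \<omega> n \<in> T) \<and> (\<forall>n. B (\<omega> n) (\<omega> (Suc n)) = 1)}"

abbreviation full_shift :: "('s \<Rightarrow> 's \<Rightarrow> nat) \<Rightarrow> 's point set" where
  "full_shift A \<equiv> subshift UNIV A"

definition shift :: "'s point \<Rightarrow> 's point" where
  "shift \<omega> = (\<lambda>n. \<omega> (Suc n))"

definition prepend :: "'s \<Rightarrow> 's point \<Rightarrow> 's point" where
  "prepend a \<omega> = case_nat a \<omega>"

definition cylinder :: "('s \<Rightarrow> 's \<Rightarrow> nat) \<Rightarrow> 's list \<Rightarrow> 's point set" where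
  "cylinder A w = {\<omega> \<in> full_shift A. \<forall>i < length w. \<omega> i = w ! i}"

definition path_of_length :: "'s set \<Rightarrow> ('s \<Rightarrow> 's \<Rightarrow> nat) \<Rightarrow> 's \<Rightarrow> 's \<Rightarrow> nat \<Rightarrow> bool" where
  "path_of_length T B a b n \<longleftrightarrow>
     (\<exists>w. length w = n + 1 \<and> set w \<subseteq> T \<and> hd w = a \<and> last w = b \<and>
          (\<forall>i < n. B (w ! i) (w ! Suc i) = 1))"

definition irreducible_matrix :: "'s set \<Rightarrow> ('s \<Rightarrow> 's \<Rightarrow> nat) \<Rightarrow> bool" where
  "irreducible_matrix T B \<longleftrightarrow> (\<forall>a\<in>T. \<forall>b\<in>T. \<exists>n\<ge>1. path_of_length T B a b n)"

definition matrix_period :: "'s set \<Rightarrow> ('s \<Rightarrow> 's \<Rightarrow> nat) \<Rightarrow> nat" where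
  "matrix_period T B = Gcd {n. n \<ge> 1 \<and> (\<exists>a\<in>T. path_of_length T B a a n)}"

subsection \<open>Metric, topology and Borel sets\<close>

definition dist_theta :: "real \<Rightarrow> 's point \<Rightarrow> 's point \<Rightarrow> real" where
  "dist_theta \<theta> \<omega> \<upsilon> = (if \<omega> = \<upsilon> then 0 else \<theta> ^ (LEAST n. \<omega> n \<noteq> \<upsilon> n))"

lemma Metric_space_dist_theta:
  assumes "0 < \<theta>" "\<theta> < 1"
  shows "Metric_space X (dist_theta \<theta>)"
proof
  fix x y z :: "'s point"
  show "0 \<le> dist_theta \<theta> x y" using assms by (simp add: dist_theta_def)
  show "dist_theta \<theta> x y = dist_theta \<theta> y x" by (simp add: dist_theta_def eq_commute)
  show "dist_theta \<theta> x y = 0 \<longleftrightarrow> x = y" using assms by (simp add: dist_theta_def)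
  show "dist_theta \<theta> x z \<le> dist_theta \<theta> x y + dist_theta \<theta> y z"
  proof (cases "x = y \<or> y = z \<or> x = z")
    case True
    then show ?thesis using assms by (auto simp: dist_theta_def)
  next
    case False
    define n where "n = (LEAST n. x n \<noteq> z n)"
    have "x n \<noteq> z n" unfolding n_def by (rule LeastI_ex) (use False in blast)
    then have "x n \<noteq> y n \<or> y n \<noteq> z n" by metis
    then have "(LEAST n. x n \<noteq> y n) \<le> n \<or> (LEAST n. y n \<noteq> z n) \<le> n"
      by (auto intro: Least_le)
    then have "\<theta> ^ n \<le> \<theta> ^ (LEAST n. x n \<noteq> y n) \<or> \<theta> ^ n \<le> \<theta> ^ (LEAST n. y n \<noteq> z n)"
      using assms by (auto intro!: power_decreasing)
    moreover have "0 \<le> \<theta> ^ (LEAST n. x n \<noteq> y n)" "0 \<le> \<theta> ^ (LEAST n. y n \<noteq> z n)"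
      using assms by auto
    ultimately have "\<theta> ^ n \<le> \<theta> ^ (LEAST n. x n \<noteq> y n) + \<theta> ^ (LEAST n. y n \<noteq> z n)"
      by linarith
    then show ?thesis using False by (simp add: dist_theta_def n_def)
  qed
qed

definition shift_topology :: "('s \<Rightarrow> 's \<Rightarrow> nat) \<Rightarrow> real \<Rightarrow> 's point topology" where
  "shift_topology A \<theta> = Metric_space.mtopology (full_shift A) (dist_theta \<theta>)"

definition shift_borel :: "('s \<Rightarrow> 's \<Rightarrow> nat) \<Rightarrow> real \<Rightarrow> 's point measure" where
  "shift_borel A \<theta> = sigma (full_shift A) {U. openin (shift_topology A \<theta>) U}"

definition topologically_mixing :: "'x topology \<Rightarrow> ('x \<Rightarrow> 'x) \<Rightarrow> bool" where
  "topologically_mixing T f \<longleftrightarrow>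
     (\<forall>U V. openin T U \<and> openin T V \<and> U \<noteq> {} \<and> V \<noteq> {} \<longrightarrow>
        (\<exists>N. \<forall>n\<ge>N. (f ^^ n) ` U \<inter> V \<noteq> {}))"

definition class_cylinders :: "('s \<Rightarrow> 's \<Rightarrow> nat) \<Rightarrow> (nat \<Rightarrow> 's set) \<Rightarrow> nat \<Rightarrow> 's point set" where
  "class_cylinders A D i = (\<Union>s\<in>D i. cylinder A [s])"

definition cyclic_decomposition ::
  "('s \<Rightarrow> 's \<Rightarrow> nat) \<Rightarrow> real \<Rightarrow> 's set \<Rightarrow> ('s \<Rightarrow> 's \<Rightarrow> nat) \<Rightarrow> nat \<Rightarrow> (nat \<Rightarrow> 's set) \<Rightarrow> bool"
where
  "cyclic_decomposition A \<theta> S0 M p D \<longleftrightarrow>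
     (\<Union>i<p. D i) = S0 \<and> disjoint_family_on D {..<p} \<and>
     (\<forall>i<p. shift ` (subshift S0 M \<inter> class_cylinders A D i)
              = subshift S0 M \<inter> class_cylinders A D (Suc i mod p)) \<and>
     (\<forall>i<p. topologically_mixing
              (subtopology (shift_topology A \<theta>) (subshift S0 M \<inter> class_cylinders A D i))
              (shift ^^ p))"


section \<open>Function spaces\<close>

text \<open>
  A function on the shift space \<open>X\<close> is represented by a total function vanishing off \<open>X\<close>, so that
  equality of functions on \<open>X\<close> is HOL equality.  Suprema that may be infinite are taken in
  \<^typ>\<open>ennreal\<close>.
\<close>

definition variation ::
  "('s \<Rightarrow> 's \<Rightarrow> nat) \<Rightarrow> nat \<Rightarrow> ('s point \<Rightarrow> 'b::real_normed_vector) \<Rightarrow> ennreal" where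
  "variation A n f =
     (SUP (\<omega>, \<upsilon>) \<in> {(\<omega>, \<upsilon>). \<omega> \<in> full_shift A \<and> \<upsilon> \<in> full_shift A \<and> (\<forall>i<n. \<omega> i = \<upsilon> i)}.
        ennreal (norm (f \<omega> - f \<upsilon>)))"

definition holder_seminorm ::
  "('s \<Rightarrow> 's \<Rightarrow> nat) \<Rightarrow> real \<Rightarrow> nat \<Rightarrow> ('s point \<Rightarrow> 'b::real_normed_vector) \<Rightarrow> ennreal" where
  "holder_seminorm A \<theta> k f = (SUP n\<in>{k..}. variation A n f / ennreal (\<theta> ^ n))"

definition sup_norm :: "('s \<Rightarrow> 's \<Rightarrow> nat) \<Rightarrow> ('s point \<Rightarrow> complex) \<Rightarrow> ennreal" where
  "sup_norm A f = (SUP \<omega>\<in>full_shift A. ennreal (norm (f \<omega>)))"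

definition cont_fun :: "('s \<Rightarrow> 's \<Rightarrow> nat) \<Rightarrow> real \<Rightarrow> ('s point \<Rightarrow> complex) set" where
  "cont_fun A \<theta> = {f. continuous_map (shift_topology A \<theta>) euclidean f \<and>
                      (\<forall>\<omega>. \<omega> \<notin> full_shift A \<longrightarrow> f \<omega> = 0)}"

definition bounded_cont_fun :: "('s \<Rightarrow> 's \<Rightarrow> nat) \<Rightarrow> real \<Rightarrow> ('s point \<Rightarrow> complex) set" where
  "bounded_cont_fun A \<theta> = {f \<in> cont_fun A \<theta>. sup_norm A f < \<infinity>}"

definition holder_fun :: "('s \<Rightarrow> 's \<Rightarrow> nat) \<Rightarrow> real \<Rightarrow> nat \<Rightarrow> ('s point \<Rightarrow> complex) set" where
  "holder_fun A \<theta> k = {f \<in> bounded_cont_fun A \<theta>. holder_seminorm A \<theta> k f < \<infinity>}"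

definition holder_norm ::
  "('s \<Rightarrow> 's \<Rightarrow> nat) \<Rightarrow> real \<Rightarrow> nat \<Rightarrow> ('s point \<Rightarrow> complex) \<Rightarrow> ennreal" where
  "holder_norm A \<theta> k f = sup_norm A f + holder_seminorm A \<theta> k f"

definition log_lipschitz_cone ::
  "('s \<Rightarrow> 's \<Rightarrow> nat) \<Rightarrow> real \<Rightarrow> nat \<Rightarrow> real \<Rightarrow> ('s point \<Rightarrow> complex) set" where
  "log_lipschitz_cone A \<theta> k c =
     {f \<in> cont_fun A \<theta>. (\<forall>\<omega>\<in>full_shift A. f \<omega> \<in> \<real>\<^sub>\<ge>\<^sub>0) \<and>
        (\<forall>\<omega>\<in>full_shift A. \<forall>\<upsilon>\<in>full_shift A. (\<forall>i<k. \<omega> i = \<upsilon> i) \<longrightarrow>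
           Re (f \<omega>) \<le> exp (c * dist_theta \<theta> \<omega> \<upsilon>) * Re (f \<upsilon>))}"


section \<open>Potential, pressure and transfer operator\<close>

text \<open>
  The first conjunct expresses that \<open>exp (sup\<^bsub>[s]\<^esub> \<phi>)\<close> is finite; the real-valued supremum is
  meaningless otherwise.
\<close>

definition summable_potential :: "('s \<Rightarrow> 's \<Rightarrow> nat) \<Rightarrow> ('s point \<Rightarrow> real) \<Rightarrow> bool" where
  "summable_potential A \<phi> \<longleftrightarrow>
     (\<forall>s. bdd_above (\<phi> ` cylinder A [s])) \<and>
     (\<lambda>s. exp (SUP \<omega>\<in>cylinder A [s]. \<phi> \<omega>)) summable_on {s. cylinder A [s] \<noteq> {}}"

definition birkhoff_sum :: "nat \<Rightarrow> ('s point \<Rightarrow> real) \<Rightarrow> 's point \<Rightarrow> real" where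
  "birkhoff_sum n \<phi> \<omega> = (\<Sum>i<n. \<phi> ((shift ^^ i) \<omega>))"

text \<open>
  For a summable potential and a nonempty \<open>subshift S0 M\<close> inside \<open>full_shift A\<close>, the suprema and
  the sums below are finite and the sums are positive; they are submultiplicative in \<open>n\<close>.
\<close>

definition partition_sum ::
  "('s \<Rightarrow> 's \<Rightarrow> nat) \<Rightarrow> 's set \<Rightarrow> ('s \<Rightarrow> 's \<Rightarrow> nat) \<Rightarrow> ('s point \<Rightarrow> real) \<Rightarrow> nat \<Rightarrow> real" where
  "partition_sum A S0 M \<phi> n =
     (\<Sum>\<^sub>\<infinity>w\<in>{w. length w = n \<and> set w \<subseteq> S0 \<and> cylinder A w \<inter> subshift S0 M \<noteq> {}}.
        exp (SUP \<omega>\<in>cylinder A w \<inter> subshift S0 M. birkhoff_sum n \<phi> \<omega>))"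

definition pressure ::
  "('s \<Rightarrow> 's \<Rightarrow> nat) \<Rightarrow> 's set \<Rightarrow> ('s \<Rightarrow> 's \<Rightarrow> nat) \<Rightarrow> ('s point \<Rightarrow> real) \<Rightarrow> real" where
  "pressure A S0 M \<phi> = lim (\<lambda>n. 1 / real n * ln (partition_sum A S0 M \<phi> n))"

definition transfer_op ::
  "('s \<Rightarrow> 's \<Rightarrow> nat) \<Rightarrow> ('s \<Rightarrow> 's \<Rightarrow> nat) \<Rightarrow> ('s point \<Rightarrow> real) \<Rightarrow>
   ('s point \<Rightarrow> complex) \<Rightarrow> ('s point \<Rightarrow> complex)" where
  "transfer_op A M \<phi> f \<omega> =
     (if \<omega> \<in> full_shift A
      then \<Sum>\<^sub>\<infinity>a\<in>{a. M a (\<omega> 0) = 1}. complex_of_real (exp (\<phi> (prepend a \<omega>))) * f (prepend a \<omega>)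
      else 0)"


section \<open>Operators on a normed space of complex functions\<close>

text \<open>
  \<open>V\<close> is a linear space of functions and \<open>N\<close> its norm (finite on \<open>V\<close>).
  Operators are only looked at on \<open>V\<close>.
\<close>

definition bounded_operator ::
  "('x \<Rightarrow> complex) set \<Rightarrow> (('x \<Rightarrow> complex) \<Rightarrow> ennreal) \<Rightarrow>
   (('x \<Rightarrow> complex) \<Rightarrow> ('x \<Rightarrow> complex)) \<Rightarrow> bool" where
  "bounded_operator V N T \<longleftrightarrow>
     (\<forall>f\<in>V. T f \<in> V) \<and>
     (\<forall>f\<in>V. \<forall>u\<in>V. \<forall>a b. T (\<lambda>x. a * f x + b * u x) = (\<lambda>x. a * T f x + b * T u x)) \<and>
     (\<exists>K::real. \<forall>f\<in>V. N (T f) \<le> ennreal K * N f)"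

definition op_minus_scalar ::
  "(('x \<Rightarrow> complex) \<Rightarrow> ('x \<Rightarrow> complex)) \<Rightarrow> complex \<Rightarrow> ('x \<Rightarrow> complex) \<Rightarrow> ('x \<Rightarrow> complex)" where
  "op_minus_scalar T z f = (\<lambda>x. T f x - z * f x)"

definition op_spectrum ::
  "('x \<Rightarrow> complex) set \<Rightarrow> (('x \<Rightarrow> complex) \<Rightarrow> ennreal) \<Rightarrow>
   (('x \<Rightarrow> complex) \<Rightarrow> ('x \<Rightarrow> complex)) \<Rightarrow> complex set" where
  "op_spectrum V N T =
     {z. \<not> (\<exists>B. bounded_operator V N B \<and>
               (\<forall>f\<in>V. B (op_minus_scalar T z f) = f \<and> op_minus_scalar T z (B f) = f))}"

definition spectral_radius ::
  "('x \<Rightarrow> complex) set \<Rightarrow> (('x \<Rightarrow> complex) \<Rightarrow> ennreal) \<Rightarrow>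
   (('x \<Rightarrow> complex) \<Rightarrow> ('x \<Rightarrow> complex)) \<Rightarrow> ennreal" where
  "spectral_radius V N T = (SUP z\<in>op_spectrum V N T. ennreal (norm z))"

definition eigenfunction ::
  "('x \<Rightarrow> complex) set \<Rightarrow> (('x \<Rightarrow> complex) \<Rightarrow> ('x \<Rightarrow> complex)) \<Rightarrow> complex \<Rightarrow>
   ('x \<Rightarrow> complex) \<Rightarrow> bool" where
  "eigenfunction V T z h \<longleftrightarrow> h \<in> V \<and> h \<noteq> (\<lambda>x. 0) \<and> T h = (\<lambda>x. z * h x)"

text \<open>Simple: algebraic multiplicity one, i.e. a one-dimensional generalised eigenspace.\<close>

definition simple_eigenvalue ::
  "('x \<Rightarrow> complex) set \<Rightarrow> (('x \<Rightarrow> complex) \<Rightarrow> ('x \<Rightarrow> complex)) \<Rightarrow> complex \<Rightarrow> bool" where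
  "simple_eigenvalue V T z \<longleftrightarrow>
     (\<exists>h. eigenfunction V T z h \<and>
          {f \<in> V. \<exists>n. (op_minus_scalar T z ^^ n) f = (\<lambda>x. 0)} = range (\<lambda>(c::complex) x. c * h x))"

definition dual_eigenvector ::
  "('x \<Rightarrow> complex) set \<Rightarrow> (('x \<Rightarrow> complex) \<Rightarrow> ('x \<Rightarrow> complex)) \<Rightarrow> complex \<Rightarrow>
   (('x \<Rightarrow> complex) \<Rightarrow> complex) \<Rightarrow> bool" where
  "dual_eigenvector V T z l \<longleftrightarrow> (\<exists>f\<in>V. l f \<noteq> 0) \<and> (\<forall>f\<in>V. l (T f) = z * l f)"

definition projection_operator ::
  "('x \<Rightarrow> complex) set \<Rightarrow> (('x \<Rightarrow> complex) \<Rightarrow> ennreal) \<Rightarrow>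
   (('x \<Rightarrow> complex) \<Rightarrow> ('x \<Rightarrow> complex)) \<Rightarrow> bool" where
  "projection_operator V N P \<longleftrightarrow> bounded_operator V N P \<and> (\<forall>f\<in>V. P (P f) = P f)"

definition tensor_op ::
  "('x \<Rightarrow> complex) \<Rightarrow> (('x \<Rightarrow> complex) \<Rightarrow> complex) \<Rightarrow> ('x \<Rightarrow> complex) \<Rightarrow> ('x \<Rightarrow> complex)" where
  "tensor_op h l f = (\<lambda>x. l f * h x)"


section \<open>Peripheral eigendata\<close>

definition root_kappa :: "nat \<Rightarrow> complex" where
  "root_kappa p = exp (2 * complex_of_real pi * \<i> / of_nat p)"

definition peripheral_eigenfun ::
  "('s \<Rightarrow> 's \<Rightarrow> nat) \<Rightarrow> (nat \<Rightarrow> 's set) \<Rightarrow> nat \<Rightarrow> ('s point \<Rightarrow> complex) \<Rightarrow> nat \<Rightarrow>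
   's point \<Rightarrow> complex" where
  "peripheral_eigenfun A D p h i \<omega> =
     (\<Sum>j<p. root_kappa p powi (- int (j * i)) * h \<omega> * indicator (class_cylinders A D j) \<omega>)"

text \<open>
  A complex combination of finite measures is represented by its integration functional
  \<open>f \<mapsto> \<integral>f d\<nu>\<^sub>i\<close>.
\<close>

definition peripheral_eigenmeasure ::
  "('s \<Rightarrow> 's \<Rightarrow> nat) \<Rightarrow> (nat \<Rightarrow> 's set) \<Rightarrow> nat \<Rightarrow> 's point measure \<Rightarrow> nat \<Rightarrow>
   ('s point \<Rightarrow> complex) \<Rightarrow> complex" where
  "peripheral_eigenmeasure A D p \<nu> i f =
     (\<Sum>j<p. root_kappa p ^ (j * i) *
        (LINT \<omega>|restrict_space \<nu> (class_cylinders A D j). f \<omega>))"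

end

theory Submission
  imports Defs
begin

text \<open>
  After replacing \<open>\<phi>\<close> by \<open>\<phi> - ln \<lambda>\<close> one may assume \<open>\<lambda> = 1\<close>, so that \<open>\<nu>\<close> is invariant under the transfer
  operator.  Since the alphabet may be infinite, \<open>g\<close> need not be bounded away from zero, and the
  decay of correlations is obtained by a coupling argument in the style of Harris' theorem.
  Summability of \<open>\<phi>\<close> makes all but finitely many \<open>k\<close>-cylinders negligible after \<open>k\<close> steps; on each
  remaining cylinder a function \<open>u\<close> of the invariant log-Lipschitz cone is controlled by \<open>\<nu>(u)\<close>.
  This gives the drift estimate \<open>T\<^sup>n u \<le> sup u / 4 + K \<nu>(u)\<close>, and topological mixing of \<open>\<sigma>\<^sup>p\<close> on a
  cyclic class gives a minorisation \<open>T\<^sup>n u \<ge> \<eta> \<nu>(u)\<close> on a fixed cylinder.  Subtracting the common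
  part from two cone functions with the same integral and iterating, their difference decays
  exponentially in the H\<ouml>lder norm.  Every H\<ouml>lder function of integral zero on a cyclic class is
  such a difference.  A function annihilated by all \<open>\<nu>\<^sub>i\<close> has integral zero on every cyclic class by
  Fourier inversion on the cyclic group of order \<open>p\<close>, so the powers of the remainder decay at a
  rate below \<open>\<lambda>\<close>, and the Neumann series bounds its spectral radius.
\<close>

section \<open>Metric and H\<ouml>lder bounds\<close>

text \<open>The operator acts on functions on all of \<open>X\<close>, while \<nu> lives on the
  smaller set \<open>X_M\<close>. The link is that sums over preimages use only transitions allowed
  by \<open>M\<close>: up to a small error, only \<open>k\<close>-cylinders that meet
  \<open>X_M\<close> matter after \<open>k\<close> steps, each of these has positive mass, and on
  the whole cylinder in \<open>X\<close> a cone function is comparable to its mean. In this way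
  \<nu>(u) controls sup norms even off \<open>X_M\<close>. The common part removed in the coupling
  cannot be a constant, since no lower bound holds uniformly on \<open>X\<close>; it is placed on a
  single cylinder. For the step to be repeatable, the class of functions must be stable, and this is
  the role of the condition \<open>sup u \<le> B * \<nu>(u)\<close>: if
  \<open>B \<ge> 4 * K\<close>, the drift factor 1/4 brings the sup down to half of
  \<open>B * \<nu>(u)\<close>, while the subtraction leaves at least half of the integral. The time
  of a step is a multiple of \<open>p\<close>, so that supports return to their cyclic
  class.\<close>

definition agree :: "nat \<Rightarrow> 's point \<Rightarrow> 's point \<Rightarrow> bool" where
  "agree n \<omega> \<upsilon> \<longleftrightarrow> (\<forall>i<n. \<omega> i = \<upsilon> i)"

lemma agree_refl [simp]: "agree n \<omega> \<omega>"
  by (simp add: agree_def)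

lemma agree_sym: "agree n \<omega> \<upsilon> \<Longrightarrow> agree n \<upsilon> \<omega>"
  by (simp add: agree_def)

lemma agree_trans: "agree n \<omega> \<upsilon> \<Longrightarrow> agree n \<upsilon> \<tau> \<Longrightarrow> agree n \<omega> \<tau>"
  by (simp add: agree_def)

lemma prepend_0 [simp]: "prepend a \<omega> 0 = a"
  by (simp add: prepend_def)

lemma prepend_Suc [simp]: "prepend a \<omega> (Suc n) = \<omega> n"
  by (simp add: prepend_def)

lemma shift_prepend [simp]: "shift (prepend a \<omega>) = \<omega>"
  by (simp add: shift_def)

lemma prepend_shift: "prepend (\<omega> 0) (shift \<omega>) = \<omega>"
  by (rule ext) (simp add: prepend_def shift_def split: nat.split)

lemma agree_prepend: "agree n \<omega> \<upsilon> \<Longrightarrow> agree (Suc n) (prepend a \<omega>) (prepend a \<upsilon>)"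
  by (auto simp: agree_def less_Suc_eq_0_disj)

lemma shift_pow_apply: "(shift ^^ n) \<omega> i = \<omega> (n + i)"
  by (induction n arbitrary: i) (auto simp: shift_def)

lemma dist_theta_refl [simp]: "dist_theta \<theta> \<omega> \<omega> = 0"
  by (simp add: dist_theta_def)

lemma dist_theta_nonneg: "0 < \<theta> \<Longrightarrow> 0 \<le> dist_theta \<theta> \<omega> \<upsilon>"
  by (simp add: dist_theta_def)

lemma dist_theta_commute: "dist_theta \<theta> \<omega> \<upsilon> = dist_theta \<theta> \<upsilon> \<omega>"
  by (simp add: dist_theta_def eq_commute)

lemma dist_theta_le_power:
  assumes "0 < \<theta>" "\<theta> < 1" "agree n \<omega> \<upsilon>"
  shows "dist_theta \<theta> \<omega> \<upsilon> \<le> \<theta> ^ n"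
proof (cases "\<omega> = \<upsilon>")
  case False
  then have "\<exists>i. \<omega> i \<noteq> \<upsilon> i" by blast
  then have "\<omega> (LEAST i. \<omega> i \<noteq> \<upsilon> i) \<noteq> \<upsilon> (LEAST i. \<omega> i \<noteq> \<upsilon> i)"
    by (rule LeastI_ex)
  then have "n \<le> (LEAST i. \<omega> i \<noteq> \<upsilon> i)"
    using assms(3) by (meson agree_def not_le)
  then show ?thesis using False assms by (simp add: dist_theta_def power_decreasing)
qed (use assms in simp)

lemma dist_theta_le_1: "0 < \<theta> \<Longrightarrow> \<theta> < 1 \<Longrightarrow> dist_theta \<theta> \<omega> \<upsilon> \<le> 1"
  using dist_theta_le_power[of \<theta> 0 \<omega> \<upsilon>] by (simp add: agree_def)

lemma dist_theta_first_difference: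
  assumes "\<omega> \<noteq> \<upsilon>"
  obtains n where "agree n \<omega> \<upsilon>" "\<omega> n \<noteq> \<upsilon> n" "dist_theta \<theta> \<omega> \<upsilon> = \<theta> ^ n"
proof
  let ?n = "LEAST i. \<omega> i \<noteq> \<upsilon> i"
  show "agree ?n \<omega> \<upsilon>" by (auto simp: agree_def dest: not_less_Least)
  show "\<omega> ?n \<noteq> \<upsilon> ?n" by (rule LeastI_ex) (use assms in blast)
  show "dist_theta \<theta> \<omega> \<upsilon> = \<theta> ^ ?n" using assms by (simp add: dist_theta_def)
qed

lemma dist_theta_prepend: "dist_theta \<theta> (prepend a \<omega>) (prepend a \<upsilon>) = \<theta> * dist_theta \<theta> \<omega> \<upsilon>"
proof (cases "\<omega> = \<upsilon>")
  case False
  then have ne: "prepend a \<omega> \<noteq> prepend a \<upsilon>" by (metis shift_prepend)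
  from False obtain m where "\<omega> m \<noteq> \<upsilon> m" by blast
  then have "(LEAST n. prepend a \<omega> n \<noteq> prepend a \<upsilon> n) = Suc (LEAST n. prepend a \<omega> (Suc n) \<noteq> prepend a \<upsilon> (Suc n))"
    by (intro Least_Suc[where n = "Suc m"]) simp_all
  then show ?thesis using False ne by (simp add: dist_theta_def)
qed simp

text \<open>One real number bounds both the sup norm and the Lipschitz constant on
  \<open>k\<close>-cylinders. This agrees with the Hoelder norm up to a factor 2 and avoids suprema
  in \<open>ennreal\<close> during the analysis. Values off \<open>X\<close> do not enter.\<close>

definition holder_bound ::
  "('s \<Rightarrow> 's \<Rightarrow> nat) \<Rightarrow> real \<Rightarrow> nat \<Rightarrow> real \<Rightarrow> ('s point \<Rightarrow> 'b::real_normed_vector) \<Rightarrow> bool" where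
  "holder_bound A \<theta> k b f \<longleftrightarrow>
     (\<forall>\<omega>\<in>full_shift A. norm (f \<omega>) \<le> b) \<and>
     (\<forall>\<omega>\<in>full_shift A. \<forall>\<upsilon>\<in>full_shift A. agree k \<omega> \<upsilon> \<longrightarrow>
        norm (f \<omega> - f \<upsilon>) \<le> b * dist_theta \<theta> \<omega> \<upsilon>)"

lemma holder_boundI:
  assumes "\<And>\<omega>. \<omega> \<in> full_shift A \<Longrightarrow> norm (f \<omega>) \<le> b"
    and "\<And>\<omega> \<upsilon>. \<omega> \<in> full_shift A \<Longrightarrow> \<upsilon> \<in> full_shift A \<Longrightarrow> agree k \<omega> \<upsilon> \<Longrightarrow>
           norm (f \<omega> - f \<upsilon>) \<le> b * dist_theta \<theta> \<omega> \<upsilon>"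
  shows "holder_bound A \<theta> k b f"
  using assms by (simp add: holder_bound_def)

lemma holder_boundD:
  assumes "holder_bound A \<theta> k b f"
  shows "\<And>\<omega>. \<omega> \<in> full_shift A \<Longrightarrow> norm (f \<omega>) \<le> b"
    and "\<And>\<omega> \<upsilon>. \<omega> \<in> full_shift A \<Longrightarrow> \<upsilon> \<in> full_shift A \<Longrightarrow> agree k \<omega> \<upsilon> \<Longrightarrow>
           norm (f \<omega> - f \<upsilon>) \<le> b * dist_theta \<theta> \<omega> \<upsilon>"
  using assms by (auto simp: holder_bound_def)

lemma holder_bound_cong:
  assumes "\<And>\<omega>. \<omega> \<in> full_shift A \<Longrightarrow> f \<omega> = f' \<omega>"
  shows "holder_bound A \<theta> k b f \<longleftrightarrow> holder_bound A \<theta> k b f'"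
  using assms by (simp add: holder_bound_def)

lemma holder_bound_mono:
  assumes "holder_bound A \<theta> k b f" "b \<le> b'" "0 < \<theta>"
  shows "holder_bound A \<theta> k b' f"
proof (rule holder_boundI)
  fix \<omega> \<upsilon> assume "\<omega> \<in> full_shift A" "\<upsilon> \<in> full_shift A" "agree k \<omega> \<upsilon>"
  then have "norm (f \<omega> - f \<upsilon>) \<le> b * dist_theta \<theta> \<omega> \<upsilon>" using holder_boundD(2)[OF assms(1)] by blast
  also have "\<dots> \<le> b' * dist_theta \<theta> \<omega> \<upsilon>"
    using assms by (simp add: mult_right_mono dist_theta_nonneg)
  finally show "norm (f \<omega> - f \<upsilon>) \<le> b' * dist_theta \<theta> \<omega> \<upsilon>" .
qed (rule order_trans[OF holder_boundD(1)[OF assms(1)] assms(2)])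

lemma holder_bound_add:
  assumes "holder_bound A \<theta> k b f" "holder_bound A \<theta> k b' f'"
  shows "holder_bound A \<theta> k (b + b') (\<lambda>\<omega>. f \<omega> + f' \<omega>)"
proof (rule holder_boundI)
  fix \<omega> assume "\<omega> \<in> full_shift A"
  then show "norm (f \<omega> + f' \<omega>) \<le> b + b'"
    using holder_boundD(1)[OF assms(1)] holder_boundD(1)[OF assms(2)]
    by (meson add_mono norm_triangle_le)
next
  fix \<omega> \<upsilon> assume "\<omega> \<in> full_shift A" "\<upsilon> \<in> full_shift A" "agree k \<omega> \<upsilon>"
  then have "norm (f \<omega> - f \<upsilon>) + norm (f' \<omega> - f' \<upsilon>) \<le> (b + b') * dist_theta \<theta> \<omega> \<upsilon>"
    using holder_boundD(2)[OF assms(1)] holder_boundD(2)[OF assms(2)]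
    by (simp add: distrib_right add_mono)
  moreover have "norm ((f \<omega> + f' \<omega>) - (f \<upsilon> + f' \<upsilon>)) \<le> norm (f \<omega> - f \<upsilon>) + norm (f' \<omega> - f' \<upsilon>)"
    by (metis add_diff_add norm_triangle_ineq)
  ultimately show "norm ((f \<omega> + f' \<omega>) - (f \<upsilon> + f' \<upsilon>)) \<le> (b + b') * dist_theta \<theta> \<omega> \<upsilon>" by linarith
qed

lemma holder_bound_scale:
  fixes f :: "'s point \<Rightarrow> 'b::real_normed_field"
  assumes "holder_bound A \<theta> k b f"
  shows "holder_bound A \<theta> k (norm c * b) (\<lambda>\<omega>. c * f \<omega>)"
proof (rule holder_boundI)
  fix \<omega> \<upsilon> assume "\<omega> \<in> full_shift A" "\<upsilon> \<in> full_shift A" "agree k \<omega> \<upsilon>"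
  then have "norm c * norm (f \<omega> - f \<upsilon>) \<le> norm c * (b * dist_theta \<theta> \<omega> \<upsilon>)"
    using holder_boundD(2)[OF assms(1)] by (simp add: mult_left_mono)
  then show "norm (c * f \<omega> - c * f \<upsilon>) \<le> norm c * b * dist_theta \<theta> \<omega> \<upsilon>"
    by (simp add: norm_mult flip: right_diff_distrib)
qed (use holder_boundD(1)[OF assms] in \<open>simp add: norm_mult mult_left_mono\<close>)

lemma holder_bound_diff:
  fixes f :: "'s point \<Rightarrow> 'b::real_normed_field"
  assumes "holder_bound A \<theta> k b f" "holder_bound A \<theta> k b' f'"
  shows "holder_bound A \<theta> k (b + b') (\<lambda>\<omega>. f \<omega> - f' \<omega>)"
  using holder_bound_add[OF assms(1) holder_bound_scale[OF assms(2), of "-1"]] by simp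

lemma holder_bound_sum:
  fixes f :: "'i \<Rightarrow> 's point \<Rightarrow> 'b::real_normed_field"
  assumes "finite I" "\<And>i. i \<in> I \<Longrightarrow> holder_bound A \<theta> k (b i) (f i)"
  shows "holder_bound A \<theta> k (\<Sum>i\<in>I. b i) (\<lambda>\<omega>. \<Sum>i\<in>I. f i \<omega>)"
  using assms
proof (induction I)
  case (insert i I)
  then show ?case using holder_bound_add[of A \<theta> k "b i" "f i" "sum b I"] by simp
qed (simp add: holder_bound_def)

text \<open>Only points of the same \<open>k\<close>-cylinder are compared, and \<open>E\<close> is
  a union of such cylinders, so the two indicators in a comparison agree.\<close>

lemma holder_bound_restrict:
  fixes f :: "'s point \<Rightarrow> 'b::real_normed_field"
  assumes "holder_bound A \<theta> k b f" "0 \<le> b" "0 < \<theta>"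
    and "\<And>\<omega> \<upsilon>. agree k \<omega> \<upsilon> \<Longrightarrow> \<omega> \<in> E \<longleftrightarrow> \<upsilon> \<in> E"
  shows "holder_bound A \<theta> k b (\<lambda>\<omega>. f \<omega> * indicator E \<omega>)"
proof (rule holder_boundI)
  fix \<omega> \<upsilon> assume a: "\<omega> \<in> full_shift A" "\<upsilon> \<in> full_shift A" "agree k \<omega> \<upsilon>"
  then have eq: "\<omega> \<in> E \<longleftrightarrow> \<upsilon> \<in> E" using assms(4) by blast
  show "norm (f \<omega> * indicator E \<omega> - f \<upsilon> * indicator E \<upsilon>) \<le> b * dist_theta \<theta> \<omega> \<upsilon>"
    using eq holder_boundD(2)[OF assms(1) a] assms(2,3)
    by (cases "\<omega> \<in> E") (auto simp: dist_theta_nonneg)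
qed (use holder_boundD(1)[OF assms(1)] assms(2) in \<open>auto split: split_indicator\<close>)

lemma holder_bound_const:
  fixes c :: "'b::real_normed_field"
  assumes "0 < \<theta>"
  shows "holder_bound A \<theta> k (norm c) (\<lambda>\<omega>. c)"
  using assms by (auto simp: holder_bound_def dist_theta_nonneg)

lemma holder_bound_indicator:
  assumes "0 < \<theta>" and "\<And>\<omega> \<upsilon>. agree k \<omega> \<upsilon> \<Longrightarrow> \<omega> \<in> E \<longleftrightarrow> \<upsilon> \<in> E"
  shows "holder_bound A \<theta> k 1 (indicator E :: 's point \<Rightarrow> 'b::real_normed_field)"
  using holder_bound_restrict[OF holder_bound_const[OF assms(1), of A k "1::'b"] _ assms(1), of E] assms(2)
  by simp

section \<open>The real transfer operator\<close>

text \<open>Keeps conditions such as \<open>M a b = 1\<close>, an equation between natural numbers, in that form.\<close>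

declare One_nat_def [simp del]

text \<open>The weights are real, so the complex operator acts on real and imaginary parts by this
  one; working over the reals makes order and cones available.\<close>

definition real_transfer ::
  "('s \<Rightarrow> 's \<Rightarrow> nat) \<Rightarrow> ('s \<Rightarrow> 's \<Rightarrow> nat) \<Rightarrow> ('s point \<Rightarrow> real) \<Rightarrow> ('s point \<Rightarrow> real) \<Rightarrow> 's point \<Rightarrow> real"
where
  "real_transfer A M \<phi> u \<omega> =
     (if \<omega> \<in> full_shift A
      then \<Sum>\<^sub>\<infinity>a\<in>{a. M a (\<omega> 0) = 1}. exp (\<phi> (prepend a \<omega>)) * u (prepend a \<omega>) else 0)"

lemma shift_in_full_shift: "\<omega> \<in> full_shift A \<Longrightarrow> shift \<omega> \<in> full_shift A"
  by (simp add: subshift_def shift_def)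

lemma shift_pow_in_full_shift: "\<omega> \<in> full_shift A \<Longrightarrow> (shift ^^ n) \<omega> \<in> full_shift A"
  by (induction n) (auto intro: shift_in_full_shift)

text \<open>To be used with the potential after subtraction of \<open>ln lam\<close>. The majorant
  \<open>e\<close> of the weights depends on the first letter only and makes all sums over preimages
  converge uniformly. Two points of one \<open>k\<close>-cylinder share \<open>k + 1\<close> letters
  once a letter is prepended, which is why \<phi> is compared on
  \<open>k + 1\<close>-cylinders.\<close>

locale transfer_system =
  fixes A M :: "'s \<Rightarrow> 's \<Rightarrow> nat" and \<theta> :: real and k :: nat
    and \<phi> :: "'s point \<Rightarrow> real" and \<Phi> :: real and e :: "'s \<Rightarrow> real"
  assumes theta: "0 < \<theta>" "\<theta> < 1" and k_ge_1: "1 \<le> k"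
    and M_imp_A: "M a b = 1 \<Longrightarrow> A a b = 1"
    and e_nonneg: "0 \<le> e a" and e_summable: "e summable_on UNIV"
    and exp_le_e: "\<omega> \<in> full_shift A \<Longrightarrow> exp (\<phi> \<omega>) \<le> e (\<omega> 0)"
    and Phi_nonneg: "0 \<le> \<Phi>"
    and phi_holder: "\<omega> \<in> full_shift A \<Longrightarrow> \<upsilon> \<in> full_shift A \<Longrightarrow> agree (Suc k) \<omega> \<upsilon> \<Longrightarrow>
                       \<phi> \<omega> - \<phi> \<upsilon> \<le> \<Phi> * dist_theta \<theta> \<omega> \<upsilon>"
begin

abbreviation "X \<equiv> full_shift A"
abbreviation "T \<equiv> real_transfer A M \<phi>"
abbreviation "d \<equiv> dist_theta \<theta>"

text \<open>The summand 1 ensures \<open>1 \<le> E\<close>, so that powers of \<open>E\<close>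
  increase and may absorb missing factors.\<close>

definition E :: real where "E = (\<Sum>\<^sub>\<infinity>a. e a) + 1"

definition bounded_by :: "real \<Rightarrow> ('s point \<Rightarrow> real) \<Rightarrow> bool" where
  "bounded_by b u \<longleftrightarrow> (\<forall>\<omega>\<in>X. \<bar>u \<omega>\<bar> \<le> b)"

lemma bounded_byI: "(\<And>\<omega>. \<omega> \<in> X \<Longrightarrow> \<bar>u \<omega>\<bar> \<le> b) \<Longrightarrow> bounded_by b u"
  by (simp add: bounded_by_def)

lemma bounded_byD: "bounded_by b u \<Longrightarrow> \<omega> \<in> X \<Longrightarrow> \<bar>u \<omega>\<bar> \<le> b"
  by (simp add: bounded_by_def)

lemma E_ge_1: "1 \<le> E"
  unfolding E_def using e_nonneg by (simp add: infsum_nonneg)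

lemma prepend_in_X: "\<omega> \<in> X \<Longrightarrow> M a (\<omega> 0) = 1 \<Longrightarrow> prepend a \<omega> \<in> X"
  by (auto simp: subshift_def prepend_def M_imp_A split: nat.split)

lemma d_nonneg [simp]: "0 \<le> d \<omega> \<upsilon>" and d_le_1: "d \<omega> \<upsilon> \<le> 1"
  using theta by (auto simp: dist_theta_nonneg dist_theta_le_1)

lemma agree_0: "agree k \<omega> \<upsilon> \<Longrightarrow> \<omega> 0 = \<upsilon> 0"
  using k_ge_1 by (simp add: agree_def)

lemma summand_bound:
  assumes "bounded_by b u" "\<omega> \<in> X" "M a (\<omega> 0) = 1"
  shows "\<bar>exp (\<phi> (prepend a \<omega>)) * u (prepend a \<omega>)\<bar> \<le> e a * b"
proof -
  note p = prepend_in_X[OF assms(2,3)]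
  have "\<bar>u (prepend a \<omega>)\<bar> \<le> b" using assms(1) p by (auto simp: bounded_by_def)
  then show ?thesis
    using exp_le_e[OF p] e_nonneg by (simp add: abs_mult mult_mono)
qed

lemma e_summable_on: "(\<lambda>a. e a * b) summable_on S"
  by (rule summable_on_subset_banach[OF summable_on_cmult_left[OF e_summable]]) simp

lemma infsum_e_le: "0 \<le> b \<Longrightarrow> (\<Sum>\<^sub>\<infinity>a\<in>S. e a * b) \<le> E * b"
proof -
  assume b: "0 \<le> b"
  have "(\<Sum>\<^sub>\<infinity>a\<in>S. e a * b) \<le> (\<Sum>\<^sub>\<infinity>a. e a * b)"
    by (rule infsum_mono_neutral) (use e_summable_on e_nonneg b in auto)
  also have "\<dots> = (\<Sum>\<^sub>\<infinity>a. e a) * b" by (rule infsum_cmult_left) (rule e_summable)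
  also have "\<dots> \<le> E * b" using b by (simp add: E_def mult_right_mono)
  finally show ?thesis .
qed

lemma T_abs_summable:
  assumes "bounded_by b u" "\<omega> \<in> X"
  shows "(\<lambda>a. norm (exp (\<phi> (prepend a \<omega>)) * u (prepend a \<omega>))) summable_on {a. M a (\<omega> 0) = 1}"
  by (rule summable_on_comparison_test[OF e_summable_on[of b]]) (use summand_bound[OF assms] in auto)

lemma T_summable:
  assumes "bounded_by b u" "\<omega> \<in> X"
  shows "(\<lambda>a. exp (\<phi> (prepend a \<omega>)) * u (prepend a \<omega>)) summable_on {a. M a (\<omega> 0) = 1}"
  using T_abs_summable[OF assms] by (rule abs_summable_summable)

lemma T_mono:
  assumes "bounded_by b u" "bounded_by b' v" "\<And>\<omega>. \<omega> \<in> X \<Longrightarrow> u \<omega> \<le> v \<omega>"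
  shows "T u \<omega> \<le> T v \<omega>"
proof (cases "\<omega> \<in> X")
  case True
  then show ?thesis unfolding real_transfer_def
    using T_summable[OF assms(1) True] T_summable[OF assms(2) True] assms(3) prepend_in_X
    by (auto intro!: infsum_mono)
qed (simp add: real_transfer_def)

lemma T_cong:
  assumes "\<And>\<omega>. \<omega> \<in> X \<Longrightarrow> u \<omega> = v \<omega>"
  shows "T u = T v"
  by (rule ext) (use assms prepend_in_X in \<open>auto simp: real_transfer_def intro!: infsum_cong\<close>)

lemma T_linear:
  assumes "bounded_by b u" "bounded_by b' v"
  shows "T (\<lambda>\<omega>. s * u \<omega> + t * v \<omega>) \<omega> = s * T u \<omega> + t * T v \<omega>"
proof (cases "\<omega> \<in> X")
  case True
  let ?S = "{a. M a (\<omega> 0) = 1}"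
  note su = T_summable[OF assms(1) True] and sv = T_summable[OF assms(2) True]
  have "T (\<lambda>\<omega>. s * u \<omega> + t * v \<omega>) \<omega> =
     (\<Sum>\<^sub>\<infinity>a\<in>?S. s * (exp (\<phi> (prepend a \<omega>)) * u (prepend a \<omega>)) + t * (exp (\<phi> (prepend a \<omega>)) * v (prepend a \<omega>)))"
    using True by (simp add: real_transfer_def algebra_simps)
  also have "\<dots> = s * T u \<omega> + t * T v \<omega>"
    using True su sv by (simp add: real_transfer_def infsum_add infsum_cmult_right summable_on_cmult_right)
  finally show ?thesis .
qed (simp add: real_transfer_def)

lemma T_bounded:
  assumes "bounded_by b u" "0 \<le> b"
  shows "bounded_by (E * b) (T u)"
  unfolding bounded_by_def
proof
  fix \<omega> assume w: "\<omega> \<in> X"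
  let ?S = "{a. M a (\<omega> 0) = 1}"
  have "\<bar>T u \<omega>\<bar> \<le> (\<Sum>\<^sub>\<infinity>a\<in>?S. \<bar>exp (\<phi> (prepend a \<omega>)) * u (prepend a \<omega>)\<bar>)"
    using norm_infsum_bound[OF T_abs_summable[OF assms(1) w]] w by (simp add: real_transfer_def)
  also have "\<dots> \<le> (\<Sum>\<^sub>\<infinity>a\<in>?S. e a * b)"
    using T_abs_summable[OF assms(1) w] summand_bound[OF assms(1) w]
    by (intro infsum_mono e_summable_on) auto
  also have "\<dots> \<le> E * b" using assms(2) by (rule infsum_e_le)
  finally show "\<bar>T u \<omega>\<bar> \<le> E * b" .
qed

section \<open>Powers of the transfer operator as positive linear maps\<close>

lemma T_pow_bounded:
  assumes "bounded_by b u" "0 \<le> b"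
  shows "bounded_by (E ^ n * b) ((T ^^ n) u)"
proof (induction n)
  case (Suc n)
  have "0 \<le> E ^ n * b" using E_ge_1 assms(2) by simp
  from T_bounded[OF Suc this] show ?case by (simp add: mult.assoc)
qed (use assms in simp)

lemma bounded_by_nonneg: "bounded_by b u \<Longrightarrow> \<omega> \<in> X \<Longrightarrow> 0 \<le> b"
  by (meson abs_ge_zero bounded_byD order_trans)

lemma bounded_by_mono: "bounded_by b u \<Longrightarrow> b \<le> b' \<Longrightarrow> bounded_by b' u"
  by (meson bounded_byD bounded_byI order_trans)

lemma bounded_by_abs: "bounded_by b u \<Longrightarrow> bounded_by \<bar>b\<bar> u"
  by (erule bounded_by_mono) simp

lemma T_pow_bounded': "bounded_by b u \<Longrightarrow> \<exists>b'. bounded_by b' ((T ^^ n) u)"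
  using T_pow_bounded[OF bounded_by_abs] by auto

lemma bounded_by_linear:
  assumes "bounded_by b u" "bounded_by b' v"
  shows "bounded_by (\<bar>s\<bar> * b + \<bar>t\<bar> * b') (\<lambda>\<omega>. s * u \<omega> + t * v \<omega>)"
  unfolding bounded_by_def
proof
  fix \<omega> assume "\<omega> \<in> X"
  then have "\<bar>s\<bar> * \<bar>u \<omega>\<bar> \<le> \<bar>s\<bar> * b" "\<bar>t\<bar> * \<bar>v \<omega>\<bar> \<le> \<bar>t\<bar> * b'"
    using bounded_byD[OF assms(1)] bounded_byD[OF assms(2)] by (simp_all add: mult_left_mono)
  then show "\<bar>s * u \<omega> + t * v \<omega>\<bar> \<le> \<bar>s\<bar> * b + \<bar>t\<bar> * b'"
    using abs_triangle_ineq[of "s * u \<omega>" "t * v \<omega>"] by (simp add: abs_mult)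
qed

lemma T_pow_mono:
  assumes "bounded_by b u" "bounded_by b' v" "\<And>\<omega>. \<omega> \<in> X \<Longrightarrow> u \<omega> \<le> v \<omega>" "\<omega> \<in> X"
  shows "(T ^^ n) u \<omega> \<le> (T ^^ n) v \<omega>"
  using assms(4)
proof (induction n arbitrary: \<omega>)
  case (Suc n)
  obtain c c' where "bounded_by c ((T ^^ n) u)" "bounded_by c' ((T ^^ n) v)"
    using T_pow_bounded'[OF assms(1)] T_pow_bounded'[OF assms(2)] by blast
  from T_mono[OF this Suc.IH] show ?case by simp
qed (use assms in simp)

lemma T_pow_cong:
  assumes "\<And>\<omega>. \<omega> \<in> X \<Longrightarrow> u \<omega> = v \<omega>" "\<omega> \<in> X"
  shows "(T ^^ n) u \<omega> = (T ^^ n) v \<omega>"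
proof (cases n)
  case (Suc m)
  then show ?thesis using T_cong[OF assms(1)] by (simp add: funpow_swap1)
qed (use assms in simp)

lemma T_pow_linear:
  assumes "bounded_by b u" "bounded_by b' v" "\<omega> \<in> X"
  shows "(T ^^ n) (\<lambda>\<omega>. s * u \<omega> + t * v \<omega>) \<omega> = s * (T ^^ n) u \<omega> + t * (T ^^ n) v \<omega>"
  using assms(3)
proof (induction n arbitrary: \<omega>)
  case (Suc n)
  obtain c c' where "bounded_by c ((T ^^ n) u)" "bounded_by c' ((T ^^ n) v)"
    using T_pow_bounded'[OF assms(1)] T_pow_bounded'[OF assms(2)] by blast
  from T_linear[OF this] T_cong[OF Suc.IH] show ?case by simp
qed simp

lemma T_pow_scale:
  assumes "bounded_by b u" "\<omega> \<in> X"
  shows "(T ^^ n) (\<lambda>\<omega>. s * u \<omega>) \<omega> = s * (T ^^ n) u \<omega>"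
  using T_pow_linear[OF assms(1,1,2), of n s 0] by simp

lemma T_pow_diff:
  assumes "bounded_by b u" "bounded_by b' v" "\<omega> \<in> X"
  shows "(T ^^ n) (\<lambda>\<omega>. u \<omega> - v \<omega>) \<omega> = (T ^^ n) u \<omega> - (T ^^ n) v \<omega>"
  using T_pow_linear[OF assms, of n 1 "-1"] by simp

lemma T_pow_nonneg:
  assumes "bounded_by b u" "\<And>\<omega>. \<omega> \<in> X \<Longrightarrow> 0 \<le> u \<omega>" "\<omega> \<in> X"
  shows "0 \<le> (T ^^ n) u \<omega>"
proof -
  have "bounded_by 0 (\<lambda>_. 0)" by (simp add: bounded_by_def)
  from T_pow_mono[OF this assms, of n] T_pow_linear[OF this this assms(3), of n 0 0] show ?thesis by simp
qed

lemma T_pow_sum: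
  assumes "finite I" "\<And>i. i \<in> I \<Longrightarrow> \<exists>b. bounded_by b (u i)" "\<omega> \<in> X"
  shows "(T ^^ n) (\<lambda>\<omega>. \<Sum>i\<in>I. u i \<omega>) \<omega> = (\<Sum>i\<in>I. (T ^^ n) (u i) \<omega>) \<and> (\<exists>b. bounded_by b (\<lambda>\<omega>. \<Sum>i\<in>I. u i \<omega>))"
  using assms(1,2)
proof (induction I)
  case empty
  have "bounded_by 0 (\<lambda>_. 0)" by (simp add: bounded_by_def)
  from this T_pow_linear[OF this this assms(3), of n 0 0] show ?case by auto
next
  case (insert i I)
  then obtain b where "bounded_by b (u i)" by auto
  moreover obtain b' where "bounded_by b' (\<lambda>\<omega>. \<Sum>i\<in>I. u i \<omega>)" using insert by auto
  ultimately have bb: "bounded_by b (u i)" "bounded_by b' (\<lambda>\<omega>. \<Sum>i\<in>I. u i \<omega>)" by auto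
  from T_pow_linear[OF bb assms(3), of n 1 1] bounded_by_linear[OF bb, of 1 1] insert show ?case
    by auto
qed

lemma T_ge_summand:
  assumes "bounded_by b u" "\<And>\<omega>. \<omega> \<in> X \<Longrightarrow> 0 \<le> u \<omega>" "\<omega> \<in> X" "M a (\<omega> 0) = 1"
  shows "exp (\<phi> (prepend a \<omega>)) * u (prepend a \<omega>) \<le> T u \<omega>"
proof -
  have "(\<Sum>\<^sub>\<infinity>a\<in>{a}. exp (\<phi> (prepend a \<omega>)) * u (prepend a \<omega>)) \<le> T u \<omega>"
    unfolding real_transfer_def if_P[OF assms(3)]
    using assms(4) T_summable[OF assms(1,3)] assms(2)[OF prepend_in_X[OF assms(3)]]
    by (intro infsum_mono_neutral) simp_all
  then show ?thesis by simp
qed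

text \<open>Among the preimages summed over at \<open>(shift ^^ n) \<omega>\<close> is \<omega>
  itself, reached along transitions allowed by \<open>M\<close>; its single positive term suffices
  because all others are nonnegative.\<close>

lemma T_pow_pos:
  assumes "bounded_by b u" "\<And>\<omega>. \<omega> \<in> X \<Longrightarrow> 0 \<le> u \<omega>"
    and "\<omega> \<in> X" "u \<omega> > 0" "\<And>i. i < n \<Longrightarrow> M (\<omega> i) (\<omega> (Suc i)) = 1"
  shows "(T ^^ n) u ((shift ^^ n) \<omega>) > 0"
  using assms(5)
proof (induction n)
  case (Suc n)
  let ?\<upsilon> = "(shift ^^ n) \<omega>"
  obtain c where c: "bounded_by c ((T ^^ n) u)" using T_pow_bounded'[OF assms(1)] by blast
  have pre: "prepend (\<omega> n) (shift ?\<upsilon>) = ?\<upsilon>" using prepend_shift[of ?\<upsilon>] by (simp add: shift_pow_apply)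
  have "M (\<omega> n) (shift ?\<upsilon> 0) = 1" using Suc.prems[of n] by (simp add: shift_def shift_pow_apply)
  moreover have "\<And>\<omega>. \<omega> \<in> X \<Longrightarrow> 0 \<le> (T ^^ n) u \<omega>" by (rule T_pow_nonneg[OF assms(1,2)])
  moreover have "shift ?\<upsilon> \<in> X" by (rule shift_in_full_shift[OF shift_pow_in_full_shift[OF assms(3)]])
  ultimately have "exp (\<phi> ?\<upsilon>) * (T ^^ n) u ?\<upsilon> \<le> (T ^^ Suc n) u (shift ?\<upsilon>)"
    using T_ge_summand[OF c, of "shift ?\<upsilon>" "\<omega> n"] by (simp add: pre)
  moreover have "0 < (T ^^ n) u ?\<upsilon>" by (rule Suc.IH) (use Suc.prems in simp)
  then have "0 < exp (\<phi> ?\<upsilon>) * (T ^^ n) u ?\<upsilon>" by simp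
  ultimately show ?case unfolding funpow.simps o_apply by (meson less_le_trans)
qed (simp add: assms(4))

section \<open>Invariant cones\<close>

text \<open>The real counterpart of \<open>log_lipschitz_cone\<close>. Continuity is left out,
  because bounded members with \<open>0 \<le> c\<close> are Hoelder by
  \<open>cone_imp_holder_bound\<close>.\<close>

definition cone :: "real \<Rightarrow> ('s point \<Rightarrow> real) \<Rightarrow> bool" where
  "cone c u \<longleftrightarrow> (\<forall>\<omega>\<in>X. 0 \<le> u \<omega>) \<and>
     (\<forall>\<omega>\<in>X. \<forall>\<upsilon>\<in>X. agree k \<omega> \<upsilon> \<longrightarrow> u \<omega> \<le> exp (c * d \<omega> \<upsilon>) * u \<upsilon>)"

lemma coneD:
  assumes "cone c u"
  shows "\<And>\<omega>. \<omega> \<in> X \<Longrightarrow> 0 \<le> u \<omega>"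
    and "\<And>\<omega> \<upsilon>. \<omega> \<in> X \<Longrightarrow> \<upsilon> \<in> X \<Longrightarrow> agree k \<omega> \<upsilon> \<Longrightarrow> u \<omega> \<le> exp (c * d \<omega> \<upsilon>) * u \<upsilon>"
  using assms by (auto simp: cone_def)

lemma cone_mono: "cone c u \<Longrightarrow> c \<le> c' \<Longrightarrow> cone c' u"
  unfolding cone_def
  by (meson d_nonneg exp_le_cancel_iff mult_right_mono order_trans)

text \<open>Prepending a letter contracts distances by \<theta>, so in every branch the weight
  contributes the exponent \<open>\<Phi> * \<theta> * d\<close> and \<open>u\<close> contributes
  \<open>c * \<theta> * d\<close>. The factor is the same for all branches and passes to the sum;
  both points have the same branches since they share the first letter.\<close>

lemma cone_T:
  assumes "cone c u" "bounded_by b u"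
  shows "cone (\<theta> * (c + \<Phi>)) (T u)"
  unfolding cone_def
proof (intro conjI ballI impI)
  fix \<omega> assume "\<omega> \<in> X"
  then show "0 \<le> T u \<omega>" using T_pow_nonneg[OF assms(2) coneD(1)[OF assms(1)], of \<omega> "Suc 0"] by simp
next
  fix \<omega> \<upsilon> assume w: "\<omega> \<in> X" "\<upsilon> \<in> X" "agree k \<omega> \<upsilon>"
  let ?S = "{a. M a (\<upsilon> 0) = 1}"
  let ?c = "exp (\<theta> * (c + \<Phi>) * d \<omega> \<upsilon>)"
  have S: "{a. M a (\<omega> 0) = 1} = ?S" using agree_0[OF w(3)] by simp
  have "exp (\<phi> (prepend a \<omega>)) * u (prepend a \<omega>) \<le> ?c * (exp (\<phi> (prepend a \<upsilon>)) * u (prepend a \<upsilon>))"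
    if a: "a \<in> ?S" for a
  proof -
    have p: "prepend a \<omega> \<in> X" "prepend a \<upsilon> \<in> X" "agree (Suc k) (prepend a \<omega>) (prepend a \<upsilon>)"
      using prepend_in_X[OF w(1), of a] prepend_in_X[OF w(2), of a] a agree_0[OF w(3)] agree_prepend[OF w(3)]
      by auto
    then have p': "agree k (prepend a \<omega>) (prepend a \<upsilon>)" by (simp add: agree_def)
    have "\<phi> (prepend a \<omega>) \<le> \<phi> (prepend a \<upsilon>) + \<Phi> * (\<theta> * d \<omega> \<upsilon>)"
      using phi_holder[OF p] by (simp add: dist_theta_prepend)
    then have "exp (\<phi> (prepend a \<omega>)) \<le> exp (\<phi> (prepend a \<upsilon>)) * exp (\<Phi> * (\<theta> * d \<omega> \<upsilon>))"
      unfolding exp_add[symmetric] by (rule exp_le_cancel_iff[THEN iffD2])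
    moreover have "u (prepend a \<omega>) \<le> exp (c * (\<theta> * d \<omega> \<upsilon>)) * u (prepend a \<upsilon>)"
      using coneD(2)[OF assms(1) p(1,2) p'] by (simp add: dist_theta_prepend)
    ultimately have "exp (\<phi> (prepend a \<omega>)) * u (prepend a \<omega>) \<le>
      (exp (\<phi> (prepend a \<upsilon>)) * exp (\<Phi> * (\<theta> * d \<omega> \<upsilon>))) * (exp (c * (\<theta> * d \<omega> \<upsilon>)) * u (prepend a \<upsilon>))"
      using coneD(1)[OF assms(1) p(1)] by (intro mult_mono) simp_all
    also have "\<dots> = (exp (\<Phi> * (\<theta> * d \<omega> \<upsilon>)) * exp (c * (\<theta> * d \<omega> \<upsilon>))) * (exp (\<phi> (prepend a \<upsilon>)) * u (prepend a \<upsilon>))"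
      by (simp only: mult_ac)
    also have "exp (\<Phi> * (\<theta> * d \<omega> \<upsilon>)) * exp (c * (\<theta> * d \<omega> \<upsilon>)) = ?c"
      unfolding exp_add[symmetric] by (simp add: algebra_simps)
    finally show ?thesis .
  qed
  then have "T u \<omega> \<le> (\<Sum>\<^sub>\<infinity>a\<in>?S. ?c * (exp (\<phi> (prepend a \<upsilon>)) * u (prepend a \<upsilon>)))"
    unfolding real_transfer_def if_P[OF w(1)] S
    using T_summable[OF assms(2) w(1), unfolded S] T_summable[OF assms(2) w(2)]
    by (intro infsum_mono summable_on_cmult_right)
  also have "\<dots> = ?c * T u \<upsilon>"
    using w by (simp add: real_transfer_def infsum_cmult_right T_summable[OF assms(2) w(2)])
  finally show "T u \<omega> \<le> ?c * T u \<upsilon>" .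
qed

section \<open>Hoelder bounds under the operator and from cones\<close>

lemma holder_bound_imp_bounded: "holder_bound A \<theta> k b u \<Longrightarrow> bounded_by b u"
  by (auto simp: bounded_by_def holder_bound_def)

lemma holder_bound_nonneg:
  "holder_bound A \<theta> k b u \<Longrightarrow> \<omega> \<in> X \<Longrightarrow> 0 \<le> b"
  by (meson holder_boundD(1) norm_ge_zero order_trans)

text \<open>The tangent of the exponential at \<open>x\<close> lies below the graph.\<close>

lemma exp_diff_le: "exp x - exp y \<le> exp x * (x - y)" for x y :: real
proof -
  have "exp x * (1 + (y - x)) \<le> exp x * exp (y - x)"
    using exp_ge_add_one_self[of "y - x"] by (intro mult_left_mono) auto
  also have "\<dots> = exp y" by (simp add: exp_diff)
  finally show ?thesis by (simp add: right_diff_distrib distrib_left)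
qed

lemma abs_exp_diff_le: "\<bar>exp x - exp y\<bar> \<le> max (exp x) (exp y) * \<bar>x - y\<bar>" for x y :: real
  using exp_diff_le[of x y] exp_diff_le[of y x] by (cases "x \<le> y") (auto simp: max_def abs_if)

lemma holder_bound_T:
  assumes "holder_bound A \<theta> k b u" "0 \<le> b"
  shows "holder_bound A \<theta> k (E * (1 + \<Phi>) * b) (T u)"
proof (rule holder_boundI)
  note bd = holder_bound_imp_bounded[OF assms(1)]
  fix \<omega> assume "\<omega> \<in> X"
  then have "\<bar>T u \<omega>\<bar> \<le> E * b" by (rule bounded_byD[OF T_bounded[OF bd assms(2)]])
  also have "\<dots> \<le> E * (1 + \<Phi>) * b"
    using Phi_nonneg E_ge_1 assms(2) by (simp add: distrib_left distrib_right)
  finally show "norm (T u \<omega>) \<le> E * (1 + \<Phi>) * b" by simp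
next
  note bd = holder_bound_imp_bounded[OF assms(1)]
  fix \<omega> \<upsilon> assume w: "\<omega> \<in> X" "\<upsilon> \<in> X" "agree k \<omega> \<upsilon>"
  let ?S = "{a. M a (\<upsilon> 0) = 1}"
  let ?f = "\<lambda>\<omega> a. exp (\<phi> (prepend a \<omega>)) * u (prepend a \<omega>)"
  have S: "{a. M a (\<omega> 0) = 1} = ?S" using agree_0[OF w(3)] by simp
  have bound: "\<bar>?f \<omega> a - ?f \<upsilon> a\<bar> \<le> e a * ((1 + \<Phi>) * b * d \<omega> \<upsilon>)" if a: "a \<in> ?S" for a
  proof -
    let ?x = "prepend a \<omega>" and ?y = "prepend a \<upsilon>"
    have p: "?x \<in> X" "?y \<in> X" "agree (Suc k) ?x ?y"
      using prepend_in_X[OF w(1), of a] prepend_in_X[OF w(2), of a] a agree_0[OF w(3)] agree_prepend[OF w(3)]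
      by simp_all
    then have p': "agree k ?x ?y" by (simp add: agree_def)
    have dp: "d ?x ?y \<le> d \<omega> \<upsilon>"
      using theta by (simp add: dist_theta_prepend mult_left_le_one_le)
    have ex: "exp (\<phi> ?x) \<le> e a" "exp (\<phi> ?y) \<le> e a"
      using exp_le_e[OF p(1)] exp_le_e[OF p(2)] by simp_all
    have "\<bar>\<phi> ?x - \<phi> ?y\<bar> \<le> \<Phi> * d ?x ?y"
      using phi_holder[OF p] phi_holder[OF p(2,1) agree_sym[OF p(3)]]
      by (simp add: dist_theta_commute abs_le_iff)
    also have "\<dots> \<le> \<Phi> * d \<omega> \<upsilon>" using dp Phi_nonneg by (rule mult_left_mono)
    finally have "\<bar>exp (\<phi> ?x) - exp (\<phi> ?y)\<bar> \<le> e a * (\<Phi> * d \<omega> \<upsilon>)"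
      using ex e_nonneg by (intro order_trans[OF abs_exp_diff_le] mult_mono) simp_all
    then have 1: "\<bar>exp (\<phi> ?x) - exp (\<phi> ?y)\<bar> * \<bar>u ?x\<bar> \<le> (e a * (\<Phi> * d \<omega> \<upsilon>)) * b"
      using holder_boundD(1)[OF assms(1) p(1)] e_nonneg Phi_nonneg by (intro mult_mono) simp_all
    have "\<bar>u ?x - u ?y\<bar> \<le> b * d ?x ?y" using holder_boundD(2)[OF assms(1) p(1,2) p'] by simp
    also have "\<dots> \<le> b * d \<omega> \<upsilon>" using dp assms(2) by (rule mult_left_mono)
    finally have 2: "exp (\<phi> ?y) * \<bar>u ?x - u ?y\<bar> \<le> e a * (b * d \<omega> \<upsilon>)"
      using ex e_nonneg by (intro mult_mono) simp_all
    have "?f \<omega> a - ?f \<upsilon> a = (exp (\<phi> ?x) - exp (\<phi> ?y)) * u ?x + exp (\<phi> ?y) * (u ?x - u ?y)"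
      by (simp add: algebra_simps)
    then have "\<bar>?f \<omega> a - ?f \<upsilon> a\<bar> \<le> \<bar>exp (\<phi> ?x) - exp (\<phi> ?y)\<bar> * \<bar>u ?x\<bar> + exp (\<phi> ?y) * \<bar>u ?x - u ?y\<bar>"
      using abs_triangle_ineq[of "(exp (\<phi> ?x) - exp (\<phi> ?y)) * u ?x" "exp (\<phi> ?y) * (u ?x - u ?y)"]
      by (simp add: abs_mult)
    with 1 2 show ?thesis by (simp add: algebra_simps)
  qed
  have su: "(?f \<omega>) summable_on ?S" "(?f \<upsilon>) summable_on ?S"
    using T_summable[OF bd w(1)] T_summable[OF bd w(2)] S by auto
  have abs: "(\<lambda>a. norm (?f \<omega> a - ?f \<upsilon> a)) summable_on ?S"
    by (rule summable_on_comparison_test[OF e_summable_on[of "(1 + \<Phi>) * b * d \<omega> \<upsilon>"]]) (use bound in auto)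
  have "T u \<omega> - T u \<upsilon> = (\<Sum>\<^sub>\<infinity>a\<in>?S. ?f \<omega> a - ?f \<upsilon> a)"
    using w S infsum_add[OF su(1) summable_on_uminus[THEN iffD2, OF su(2)]]
    by (simp add: real_transfer_def infsum_uminus)
  then have "norm (T u \<omega> - T u \<upsilon>) \<le> (\<Sum>\<^sub>\<infinity>a\<in>?S. norm (?f \<omega> a - ?f \<upsilon> a))"
    using norm_infsum_bound[OF abs] by simp
  also have "\<dots> \<le> (\<Sum>\<^sub>\<infinity>a\<in>?S. e a * ((1 + \<Phi>) * b * d \<omega> \<upsilon>))"
    using abs bound by (intro infsum_mono e_summable_on) auto
  also have "\<dots> \<le> E * ((1 + \<Phi>) * b * d \<omega> \<upsilon>)"
    using Phi_nonneg assms(2) by (intro infsum_e_le) simp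
  finally show "norm (T u \<omega> - T u \<upsilon>) \<le> E * (1 + \<Phi>) * b * d \<omega> \<upsilon>" by (simp add: mult.assoc)
qed

text \<open>Since \<open>d \<le> 1\<close>, the number \<open>exp (c * d) - 1\<close> is at most
  \<open>c * exp c * d\<close>, which turns multiplicative oscillation into additive oscillation.
  Estimates for cone functions are converted back to Hoelder bounds in this way.\<close>

lemma cone_imp_holder_bound:
  assumes "cone c u" "bounded_by b u" "0 \<le> c"
  shows "holder_bound A \<theta> k ((1 + c * exp c) * b) u"
proof (rule holder_boundI)
  fix \<omega> assume w: "\<omega> \<in> X"
  then have "\<bar>u \<omega>\<bar> \<le> b" by (rule bounded_byD[OF assms(2)])
  also have "\<dots> \<le> (1 + c * exp c) * b"
    using mult_right_mono[of 1 "1 + c * exp c" b] assms(3) bounded_by_nonneg[OF assms(2) w] by simp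
  finally show "norm (u \<omega>) \<le> (1 + c * exp c) * b" by simp
next
  have main: "u \<omega> - u \<upsilon> \<le> (1 + c * exp c) * b * d \<omega> \<upsilon>"
    if w: "\<omega> \<in> X" "\<upsilon> \<in> X" "agree k \<omega> \<upsilon>" for \<omega> \<upsilon>
  proof -
    have b: "0 \<le> u \<upsilon>" "u \<upsilon> \<le> b"
      using coneD(1)[OF assms(1) w(2)] bounded_byD[OF assms(2) w(2)] by simp_all
    have cd: "0 \<le> c * d \<omega> \<upsilon>" "c * d \<omega> \<upsilon> \<le> c"
      using assms(3) mult_left_le[OF d_le_1[of \<omega> \<upsilon>] assms(3)] by simp_all
    have "exp (c * d \<omega> \<upsilon>) - 1 \<le> exp (c * d \<omega> \<upsilon>) * (c * d \<omega> \<upsilon>)"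
      using exp_diff_le[of "c * d \<omega> \<upsilon>" 0] by simp
    also have "\<dots> \<le> exp c * (c * d \<omega> \<upsilon>)" using cd by (intro mult_right_mono) auto
    finally have 1: "exp (c * d \<omega> \<upsilon>) - 1 \<le> c * exp c * d \<omega> \<upsilon>" by (simp add: mult_ac)
    have "u \<omega> - u \<upsilon> \<le> (exp (c * d \<omega> \<upsilon>) - 1) * u \<upsilon>"
      using coneD(2)[OF assms(1) w] by (simp add: algebra_simps)
    also have "\<dots> \<le> (c * exp c * d \<omega> \<upsilon>) * b"
      using 1 b cd assms(3) by (intro mult_mono) simp_all
    also have "\<dots> \<le> (1 + c * exp c) * b * d \<omega> \<upsilon>" using mult_nonneg_nonneg[OF order_trans[OF b] d_nonneg[of \<omega> \<upsilon>]] by (simp add: algebra_simps)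
    finally show ?thesis .
  qed
  fix \<omega> \<upsilon> assume w: "\<omega> \<in> X" "\<upsilon> \<in> X" "agree k \<omega> \<upsilon>"
  show "norm (u \<omega> - u \<upsilon>) \<le> (1 + c * exp c) * b * d \<omega> \<upsilon>"
    using main[OF w] main[OF w(2,1) agree_sym[OF w(3)]] by (simp add: dist_theta_commute abs_le_iff)
qed

text \<open>The fixed point of the map \<open>c \<mapsto> \<theta> (c + \<Phi>)\<close> from the lemma \<open>cone_T\<close>.\<close>

definition c1 :: real where "c1 = \<Phi> * \<theta> / (1 - \<theta>)"

lemma c1_nonneg: "0 \<le> c1"
  using theta Phi_nonneg by (simp add: c1_def)

text \<open>As \<open>c1\<close> is fixed by an affine map with slope \<theta>, the excess 1 over
  \<open>c1\<close> shrinks to \<theta>. The gap \<open>1 - \<theta>\<close> later pays for a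
  subtraction.\<close>

lemma cone_T': "cone (c1 + 1) u \<Longrightarrow> bounded_by b u \<Longrightarrow> cone (c1 + \<theta>) (T u)"
proof -
  have "\<theta> * (c1 + 1 + \<Phi>) = c1 + \<theta>" using theta by (simp add: c1_def field_simps)
  then show "cone (c1 + 1) u \<Longrightarrow> bounded_by b u \<Longrightarrow> cone (c1 + \<theta>) (T u)"
    using cone_T[of "c1 + 1" u b] by simp
qed

lemma cone_T_pow:
  assumes "cone (c1 + 1) u" "bounded_by b u"
  shows "cone (c1 + 1) ((T ^^ n) u)"
proof (induction n)
  case (Suc n)
  obtain b' where "bounded_by b' ((T ^^ n) u)" using T_pow_bounded'[OF assms(2)] by blast
  from cone_mono[OF cone_T'[OF Suc this], of "c1 + 1"] theta show ?case by simp
qed (use assms in simp)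

lemma cone_T_pow_strict:
  assumes "cone (c1 + 1) u" "bounded_by b u" "1 \<le> n"
  shows "cone (c1 + \<theta>) ((T ^^ n) u)"
proof -
  define m where "m = n - 1"
  then have m: "n = Suc m" using assms(3) by simp
  obtain b' where "bounded_by b' ((T ^^ m) u)" using T_pow_bounded'[OF assms(2)] by blast
  from cone_T'[OF cone_T_pow[OF assms(1,2)] this] show ?thesis by (simp add: m)
qed

section \<open>Tail estimates\<close>

lemma k_local_const_0: "agree k \<omega> \<upsilon> \<Longrightarrow> \<omega> \<in> {\<omega>. P (\<omega> 0)} \<longleftrightarrow> \<upsilon> \<in> {\<omega>. P (\<omega> 0)}"
  by (simp add: agree_0)

lemma bounded_by_indicator: "bounded_by 1 (indicator E')"
  by (rule bounded_byI) (simp split: split_indicator)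

lemma cone_indicator:
  assumes "\<And>\<omega> \<upsilon>. agree k \<omega> \<upsilon> \<Longrightarrow> \<omega> \<in> E' \<longleftrightarrow> \<upsilon> \<in> E'"
  shows "cone (c1 + 1) (indicator E')"
  unfolding cone_def
proof (intro conjI ballI impI)
  fix \<omega> \<upsilon> assume "\<omega> \<in> X" "\<upsilon> \<in> X" "agree k \<omega> \<upsilon>"
  then have "indicator E' \<omega> = (indicator E' \<upsilon> :: real)" using assms by (simp add: indicator_def)
  moreover have "1 \<le> exp ((c1 + 1) * d \<omega> \<upsilon>)" using c1_nonneg by simp
  ultimately show "indicator E' \<omega> \<le> exp ((c1 + 1) * d \<omega> \<upsilon>) * (indicator E' \<upsilon> :: real)"
    by (simp split: split_indicator)
qed simp

text \<open>A Harnack inequality on \<open>k\<close>-cylinders; the constant is uniform because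
  \<open>d \<le> 1\<close>.\<close>

lemma cone_agree_le:
  assumes "cone (c1 + 1) u" "\<omega> \<in> X" "\<upsilon> \<in> X" "agree k \<omega> \<upsilon>"
  shows "u \<omega> \<le> exp (c1 + 1) * u \<upsilon>"
proof -
  have "u \<omega> \<le> exp ((c1 + 1) * d \<omega> \<upsilon>) * u \<upsilon>" using coneD(2)[OF assms] .
  also have "\<dots> \<le> exp (c1 + 1) * u \<upsilon>"
    using coneD(1)[OF assms(1,3)] c1_nonneg d_le_1[of \<omega> \<upsilon>] by (intro mult_right_mono) (simp_all add: mult_left_le)
  finally show ?thesis .
qed

lemma holder_bound_T_pow:
  assumes "holder_bound A \<theta> k b u" "0 \<le> b"
  shows "holder_bound A \<theta> k ((E * (1 + \<Phi>)) ^ n * b) ((T ^^ n) u)"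
proof (induction n)
  case (Suc n)
  have "0 \<le> (E * (1 + \<Phi>)) ^ n * b" using E_ge_1 Phi_nonneg assms(2) by simp
  from holder_bound_T[OF Suc this] show ?case by (simp add: mult.assoc)
qed (simp add: assms)

text \<open>
  After \<open>m\<close> steps the transfer operator does not see the points whose first \<open>m\<close> transitions are not
  allowed by \<open>M\<close>, and it almost ignores those with one of the first \<open>m\<close> letters outside a large
  finite set \<open>F\<close>.
\<close>

definition bad :: "'s set \<Rightarrow> nat \<Rightarrow> 's point set" where
  "bad F m = {\<omega>. \<exists>i<m. \<omega> i \<notin> F \<or> M (\<omega> i) (\<omega> (Suc i)) \<noteq> 1}"

lemma bad_prepend:
  assumes "M a (\<omega> 0) = 1"
  shows "prepend a \<omega> \<in> bad F (Suc m) \<longleftrightarrow> a \<notin> F \<or> \<omega> \<in> bad F m"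
proof -
  have "prepend a \<omega> \<in> bad F (Suc m) \<longleftrightarrow>
    (\<exists>i<Suc m. prepend a \<omega> i \<notin> F \<or> M (prepend a \<omega> i) (\<omega> i) \<noteq> 1)" by (simp add: bad_def)
  also have "\<dots> \<longleftrightarrow> (prepend a \<omega> 0 \<notin> F \<or> M (prepend a \<omega> 0) (\<omega> 0) \<noteq> 1) \<or>
    (\<exists>i<m. prepend a \<omega> (Suc i) \<notin> F \<or> M (prepend a \<omega> (Suc i)) (\<omega> (Suc i)) \<noteq> 1)"
    by (metis less_Suc_eq_0_disj Suc_less_eq)
  finally show ?thesis using assms by (simp add: bad_def)
qed

text \<open>The letter prepended to \<omega> either lies outside \<open>F\<close>, which costs the
  tail of \<open>e\<close>, or leaves the decision to \<omega>, at a cost of at most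
  \<open>E\<close>. The factor \<open>* 1\<close> gives the right side the shape of a linear
  combination expected by \<open>T_pow_linear\<close>.\<close>

lemma T_bad_le:
  assumes "\<omega> \<in> X"
  shows "T (indicator (bad F (Suc m))) \<omega> \<le> (\<Sum>\<^sub>\<infinity>a\<in>-F. e a) * 1 + E * indicator (bad F m) \<omega>"
proof (cases "\<omega> \<in> bad F m")
  case True
  have "T (indicator (bad F (Suc m))) \<omega> \<le> E"
    using bounded_byD[OF T_bounded[OF bounded_by_indicator] assms] by (simp add: abs_le_iff)
  moreover have "0 \<le> (\<Sum>\<^sub>\<infinity>a\<in>-F. e a)" by (rule infsum_nonneg) (rule e_nonneg)
  ultimately show ?thesis using True by simp
next
  case False
  have "T (indicator (bad F (Suc m))) \<omega> \<le> (\<Sum>\<^sub>\<infinity>a\<in>-F. e a)"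
    unfolding real_transfer_def if_P[OF assms]
  proof (rule infsum_mono_neutral)
    show "(\<lambda>a. exp (\<phi> (prepend a \<omega>)) * indicator (bad F (Suc m)) (prepend a \<omega>)) summable_on {a. M a (\<omega> 0) = 1}"
      by (rule T_summable[OF bounded_by_indicator assms])
    show "e summable_on - F" using e_summable_on[of 1 "-F"] by simp
    fix a assume "a \<in> {a. M a (\<omega> 0) = 1} \<inter> - F"
    then have a: "M a (\<omega> 0) = 1" by simp
    show "exp (\<phi> (prepend a \<omega>)) * indicator (bad F (Suc m)) (prepend a \<omega>) \<le> e a"
      using summand_bound[OF bounded_by_indicator assms a, of "bad F (Suc m)"] by (simp add: abs_le_iff)
  next
    fix a assume "a \<in> {a. M a (\<omega> 0) = 1} - - F"
    then have "prepend a \<omega> \<notin> bad F (Suc m)" using bad_prepend False by simp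
    then show "exp (\<phi> (prepend a \<omega>)) * indicator (bad F (Suc m)) (prepend a \<omega>) \<le> 0" by simp
  qed (rule e_nonneg)
  then show ?thesis using False by simp
qed

text \<open>Induction on the number of letters: each step adds one tail of \<open>e\<close>, and the
  remaining letters cost powers of \<open>E\<close>. For \<open>m = 0\<close> no point is
  bad.\<close>

lemma T_pow_bad_le:
  assumes "\<omega> \<in> X"
  shows "(T ^^ m) (indicator (bad F m)) \<omega> \<le> real m * (\<Sum>\<^sub>\<infinity>a\<in>-F. e a) * E ^ m"
  using assms
proof (induction m arbitrary: \<omega>)
  case 0
  then show ?case by (simp add: bad_def)
next
  case (Suc m)
  let ?t = "\<Sum>\<^sub>\<infinity>a\<in>-F. e a"
  have t: "0 \<le> ?t" by (rule infsum_nonneg) (rule e_nonneg)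
  have 1: "bounded_by 1 (\<lambda>_. 1)" by (rule bounded_byI) simp
  have "(T ^^ Suc m) (indicator (bad F (Suc m))) \<omega> = (T ^^ m) (T (indicator (bad F (Suc m)))) \<omega>"
    by (simp add: funpow_swap1)
  also have "\<dots> \<le> (T ^^ m) (\<lambda>\<omega>. ?t * 1 + E * indicator (bad F m) \<omega>) \<omega>"
    by (rule T_pow_mono[OF T_bounded[OF bounded_by_indicator] bounded_by_linear[OF 1 bounded_by_indicator] T_bad_le Suc.prems]) simp
  also have "\<dots> = ?t * (T ^^ m) (\<lambda>_. 1) \<omega> + E * (T ^^ m) (indicator (bad F m)) \<omega>"
    by (rule T_pow_linear[OF 1 bounded_by_indicator Suc.prems])
  also have "\<dots> \<le> ?t * E ^ m + E * (real m * ?t * E ^ m)"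
    using bounded_byD[OF T_pow_bounded[OF 1] Suc.prems, of m] Suc.IH[OF Suc.prems] t E_ge_1
    by (intro add_mono mult_left_mono) (simp_all add: abs_le_iff)
  \<comment> \<open>\<open>E \<ge> 1\<close> pads the first term, so that both carry the same
    power.\<close>
  also have "\<dots> \<le> E * (?t * E ^ m) + E * (real m * ?t * E ^ m)"
    using mult_right_mono[of 1 E "?t * E ^ m"] t E_ge_1 by simp
  also have "\<dots> = real (Suc m) * ?t * E ^ Suc m" by (simp add: algebra_simps)
  finally show ?case .
qed

lemma small_tail:
  assumes "0 < \<epsilon>"
  shows "\<exists>F. finite F \<and> (\<Sum>\<^sub>\<infinity>a\<in>-F. e a) \<le> \<epsilon>"
proof -
  from infsum_finite_approximation[OF e_summable assms]
  obtain F where F: "finite F" "dist (sum e F) (infsum e UNIV) \<le> \<epsilon>" by blast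
  have "infsum e (UNIV - F) = infsum e UNIV - infsum e F"
    using F(1) e_summable by (intro infsum_Diff) simp_all
  then show ?thesis using F by (intro exI[of _ F]) (simp add: Compl_eq_Diff_UNIV dist_real_def abs_le_iff)
qed

end

section \<open>Invariant measure and Lyapunov estimate\<close>

text \<open>Mixing is expressed by points: for all large \<open>n\<close> some point of
  \<open>X_M\<close> starts in the \<open>k\<close>-cylinder of \<open>x\<close> and is in that of
  \<open>y\<close> at time \<open>p * n\<close>. The equivalence in \<open>class_step\<close> says
  that the allowed preimages of a point lie in class \<open>i\<close> exactly when the point lies in
  the next class. Measurability and invariance are demanded for real Hoelder functions only.\<close>

locale invariant_system = transfer_system A M \<theta> k \<phi> \<Phi> e + prob_space \<nu>
  for A M :: "'s::countable \<Rightarrow> 's \<Rightarrow> nat" and \<theta> :: real and k :: nat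
    and \<phi> :: "'s point \<Rightarrow> real" and \<Phi> :: real and e :: "'s \<Rightarrow> real" and \<nu> :: "'s point measure" +
  fixes S0 :: "'s set" and D :: "nat \<Rightarrow> 's set" and p :: nat
  assumes space_nu: "space \<nu> = full_shift A"
    and measurable_holder: "\<And>b u. holder_bound A \<theta> k b (u :: 's point \<Rightarrow> real) \<Longrightarrow> u \<in> borel_measurable \<nu>"
    and nu_support: "AE \<omega> in \<nu>. \<omega> \<in> subshift S0 M"
    and nu_invariant: "\<And>b u. holder_bound A \<theta> k b u \<Longrightarrow>
                         (LINT \<omega>|\<nu>. real_transfer A M \<phi> u \<omega>) = (LINT \<omega>|\<nu>. u \<omega>)"
    and M_S0: "M a b = 1 \<Longrightarrow> a \<in> S0 \<and> b \<in> S0"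
    and extend: "b \<in> S0 \<Longrightarrow> \<exists>x\<in>subshift S0 M. x 0 = b"
    and pred: "b \<in> S0 \<Longrightarrow> \<exists>a. M a b = 1"
    and classes: "(\<Union>i<p. D i) = S0" "disjoint_family_on D {..<p}"
    and class_step: "M a b = 1 \<Longrightarrow> i < p \<Longrightarrow> a \<in> D i \<longleftrightarrow> b \<in> D (Suc i mod p)"
    and mixing: "i < p \<Longrightarrow> x \<in> subshift S0 M \<Longrightarrow> x 0 \<in> D i \<Longrightarrow> y \<in> subshift S0 M \<Longrightarrow> y 0 \<in> D i \<Longrightarrow>
       \<exists>N. \<forall>n\<ge>N. \<exists>z\<in>subshift S0 M. agree k z x \<and> agree k ((shift ^^ (p * n)) z) y"
begin

abbreviation "XM \<equiv> subshift S0 M"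
abbreviation I :: "('s point \<Rightarrow> real) \<Rightarrow> real" where "I u \<equiv> integral\<^sup>L \<nu> u"

text \<open>Masses of sets stay in the form \<open>I (indicator E)\<close>, to which the lemmas on
  Hoelder functions apply.\<close>

declare Bochner_Integration.integral_indicator [simp del]

text \<open>Named by a point and taken among all sequences, not only those in \<open>X\<close>, so
  that \<open>cyl_local\<close> involves no membership in \<open>X\<close>. The same applies to
  \<open>sector\<close>.\<close>

definition cyl :: "'s point \<Rightarrow> 's point set" where
  "cyl x = {\<omega>. agree k \<omega> x}"

definition sector :: "nat \<Rightarrow> 's point set" where
  "sector j = {\<omega>. \<omega> 0 \<in> D j}"

lemma XM_subset_X: "x \<in> XM \<Longrightarrow> x \<in> X"
  by (simp add: subshift_def M_imp_A)

lemma cyl_local: "agree k \<omega> \<upsilon> \<Longrightarrow> \<omega> \<in> cyl x \<longleftrightarrow> \<upsilon> \<in> cyl x"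
  unfolding cyl_def using agree_sym agree_trans by blast

lemma sector_local: "agree k \<omega> \<upsilon> \<Longrightarrow> \<omega> \<in> sector j \<longleftrightarrow> \<upsilon> \<in> sector j"
  unfolding sector_def by (rule k_local_const_0)

lemma holder_integrable: "holder_bound A \<theta> k b u \<Longrightarrow> integrable \<nu> u"
  for u :: "'s point \<Rightarrow> real"
  using holder_boundD(1)[of A \<theta> k b u]
  by (intro integrable_const_bound[of _ b] AE_I2) (auto intro: measurable_holder simp: space_nu)

lemma I_mono:
  assumes "holder_bound A \<theta> k b u" "holder_bound A \<theta> k b' v" "\<And>\<omega>. \<omega> \<in> X \<Longrightarrow> u \<omega> \<le> v \<omega>"
  shows "I u \<le> I v"
  by (rule integral_mono[OF holder_integrable[OF assms(1)] holder_integrable[OF assms(2)]])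
    (simp add: space_nu assms(3))

lemma I_linear:
  assumes "holder_bound A \<theta> k b u" "holder_bound A \<theta> k b' v"
  shows "I (\<lambda>\<omega>. s * u \<omega> + t * v \<omega>) = s * I u + t * I v"
  using holder_integrable[OF assms(1)] holder_integrable[OF assms(2)] by simp

lemma I_sum:
  assumes "\<And>i. i \<in> J \<Longrightarrow> \<exists>b. holder_bound A \<theta> k b (u i)"
  shows "I (\<lambda>\<omega>. \<Sum>i\<in>J. u i \<omega>) = (\<Sum>i\<in>J. I (u i))"
  by (rule Bochner_Integration.integral_sum) (use assms holder_integrable in blast)

lemma I_nonneg: "(\<And>\<omega>. \<omega> \<in> X \<Longrightarrow> 0 \<le> u \<omega>) \<Longrightarrow> 0 \<le> I u" for u :: "'s point \<Rightarrow> real"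
  by (rule Bochner_Integration.integral_nonneg) (simp add: space_nu)

lemma I_le:
  assumes "holder_bound A \<theta> k b u" "\<And>\<omega>. \<omega> \<in> X \<Longrightarrow> u \<omega> \<le> c"
  shows "I u \<le> c"
  using I_mono[OF assms(1) holder_bound_const[OF theta(1)], of c] assms(2) prob_space by (simp add: space_nu)

lemma I_T_pow:
  assumes "holder_bound A \<theta> k b u" "0 \<le> b"
  shows "I ((T ^^ n) u) = I u"
proof (induction n)
  case (Suc n)
  then show ?case using nu_invariant[OF holder_bound_T_pow[OF assms, of n]] by simp
qed simp

lemma holder_indicator_cyl: "holder_bound A \<theta> k 1 (indicator (cyl x) :: 's point \<Rightarrow> real)"
  by (rule holder_bound_indicator[OF theta(1) cyl_local])

lemma holder_indicator_sector: "holder_bound A \<theta> k 1 (indicator (sector j) :: 's point \<Rightarrow> real)"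
  by (rule holder_bound_indicator[OF theta(1) sector_local])

lemma cone_holder: "cone (c1 + 1) u \<Longrightarrow> bounded_by b u \<Longrightarrow>
    holder_bound A \<theta> k ((1 + (c1 + 1) * exp (c1 + 1)) * b) u"
  using cone_imp_holder_bound c1_nonneg by simp

section \<open>Finitely many cylinders that matter\<close>

text \<open>Only finitely many words of length \<open>k\<close> use letters of \<open>F\<close>. A
  point that is not bad may lie outside \<open>X_M\<close>, but its first \<open>k\<close>
  transitions are allowed, so its initial word continues to a point of \<open>X_M\<close>; one such
  point is chosen for each word that occurs.\<close>

lemma cover_good:
  assumes "finite F"
  shows "\<exists>Q. finite Q \<and> Q \<subseteq> XM \<and> (\<forall>\<omega>\<in>X. (\<forall>x\<in>Q. \<omega> \<notin> cyl x) \<longrightarrow> \<omega> \<in> bad F k)"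
proof -
  let ?W = "{w. set w \<subseteq> F \<and> length w = k}"
  let ?P = "\<lambda>w x. x \<in> XM \<and> (\<forall>i<k. x i = w ! i)"
  let ?Q = "(\<lambda>w. SOME x. ?P w x) ` {w \<in> ?W. \<exists>x. ?P w x}"
  have "finite {w \<in> ?W. \<exists>x. ?P w x}"
    by (rule finite_subset[OF _ finite_lists_length_eq[OF assms, of k]]) blast
  then have fin: "finite ?Q" by (rule finite_imageI)
  have sub: "?Q \<subseteq> XM"
  proof
    fix y assume "y \<in> ?Q"
    then obtain w where w: "\<exists>x. ?P w x" "y = (SOME x. ?P w x)" by blast
    show "y \<in> XM" using someI_ex[OF w(1)] w(2) by simp
  qed
  have cov: "\<exists>x\<in>?Q. \<omega> \<in> cyl x" if "\<omega> \<in> X" "\<omega> \<notin> bad F k" for \<omega>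
  proof -
    have good: "\<omega> i \<in> F" "M (\<omega> i) (\<omega> (Suc i)) = 1" if "i < k" for i
      using \<open>\<omega> \<notin> bad F k\<close> that by (auto simp: bad_def)
    \<comment> \<open>The letter at position \<open>k\<close> is the target of the last allowed
      transition; the index \<open>k - 1\<close> makes sense as \<open>k \<ge> 1\<close>.\<close>
    have "\<omega> k \<in> S0" using M_S0[OF good(2)[of "k - 1"]] k_ge_1 by simp
    then obtain y where y: "y \<in> XM" "y 0 = \<omega> k" using extend by blast
    \<comment> \<open>The first \<open>k\<close> letters are kept, and letter \<open>k\<close> is
      continued inside \<open>X_M\<close>.\<close>
    define x where "x = (\<lambda>i. if i < k then \<omega> i else y (i - k))"
    have "x n \<in> S0 \<and> M (x n) (x (Suc n)) = 1" for n
    proof (cases "n < k")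
      case True
      have "x (Suc n) = \<omega> (Suc n)"
      proof (cases "Suc n < k")
        case False
        then have "Suc n = k" using True by simp
        then show ?thesis using y(2) by (simp add: x_def)
      qed (simp add: x_def)
      then show ?thesis using True good(2)[OF True] M_S0[OF good(2)[OF True]] by (simp add: x_def)
    next
      case False
      then show ?thesis using y(1) by (simp add: x_def subshift_def Suc_diff_le)
    qed
    then have x: "x \<in> XM" by (simp add: subshift_def)
    let ?w = "map \<omega> [0..<k]"
    have Px: "?P ?w x" using x by (simp add: x_def)
    have w: "?w \<in> {w \<in> ?W. \<exists>x. ?P w x}" using Px good(1) by auto
    have "\<omega> \<in> cyl (SOME x. ?P ?w x)"
      using someI[of "?P ?w", OF Px] by (simp add: cyl_def agree_def)
    then show ?thesis using bexI[OF _ imageI[OF w, of "\<lambda>w. SOME x. ?P w x"], of "\<lambda>x. \<omega> \<in> cyl x"] by blast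
  qed
  have "\<forall>\<omega>\<in>X. (\<forall>x\<in>?Q. \<omega> \<notin> cyl x) \<longrightarrow> \<omega> \<in> bad F k"
  proof (intro ballI impI, rule ccontr)
    fix \<omega> assume w: "\<omega> \<in> X" "\<forall>x\<in>?Q. \<omega> \<notin> cyl x" "\<omega> \<notin> bad F k"
    from cov[OF w(1,3)] obtain x where "x \<in> ?Q" "\<omega> \<in> cyl x" by (elim bexE)
    then show False using w(2) by simp
  qed
  with fin sub show ?thesis by (intro exI[of _ ?Q] conjI)
qed

lemma tail_estimate:
  assumes "0 < \<epsilon>"
  shows "\<exists>Q. finite Q \<and> Q \<subseteq> XM \<and> (\<forall>\<omega>\<in>X. (T ^^ k) (indicator {\<omega>. \<forall>x\<in>Q. \<omega> \<notin> cyl x}) \<omega> \<le> \<epsilon>)"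
proof -
  \<comment> \<open>The share of \<epsilon> that the factor in \<open>T_pow_bad_le\<close> leaves
    for the tail.\<close>
  let ?\<delta> = "\<epsilon> / (real k * E ^ k)"
  have pos: "0 < real k * E ^ k" using k_ge_1 E_ge_1 by simp
  then obtain F where F: "finite F" "(\<Sum>\<^sub>\<infinity>a\<in>-F. e a) \<le> ?\<delta>" using small_tail[of ?\<delta>] assms by auto
  obtain Q where Q: "finite Q" "Q \<subseteq> XM" "\<And>\<omega>. \<omega> \<in> X \<Longrightarrow> (\<forall>x\<in>Q. \<omega> \<notin> cyl x) \<Longrightarrow> \<omega> \<in> bad F k"
    using cover_good[OF F(1)] by blast
  have "(T ^^ k) (indicator {\<omega>. \<forall>x\<in>Q. \<omega> \<notin> cyl x}) \<omega> \<le> \<epsilon>" if w: "\<omega> \<in> X" for \<omega>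
  proof -
    have "(T ^^ k) (indicator {\<omega>. \<forall>x\<in>Q. \<omega> \<notin> cyl x}) \<omega> \<le> (T ^^ k) (indicator (bad F k)) \<omega>"
      by (rule T_pow_mono[OF bounded_by_indicator bounded_by_indicator _ w])
        (use Q(3) in \<open>simp split: split_indicator\<close>)
    also have "\<dots> \<le> real k * (\<Sum>\<^sub>\<infinity>a\<in>-F. e a) * E ^ k" by (rule T_pow_bad_le[OF w])
    also have "\<dots> \<le> \<epsilon>" using F(2) pos by (simp add: pos_le_divide_eq mult_ac)
    finally show ?thesis .
  qed
  then show ?thesis using Q by blast
qed

text \<open>The Harnack inequality integrated over the cylinder compares the value at any of its
  points with the mean. Both sides are multiplied by the mass, so no division by a possibly
  vanishing mass occurs.\<close>

lemma cone_times_mass_le: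
  assumes "cone (c1 + 1) u" "bounded_by b u" "\<omega> \<in> X" "\<omega> \<in> cyl x"
  shows "u \<omega> * I (indicator (cyl x)) \<le> exp (c1 + 1) * I (\<lambda>\<upsilon>. u \<upsilon> * indicator (cyl x) \<upsilon>)"
    and "I (\<lambda>\<upsilon>. u \<upsilon> * indicator (cyl x) \<upsilon>) \<le> exp (c1 + 1) * u \<omega> * I (indicator (cyl x))"
proof -
  note hb = cone_holder[OF assms(1,2)]
  have b: "0 \<le> (1 + (c1 + 1) * exp (c1 + 1)) * b"
    using bounded_by_nonneg[OF assms(2,3)] c1_nonneg by simp
  note hr = holder_bound_restrict[OF hb b theta(1) cyl_local, of x]
  have ag: "agree k \<omega> \<upsilon>" "agree k \<upsilon> \<omega>" if "\<upsilon> \<in> cyl x" for \<upsilon>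
    using that assms(4) agree_sym agree_trans unfolding cyl_def by blast+
  have "I (\<lambda>\<upsilon>. u \<omega> * indicator (cyl x) \<upsilon>) \<le> I (\<lambda>\<upsilon>. exp (c1 + 1) * (u \<upsilon> * indicator (cyl x) \<upsilon>))"
    using cone_agree_le[OF assms(1,3)] ag(1)
    by (intro I_mono[OF holder_bound_scale[OF holder_indicator_cyl] holder_bound_scale[OF hr]])
      (auto split: split_indicator)
  then show "u \<omega> * I (indicator (cyl x)) \<le> exp (c1 + 1) * I (\<lambda>\<upsilon>. u \<upsilon> * indicator (cyl x) \<upsilon>)"
    by simp
  have "I (\<lambda>\<upsilon>. u \<upsilon> * indicator (cyl x) \<upsilon>) \<le> I (\<lambda>\<upsilon>. exp (c1 + 1) * u \<omega> * indicator (cyl x) \<upsilon>)"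
    using cone_agree_le[OF assms(1) _ assms(3)] ag(2)
    by (intro I_mono[OF hr holder_bound_scale[OF holder_indicator_cyl]])
      (auto split: split_indicator)
  then show "I (\<lambda>\<upsilon>. u \<upsilon> * indicator (cyl x) \<upsilon>) \<le> exp (c1 + 1) * u \<omega> * I (indicator (cyl x))"
    by simp
qed

section \<open>Positive mass of sectors and of cylinders that meet \<open>X_M\<close>\<close>

text \<open>For \<open>p = 0\<close> there would be no classes, \<open>S0\<close> would be empty,
  and \<nu> would have nothing to live on.\<close>

lemma p_pos: "0 < p"
proof (rule ccontr)
  assume "\<not> 0 < p"
  then have "S0 = {}" using classes(1) by simp
  then have "AE \<omega> in \<nu>. False" using nu_support by (simp add: subshift_def)
  then show False by simp
qed

lemma sector_disjoint: "i < p \<Longrightarrow> j < p \<Longrightarrow> \<omega> \<in> sector i \<Longrightarrow> \<omega> \<in> sector j \<Longrightarrow> i = j"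
  using classes(2) unfolding disjoint_family_on_def sector_def by blast

lemma sum_sectors:
  assumes "\<omega> 0 \<in> S0"
  shows "(\<Sum>j<p. indicator (sector j) \<omega> :: real) = 1"
proof -
  obtain i where i: "i < p" "\<omega> \<in> sector i" using assms classes(1) by (auto simp: sector_def)
  have "indicator (sector j) \<omega> = (if j = i then 1 else 0 :: real)" if "j < p" for j
  proof (cases "j = i")
    case False
    then have "\<omega> \<notin> sector j" using sector_disjoint[OF that i(1) _ i(2)] by blast
    then show ?thesis using False by simp
  qed (simp add: i(2))
  then have "(\<Sum>j<p. indicator (sector j) \<omega> :: real) = (\<Sum>j<p. if j = i then 1 else 0)" by simp
  then show ?thesis using i(1) by simp
qed

lemma AE_I_zero:
  assumes "holder_bound A \<theta> k b u" "\<And>\<omega>. \<omega> \<in> X \<Longrightarrow> 0 \<le> u \<omega>" "I u = 0"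
  shows "AE \<omega> in \<nu>. u \<omega> = 0"
proof -
  have "AE \<omega> in \<nu>. 0 \<le> u \<omega>" by (rule AE_I2) (simp add: space_nu assms(2))
  from integral_nonneg_eq_0_iff_AE[OF holder_integrable[OF assms(1)] this] assms(3)
  show ?thesis by simp
qed

text \<open>Every letter of \<open>S0\<close> has a predecessor, so \<open>T\<close> of the
  indicator of one sector is positive on the next. By invariance a null sector makes its successor
  null, and around the cycle all of them, against total mass 1.\<close>

lemma sector_mass_pos:
  assumes "j < p"
  shows "0 < I (indicator (sector j))"
proof (rule ccontr)
  assume "\<not> 0 < I (indicator (sector j))"
  moreover have "0 \<le> I (indicator (sector j))" by (rule I_nonneg) simp
  ultimately have j0: "I (indicator (sector j)) = 0" by simp
  have step: "I (indicator (sector (Suc i mod p))) = 0" if i: "i < p" "I (indicator (sector i)) = 0" for i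
  proof -
    have "I (T (indicator (sector i))) = 0" using nu_invariant[OF holder_indicator_sector] i(2) by simp
    from AE_I_zero[OF holder_bound_T[OF holder_indicator_sector] _ this]
    have "AE \<omega> in \<nu>. T (indicator (sector i)) \<omega> = 0"
      using T_pow_nonneg[OF bounded_by_indicator, of "sector i" _ "Suc 0"] by simp
    then have "AE \<omega> in \<nu>. (indicator (sector (Suc i mod p)) \<omega> :: real) = 0"
    proof (rule AE_mp)
      show "AE \<omega> in \<nu>. T (indicator (sector i)) \<omega> = 0 \<longrightarrow> (indicator (sector (Suc i mod p)) \<omega> :: real) = 0"
      proof (rule AE_I2, rule impI, rule ccontr)
        fix \<omega> assume w: "\<omega> \<in> space \<nu>" "T (indicator (sector i)) \<omega> = 0"
          "(indicator (sector (Suc i mod p)) \<omega> :: real) \<noteq> 0"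
        then have s: "\<omega> 0 \<in> D (Suc i mod p)" by (simp add: sector_def indicator_def split: if_splits)
        moreover have "Suc i mod p < p" using p_pos by simp
        ultimately have "\<omega> 0 \<in> S0" using classes(1) by blast
        then obtain a where a: "M a (\<omega> 0) = 1" using pred by blast
        then have "prepend a \<omega> \<in> sector i" using class_step[OF a i(1)] s by (simp add: sector_def)
        then have "exp (\<phi> (prepend a \<omega>)) \<le> T (indicator (sector i)) \<omega>"
          using T_ge_summand[where u = "indicator (sector i)" and \<omega> = \<omega> and a = a, OF bounded_by_indicator] a w(1)
          by (simp add: space_nu)
        then show False using w(2) exp_gt_zero[of "\<phi> (prepend a \<omega>)"] by linarith
      qed
    qed
    then show ?thesis using integral_eq_zero_AE by blast
  qed
  have all: "I (indicator (sector ((j + n) mod p))) = 0" for n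
  proof (induction n)
    case (Suc n)
    show ?case using step[OF _ Suc] p_pos by (simp add: mod_Suc_eq)
  qed (use j0 assms in simp)
  have "I (indicator (sector i)) = 0" if "i < p" for i
  proof -
    \<comment> \<open>\<open>i + (p - j)\<close> steps around the cycle lead from sector
      \<open>j\<close> to sector \<open>i\<close>; the number is written so as to be a natural
      number for all \<open>i\<close>.\<close>
    have "(j + (i + (p - j))) mod p = i" using assms that by simp
    then show ?thesis using all by metis
  qed
  then have "(\<Sum>i<p. I (indicator (sector i))) = 0" by simp
  moreover have "I (\<lambda>\<omega>. \<Sum>i<p. indicator (sector i) \<omega>) = (\<Sum>i<p. I (indicator (sector i)))"
    by (rule I_sum) (use holder_indicator_sector in blast)
  moreover have "I (\<lambda>\<omega>. \<Sum>i<p. indicator (sector i) \<omega>) = I (\<lambda>\<omega>. 1)"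
  proof (rule integral_cong_AE)
    show "AE \<omega> in \<nu>. (\<Sum>i<p. indicator (sector i) \<omega> :: real) = 1"
      using nu_support by (rule AE_mp) (simp add: AE_I2 sum_sectors subshift_def)
    show "(\<lambda>\<omega>. \<Sum>i<p. indicator (sector i) \<omega> :: real) \<in> borel_measurable \<nu>"
      by (rule borel_measurable_sum) (rule measurable_holder[OF holder_indicator_sector])
  qed simp
  ultimately show False using prob_space by simp
qed

text \<open>The alphabet is countable, so up to a null set the sector is covered by countably many
  \<open>k\<close>-cylinders of points of \<open>X_M\<close>; they cannot all be null.\<close>

lemma cylinder_mass_exists:
  assumes "j < p"
  shows "\<exists>y\<in>XM. y \<in> sector j \<and> 0 < I (indicator (cyl y))"
proof (rule ccontr)
  assume neg: "\<not> ?thesis"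
  have zero: "AE \<omega> in \<nu>. \<omega> \<notin> cyl y" if "y \<in> XM" "y \<in> sector j" for y
  proof -
    have "0 \<le> I (indicator (cyl y))" by (rule I_nonneg) simp
    moreover have "\<not> 0 < I (indicator (cyl y))" using neg that by blast
    ultimately have "I (indicator (cyl y)) = 0" by linarith
    from AE_I_zero[OF holder_indicator_cyl _ this] show ?thesis by (simp add: indicator_eq_0_iff)
  qed
  \<comment> \<open>The quantifier runs over words, of which there are countably many, instead of
    over points \<open>y\<close>.\<close>
  have "AE \<omega> in \<nu>. \<forall>w::'s list. \<not> (map \<omega> [0..<k] = w \<and> \<omega> \<in> XM \<and> \<omega> \<in> sector j)"
  proof (rule AE_all_countable[THEN iffD2], rule allI)
    fix w :: "'s list"
    show "AE \<omega> in \<nu>. \<not> (map \<omega> [0..<k] = w \<and> \<omega> \<in> XM \<and> \<omega> \<in> sector j)"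
    proof (cases "\<exists>y\<in>XM. y \<in> sector j \<and> map y [0..<k] = w")
      case True
      then obtain y where y: "y \<in> XM" "y \<in> sector j" "map y [0..<k] = w" by blast
      have in_cyl: "\<omega> \<in> cyl y" if "map \<omega> [0..<k] = w" for \<omega>
        using that y(3) by (auto simp: cyl_def agree_def)
      from zero[OF y(1,2)] show ?thesis by eventually_elim (use in_cyl in blast)
    qed auto
  qed
  with nu_support have "AE \<omega> in \<nu>. (indicator (sector j) \<omega> :: real) = 0"
    by eventually_elim (auto simp: indicator_def)
  then have "I (indicator (sector j)) = 0" using integral_eq_zero_AE by blast
  then show False using sector_mass_pos[OF assms] by simp
qed

text \<open>Mixing leads from \<open>cyl x\<close> to a cylinder of the same sector known to have
  positive mass: \<open>T ^^ n\<close> of the indicator is positive at one point there, hence by the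
  Harnack inequality on the whole cylinder, and its integral is still the mass of
  \<open>cyl x\<close>.\<close>

lemma cylinder_mass_pos:
  assumes "x \<in> XM"
  shows "0 < I (indicator (cyl x))"
proof -
  have "x 0 \<in> S0" using assms by (simp add: subshift_def)
  then obtain j where j: "j < p" "x 0 \<in> D j" using classes(1) by blast
  obtain y where y: "y \<in> XM" "y \<in> sector j" "0 < I (indicator (cyl y))"
    using cylinder_mass_exists[OF j(1)] by blast
  obtain N where "\<forall>n\<ge>N. \<exists>z\<in>XM. agree k z x \<and> agree k ((shift ^^ (p * n)) z) y"
    using mixing[OF j(1) assms j(2) y(1)] y(2) by (auto simp: sector_def)
  then obtain z where z: "z \<in> XM" "agree k z x" "agree k ((shift ^^ (p * N)) z) y" by blast
  let ?u = "indicator (cyl x) :: 's point \<Rightarrow> real" and ?n = "p * N"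
  let ?v = "(T ^^ ?n) ?u" and ?s = "(shift ^^ ?n) z"
  have zX: "?s \<in> X" by (rule shift_pow_in_full_shift[OF XM_subset_X[OF z(1)]])
  have v1: "0 < ?v ?s"
    by (rule T_pow_pos[OF bounded_by_indicator _ XM_subset_X[OF z(1)]])
      (use z in \<open>simp_all add: cyl_def subshift_def\<close>)
  have v2: "?v ?s * I (indicator (cyl y)) \<le> exp (c1 + 1) * I (\<lambda>\<upsilon>. ?v \<upsilon> * indicator (cyl y) \<upsilon>)"
    using cone_T_pow[OF cone_indicator[OF cyl_local] bounded_by_indicator] T_pow_bounded[OF bounded_by_indicator] zX z(3)
    by (intro cone_times_mass_le(1)) (simp_all add: cyl_def)
  have "I (\<lambda>\<upsilon>. ?v \<upsilon> * indicator (cyl y) \<upsilon>) \<le> I ?v"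
  proof (rule I_mono)
    show hv: "holder_bound A \<theta> k ((E * (1 + \<Phi>)) ^ ?n * 1) ?v"
      by (rule holder_bound_T_pow[OF holder_indicator_cyl]) simp
    show "holder_bound A \<theta> k ((E * (1 + \<Phi>)) ^ ?n * 1) (\<lambda>\<upsilon>. ?v \<upsilon> * indicator (cyl y) \<upsilon>)"
      by (rule holder_bound_restrict[OF hv _ theta(1) cyl_local]) (use E_ge_1 Phi_nonneg in simp)
    show "?v \<omega> * indicator (cyl y) \<omega> \<le> ?v \<omega>" if "\<omega> \<in> X" for \<omega>
      using T_pow_nonneg[OF bounded_by_indicator _ that, of "cyl x" ?n] by (simp split: split_indicator)
  qed
  moreover have "I ?v = I ?u" by (rule I_T_pow[OF holder_indicator_cyl]) simp
  moreover have "0 < I (\<lambda>\<upsilon>. ?v \<upsilon> * indicator (cyl y) \<upsilon>)"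
    by (rule zero_less_mult_pos[OF less_le_trans[OF mult_pos_pos[OF v1 y(3)] v2] exp_gt_zero])
  ultimately show ?thesis by linarith
qed

section \<open>Drift towards the integral\<close>

lemma bounded_by_one: "bounded_by 1 (\<lambda>_. 1)"
  by (rule bounded_byI) simp

lemma I_one: "I (\<lambda>_. 1) = 1"
  using prob_space by simp

lemma I_restrict_le:
  assumes "holder_bound A \<theta> k b u" "0 \<le> b" "\<And>\<omega>. \<omega> \<in> X \<Longrightarrow> 0 \<le> u \<omega>"
    and "\<And>\<omega> \<upsilon>. agree k \<omega> \<upsilon> \<Longrightarrow> \<omega> \<in> E' \<longleftrightarrow> \<upsilon> \<in> E'"
  shows "I (\<lambda>\<upsilon>. u \<upsilon> * indicator E' \<upsilon>) \<le> I u"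
  by (rule I_mono[OF holder_bound_restrict[OF assms(1,2) theta(1) assms(4)] assms(1)])
    (use assms(3) in \<open>auto split: split_indicator\<close>)

text \<open>On the finitely many chosen cylinders \<open>u\<close> is at most a constant times
  \<open>I u\<close>; elsewhere it is at most \<open>b\<close>, and \<open>T ^^ k\<close> brings the
  indicator of this remaining set down to \<epsilon>.\<close>

lemma lyapunov:
  assumes "0 < \<epsilon>"
  shows "\<exists>K\<ge>0. \<forall>u b. cone (c1 + 1) u \<longrightarrow> bounded_by b u \<longrightarrow> (\<forall>\<omega>\<in>X. (T ^^ k) u \<omega> \<le> \<epsilon> * b + K * I u)"
proof -
  obtain Q where Q: "finite Q" "Q \<subseteq> XM"
    "\<And>\<omega>. \<omega> \<in> X \<Longrightarrow> (T ^^ k) (indicator {\<omega>. \<forall>x\<in>Q. \<omega> \<notin> cyl x}) \<omega> \<le> \<epsilon>"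
    using tail_estimate[OF assms] by blast
  let ?m = "\<lambda>x. I (indicator (cyl x))"
  \<comment> \<open>One Harnack constant per cylinder; the sum dominates each of them and is defined
    for empty \<open>Q\<close> too.\<close>
  let ?K = "\<Sum>x\<in>Q. exp (c1 + 1) / ?m x"
  let ?R = "{\<omega>. \<forall>x\<in>Q. \<omega> \<notin> cyl x}"
  have m: "0 < ?m x" if "x \<in> Q" for x using cylinder_mass_pos that Q(2) by blast
  have K: "0 \<le> ?K" using m by (intro sum_nonneg) (simp add: less_imp_le)
  have "(T ^^ k) u \<omega> \<le> \<epsilon> * b + (?K * E ^ k) * I u"
    if u: "cone (c1 + 1) u" "bounded_by b u" and w: "\<omega> \<in> X" for u b \<omega>
  proof -
    note hb = cone_holder[OF u]
    have b: "0 \<le> b" by (rule bounded_by_nonneg[OF u(2) w])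
    have b': "0 \<le> (1 + (c1 + 1) * exp (c1 + 1)) * b" using b c1_nonneg by simp
    have Iu: "0 \<le> I u" by (rule I_nonneg) (rule coneD(1)[OF u(1)])
    have pt: "u \<tau> \<le> b * indicator ?R \<tau> + (?K * I u) * 1" if t: "\<tau> \<in> X" for \<tau>
    proof (cases "\<tau> \<in> ?R")
      case True
      then show ?thesis using bounded_byD[OF u(2) t] mult_nonneg_nonneg[OF K Iu] by simp
    next
      case False
      then obtain x where x: "x \<in> Q" "\<tau> \<in> cyl x" by blast
      have "u \<tau> * ?m x \<le> exp (c1 + 1) * I (\<lambda>\<upsilon>. u \<upsilon> * indicator (cyl x) \<upsilon>)"
        by (rule cone_times_mass_le(1)[OF u t x(2)])
      also have "\<dots> \<le> exp (c1 + 1) * I u"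
        by (intro mult_left_mono I_restrict_le[OF hb b' coneD(1)[OF u(1)] cyl_local]) simp_all
      finally have "u \<tau> \<le> exp (c1 + 1) / ?m x * I u"
        using m[OF x(1)] by (simp add: pos_le_divide_eq)
      also have "\<dots> \<le> ?K * I u"
        using m by (intro mult_right_mono member_le_sum x Q(1) Iu) (simp add: less_imp_le)
      finally show ?thesis using b by (simp split: split_indicator)
    qed
    have "(T ^^ k) u \<omega> \<le> (T ^^ k) (\<lambda>\<tau>. b * indicator ?R \<tau> + (?K * I u) * 1) \<omega>"
      by (rule T_pow_mono[OF u(2) bounded_by_linear[OF bounded_by_indicator bounded_by_one] pt w])
    also have "\<dots> = b * (T ^^ k) (indicator ?R) \<omega> + (?K * I u) * (T ^^ k) (\<lambda>_. 1) \<omega>"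
      by (rule T_pow_linear[OF bounded_by_indicator bounded_by_one w])
    also have "\<dots> \<le> b * \<epsilon> + (?K * I u) * E ^ k"
      using bounded_byD[OF T_pow_bounded[OF bounded_by_one] w, of k] Q(3)[OF w]
      by (intro add_mono mult_left_mono b mult_nonneg_nonneg K Iu) (simp_all add: abs_le_iff)
    finally show ?thesis by (simp add: mult_ac)
  qed
  then show ?thesis using K E_ge_1 by (intro exI[of _ "?K * E ^ k"]) simp
qed

lemma cone_one: "cone (c1 + 1) (\<lambda>_. 1)"
  using cone_indicator[of UNIV] by simp

text \<open>The bound \<open>E ^ n\<close> may grow with \<open>n\<close>. In blocks of
  \<open>k\<close> steps, where all iterates of 1 have integral 1, the drift estimate with factor
  1/2 turns a bound \<open>C\<close> into \<open>C / 2 + K\<close>, which is at most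
  \<open>C\<close> once \<open>C \<ge> 2 * K\<close>. The value \<open>E ^ k\<close> covers the
  times before the first block.\<close>

lemma T_pow_one_bounded: "\<exists>C\<ge>1. \<forall>n. \<forall>\<omega>\<in>X. (T ^^ n) (\<lambda>_. 1) \<omega> \<le> C"
proof -
  have half: "0 < (1/2::real)" by simp
  obtain K where K: "0 \<le> K"
    "\<And>u b \<omega>. cone (c1 + 1) u \<Longrightarrow> bounded_by b u \<Longrightarrow> \<omega> \<in> X \<Longrightarrow> (T ^^ k) u \<omega> \<le> 1/2 * b + K * I u"
    using lyapunov[OF half] by blast
  let ?C = "max (E ^ k) (2 * K)"
  have E1: "1 \<le> E ^ k" using E_ge_1 by (rule one_le_power)
  have "\<forall>\<omega>\<in>X. (T ^^ n) (\<lambda>_. 1) \<omega> \<le> ?C" for n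
  proof (induction n rule: less_induct)
    case (less n)
    show ?case
    proof (cases "n < k")
      case True
      have "E ^ n \<le> E ^ k" using True E_ge_1 by (intro power_increasing) simp_all
      then show ?thesis using bounded_byD[OF T_pow_bounded[OF bounded_by_one], of _ n]
        by (fastforce simp: abs_le_iff)
    next
      case False
      define m where "m = n - k"
      have n: "n = k + m" and mn: "m < n" using False k_ge_1 by (simp_all add: m_def)
      let ?u = "(T ^^ m) (\<lambda>_. 1)"
      have "bounded_by ?C ?u"
        by (rule bounded_byI) (use less[OF mn] T_pow_nonneg[OF bounded_by_one] in simp)
      moreover have "I ?u = 1"
        using I_T_pow[OF holder_bound_const[OF theta(1), of A k 1], of m] I_one by simp
      ultimately have "(T ^^ k) ?u \<omega> \<le> ?C" if "\<omega> \<in> X" for \<omega>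
        using K(2)[OF cone_T_pow[OF cone_one bounded_by_one] _ that, of ?C m] by simp
      then show ?thesis by (simp add: n funpow_add)
    qed
  qed
  then show ?thesis using E1 by (intro exI[of _ ?C]) simp
qed

text \<open>The steps before the last \<open>k\<close> raise the sup by at most the uniform bound
  \<open>C\<close> on iterates of 1, so the last \<open>k\<close> steps are run with
  \<open>\<epsilon> = 1 / (4 * C)\<close>.\<close>

lemma uniform_lyapunov:
  "\<exists>K\<ge>0. \<forall>u b n. cone (c1 + 1) u \<longrightarrow> bounded_by b u \<longrightarrow> k \<le> n \<longrightarrow> (\<forall>\<omega>\<in>X. (T ^^ n) u \<omega> \<le> b / 4 + K * I u)"
proof -
  obtain C where C: "1 \<le> C" "\<And>n \<omega>. \<omega> \<in> X \<Longrightarrow> (T ^^ n) (\<lambda>_. 1) \<omega> \<le> C"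
    using T_pow_one_bounded by blast
  have pos: "0 < 1 / (4 * C)" using C(1) by simp
  obtain K where K: "0 \<le> K"
    "\<And>u b \<omega>. cone (c1 + 1) u \<Longrightarrow> bounded_by b u \<Longrightarrow> \<omega> \<in> X \<Longrightarrow> (T ^^ k) u \<omega> \<le> 1 / (4 * C) * b + K * I u"
    using lyapunov[OF pos] by blast
  have "(T ^^ n) u \<omega> \<le> b / 4 + K * I u"
    if u: "cone (c1 + 1) u" "bounded_by b u" and n: "k \<le> n" and w: "\<omega> \<in> X" for u b n \<omega>
  proof -
    have b: "0 \<le> b" by (rule bounded_by_nonneg[OF u(2) w])
    have b': "0 \<le> (1 + (c1 + 1) * exp (c1 + 1)) * b" using b c1_nonneg by simp
    define m where "m = n - k"
    have nm: "n = k + m" using n by (simp add: m_def)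
    let ?u = "(T ^^ m) u"
    have "bounded_by (C * b) ?u"
    proof (rule bounded_byI)
      fix \<tau> assume t: "\<tau> \<in> X"
      have "?u \<tau> \<le> (T ^^ m) (\<lambda>_. b * 1) \<tau>"
        by (rule T_pow_mono[OF u(2) _ _ t, of b])
          (use bounded_byD[OF u(2)] b in \<open>simp_all add: bounded_by_def abs_le_iff\<close>)
      also have "\<dots> = b * (T ^^ m) (\<lambda>_. 1) \<tau>" by (rule T_pow_scale[OF bounded_by_one t])
      also have "\<dots> \<le> b * C" by (rule mult_left_mono[OF C(2)[OF t] b])
      finally show "\<bar>?u \<tau>\<bar> \<le> C * b"
        using T_pow_nonneg[OF u(2) coneD(1)[OF u(1)] t, of m] by (simp add: mult.commute)
    qed
    moreover have "I ?u = I u" by (rule I_T_pow[OF cone_holder[OF u] b'])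
    ultimately have "(T ^^ k) ?u \<omega> \<le> 1 / (4 * C) * (C * b) + K * I u"
      using K(2)[OF cone_T_pow[OF u] _ w, of "C * b" m] by simp
    then show ?thesis using C(1) by (simp add: nm funpow_add)
  qed
  then show ?thesis using K(1) by blast
qed

section \<open>Coupling inside a cyclic class\<close>

definition supported :: "nat \<Rightarrow> ('s point \<Rightarrow> real) \<Rightarrow> bool" where
  "supported j u \<longleftrightarrow> (\<forall>\<omega>\<in>X. \<omega> \<notin> sector j \<longrightarrow> u \<omega> = 0)"

lemma supported_T:
  assumes "supported j u" "j < p"
  shows "supported (Suc j mod p) (T u)"
  unfolding supported_def
proof (intro ballI impI)
  fix \<omega> assume w: "\<omega> \<in> X" "\<omega> \<notin> sector (Suc j mod p)"
  have "exp (\<phi> (prepend a \<omega>)) * u (prepend a \<omega>) = 0" if "M a (\<omega> 0) = 1" for a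
  proof -
    have "prepend a \<omega> \<notin> sector j" using class_step[OF that assms(2)] w(2) by (simp add: sector_def)
    then show ?thesis using assms(1) prepend_in_X[OF w(1) that] by (simp add: supported_def)
  qed
  then show "T u \<omega> = 0" using w(1) unfolding real_transfer_def by (simp, intro infsum_0) simp
qed

lemma supported_T_pow:
  assumes "supported j u" "j < p"
  shows "supported ((j + n) mod p) ((T ^^ n) u)"
proof (induction n)
  case (Suc n)
  have "(j + n) mod p < p" using p_pos by simp
  from supported_T[OF Suc this] show ?case by (simp add: mod_Suc_eq)
qed (use assms in simp)

text \<open>Tying the sup to the integral prevents the integral from being concentrated where \<nu>
  has little mass. The condition is homogeneous in \<open>u\<close>, so it survives the loss of
  integral in every coupling step.\<close>

definition normal_class :: "nat \<Rightarrow> real \<Rightarrow> ('s point \<Rightarrow> real) set" where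
  "normal_class j B = {u. cone (c1 + 1) u \<and> bounded_by (B * I u) u \<and> supported j u}"

section \<open>Minorisation on one cylinder\<close>

lemma finite_common_lower_bound:
  fixes f :: "'i \<Rightarrow> 'a \<Rightarrow> real"
  assumes "finite Q" "\<And>x. x \<in> Q \<Longrightarrow> \<exists>\<eta>>0. \<forall>\<omega>\<in>S. \<eta> \<le> f x \<omega>"
  shows "\<exists>\<eta>>0. \<forall>x\<in>Q. \<forall>\<omega>\<in>S. \<eta> \<le> f x \<omega>"
  using assms
proof (induction Q)
  case empty
  show ?case by (rule exI[of _ 1]) simp
next
  case (insert x Q)
  obtain \<eta> where \<eta>: "0 < \<eta>" "\<And>x \<omega>. x \<in> Q \<Longrightarrow> \<omega> \<in> S \<Longrightarrow> \<eta> \<le> f x \<omega>" using insert by blast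
  obtain \<eta>' where \<eta>': "0 < \<eta>'" "\<And>\<omega>. \<omega> \<in> S \<Longrightarrow> \<eta>' \<le> f x \<omega>" using insert.prems[of x] by blast
  show ?case using \<eta> \<eta>' by (intro exI[of _ "min \<eta> \<eta>'"]) (simp add: min_le_iff_disj)
qed

text \<open>At most half of \<open>I u\<close> comes from outside the finitely many chosen
  cylinders, so one of them carries a fixed share. The Harnack inequality makes this a lower bound
  for \<open>u\<close> on that cylinder, and mixing transports it to \<open>cyl y\<close>. Which
  cylinder occurs depends on \<open>u\<close>; finiteness makes time and constant uniform.\<close>

lemma small_set:
  assumes j: "j < p" and y: "y \<in> XM" "y \<in> sector j" and B: "0 < B"
  shows "\<exists>n \<eta>. k \<le> n \<and> p dvd n \<and> 0 < \<eta> \<and>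
    (\<forall>u\<in>normal_class j B. \<forall>\<omega>\<in>X. \<omega> \<in> cyl y \<longrightarrow> \<eta> * I u \<le> (T ^^ n) u \<omega>)"
proof -
  \<comment> \<open>A set of mass \<open>1 / (2 * B)\<close> on which \<open>u \<le> B * I u\<close>
    contributes at most half of \<open>I u\<close>.\<close>
  have Bpos: "0 < 1 / (2 * B)" using B by simp
  obtain Q where Q: "finite Q" "Q \<subseteq> XM"
    "\<And>\<omega>. \<omega> \<in> X \<Longrightarrow> (T ^^ k) (indicator {\<omega>. \<forall>x\<in>Q. \<omega> \<notin> cyl x}) \<omega> \<le> 1 / (2 * B)"
    using tail_estimate[OF Bpos] by blast
  let ?R = "{\<omega>. \<forall>x\<in>Q. \<omega> \<notin> cyl x}"
  define Q' where "Q' = {x \<in> Q. x \<in> sector j}"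
  have Q': "finite Q'" "\<And>x. x \<in> Q' \<Longrightarrow> x \<in> XM" "\<And>x. x \<in> Q' \<Longrightarrow> x 0 \<in> D j"
    using Q by (auto simp: Q'_def sector_def)
  have "\<forall>x\<in>Q'. \<forall>\<^sub>F n in sequentially. \<exists>z\<in>XM. agree k z x \<and> agree k ((shift ^^ (p * n)) z) y"
    unfolding eventually_sequentially
    by (rule ballI, rule mixing[OF j Q'(2) Q'(3) y(1)]) (use y(2) in \<open>simp_all add: sector_def\<close>)
  then have "\<forall>\<^sub>F n in sequentially. \<forall>x\<in>Q'. \<exists>z\<in>XM. agree k z x \<and> agree k ((shift ^^ (p * n)) z) y"
    by (rule eventually_ball_finite[OF Q'(1)])
  then obtain N where N: "\<And>n x. N \<le> n \<Longrightarrow> x \<in> Q' \<Longrightarrow> \<exists>z\<in>XM. agree k z x \<and> agree k ((shift ^^ (p * n)) z) y"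
    unfolding eventually_sequentially by blast
  \<comment> \<open>Adding \<open>k\<close> to \<open>N\<close> forces \<open>k \<le> n\<close>, as
    \<open>p\<close> is positive.\<close>
  define n where "n = p * (N + k)"
  have n: "k \<le> n" "p dvd n"
    using p_pos by (simp_all add: n_def trans_le_add2 add_mult_distrib2)
  have "\<exists>\<eta>>0. \<forall>\<omega>\<in>X \<inter> cyl y. \<eta> \<le> (T ^^ n) (indicator (cyl x)) \<omega>" if x: "x \<in> Q'" for x
  proof -
    obtain z where z: "z \<in> XM" "agree k z x" "agree k ((shift ^^ n) z) y"
      using N[of "N + k", OF _ x] by (auto simp: n_def)
    let ?v = "(T ^^ n) (indicator (cyl x))" and ?s = "(shift ^^ n) z"
    have sX: "?s \<in> X" by (rule shift_pow_in_full_shift[OF XM_subset_X[OF z(1)]])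
    have pos: "0 < ?v ?s"
      by (rule T_pow_pos[OF bounded_by_indicator _ XM_subset_X[OF z(1)]])
        (use z in \<open>simp_all add: cyl_def subshift_def\<close>)
    have "?v ?s / exp (c1 + 1) \<le> ?v \<omega>" if w: "\<omega> \<in> X \<inter> cyl y" for \<omega>
    proof -
      have "agree k ?s \<omega>" using z(3) w agree_sym agree_trans unfolding cyl_def by blast
      then have "?v ?s \<le> exp (c1 + 1) * ?v \<omega>"
        using w by (intro cone_agree_le[OF cone_T_pow[OF cone_indicator[OF cyl_local] bounded_by_indicator] sX]) simp_all
      then show ?thesis by (simp add: pos_divide_le_eq mult.commute)
    qed
    then show ?thesis using pos by (intro exI[of _ "?v ?s / exp (c1 + 1)"]) simp
  qed
  then obtain \<eta> where \<eta>: "0 < \<eta>" "\<And>x \<omega>. x \<in> Q' \<Longrightarrow> \<omega> \<in> X \<inter> cyl y \<Longrightarrow> \<eta> \<le> (T ^^ n) (indicator (cyl x)) \<omega>"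
    using finite_common_lower_bound[OF Q'(1), of "X \<inter> cyl y" "\<lambda>x. (T ^^ n) (indicator (cyl x))"] by blast
  \<comment> \<open>Chosen so that \<open>card Q * \<delta> < 1/2\<close> strictly, also for empty
    \<open>Q\<close>: if every cylinder carried less than \<open>\<delta> * I u\<close>, their total
    would fall below half of \<open>I u\<close>.\<close>
  define \<delta> where "\<delta> = 1 / (2 * real (card Q) + 1)"
  have \<delta>: "0 < \<delta>" by (simp add: \<delta>_def)
  have "\<eta> * (\<delta> / exp (c1 + 1)) * I u \<le> (T ^^ n) u \<omega>"
    if u: "u \<in> normal_class j B" and w: "\<omega> \<in> X" "\<omega> \<in> cyl y" for u \<omega>
  proof -
    have u': "cone (c1 + 1) u" "bounded_by (B * I u) u" "supported j u"
      using u by (simp_all add: normal_class_def)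
    note nonneg = coneD(1)[OF u'(1)]
    have Iu: "0 \<le> I u" by (rule I_nonneg) (rule nonneg)
    note hb = cone_holder[OF u'(1,2)]
    have b': "0 \<le> (1 + (c1 + 1) * exp (c1 + 1)) * (B * I u)" using B Iu c1_nonneg by simp
    note hx = holder_bound_restrict[OF hb b' theta(1) cyl_local]
    show ?thesis
    proof (cases "I u = 0")
      case True
      then show ?thesis using T_pow_nonneg[OF u'(2) nonneg w(1)] by simp
    next
      case False
      then have Ipos: "0 < I u" using Iu by simp
      have Rloc: "\<And>\<omega> \<upsilon>. agree k \<omega> \<upsilon> \<Longrightarrow> \<omega> \<in> ?R \<longleftrightarrow> \<upsilon> \<in> ?R" using cyl_local by blast
      note hR = holder_bound_indicator[OF theta(1) Rloc, where 'b = real]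
      \<comment> \<open>By invariance the mass of the remaining set is the integral of
        \<open>T ^^ k\<close> of its indicator, which the tail estimate bounds pointwise.\<close>
      have IR: "I (indicator ?R) \<le> 1 / (2 * B)"
      proof -
        have "I (indicator ?R) = I ((T ^^ k) (indicator ?R))" by (rule I_T_pow[OF hR, symmetric]) simp_all
        also have "\<dots> \<le> 1 / (2 * B)" by (rule I_le[OF holder_bound_T_pow[OF hR]]) (simp_all add: Q(3))
        finally show ?thesis .
      qed
      have hS: "holder_bound A \<theta> k (\<Sum>x\<in>Q. (1 + (c1 + 1) * exp (c1 + 1)) * (B * I u))
          (\<lambda>\<tau>. \<Sum>x\<in>Q. u \<tau> * indicator (cyl x) \<tau>)"
        by (rule holder_bound_sum[OF Q(1) hx])
      have pt: "u \<tau> \<le> (B * I u) * indicator ?R \<tau> + 1 * (\<Sum>x\<in>Q. u \<tau> * indicator (cyl x) \<tau>)" if t: "\<tau> \<in> X" for \<tau>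
      proof (cases "\<tau> \<in> ?R")
        case True
        have "0 \<le> (\<Sum>x\<in>Q. u \<tau> * indicator (cyl x) \<tau>)" using nonneg[OF t] by (intro sum_nonneg) simp
        then show ?thesis using True bounded_byD[OF u'(2) t] by simp
      next
        case False
        then obtain x where x: "x \<in> Q" "\<tau> \<in> cyl x" by blast
        have "u \<tau> * indicator (cyl x) \<tau> \<le> (\<Sum>x\<in>Q. u \<tau> * indicator (cyl x) \<tau>)"
          by (rule member_le_sum[OF x(1) _ Q(1)]) (simp add: nonneg[OF t])
        then show ?thesis using False x(2) by simp
      qed
      have "I u \<le> I (\<lambda>\<tau>. (B * I u) * indicator ?R \<tau> + 1 * (\<Sum>x\<in>Q. u \<tau> * indicator (cyl x) \<tau>))"
        by (rule I_mono[OF hb holder_bound_add[OF holder_bound_scale[OF hR] holder_bound_scale[OF hS]] pt])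
      also have "\<dots> = (B * I u) * I (indicator ?R) + 1 * I (\<lambda>\<tau>. \<Sum>x\<in>Q. u \<tau> * indicator (cyl x) \<tau>)"
        by (rule I_linear[OF hR hS])
      also have "I (\<lambda>\<tau>. \<Sum>x\<in>Q. u \<tau> * indicator (cyl x) \<tau>) = (\<Sum>x\<in>Q. I (\<lambda>\<tau>. u \<tau> * indicator (cyl x) \<tau>))"
        by (rule I_sum) (use hx in blast)
      also have "(B * I u) * I (indicator ?R) \<le> (B * I u) * (1 / (2 * B))"
        using B Iu by (intro mult_left_mono IR) simp
      finally have half: "I u / 2 \<le> (\<Sum>x\<in>Q. I (\<lambda>\<tau>. u \<tau> * indicator (cyl x) \<tau>))" using B by simp
      have "\<exists>x\<in>Q. \<delta> * I u \<le> I (\<lambda>\<tau>. u \<tau> * indicator (cyl x) \<tau>)"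
      proof (rule ccontr)
        assume "\<not> ?thesis"
        then have "(\<Sum>x\<in>Q. I (\<lambda>\<tau>. u \<tau> * indicator (cyl x) \<tau>)) \<le> real (card Q) * (\<delta> * I u)"
          by (intro sum_bounded_above) (meson less_imp_le not_le)
        also have "\<dots> < I u / 2" using Ipos by (simp add: \<delta>_def field_simps)
        finally show False using half by simp
      qed
      then obtain x where x: "x \<in> Q" "\<delta> * I u \<le> I (\<lambda>\<tau>. u \<tau> * indicator (cyl x) \<tau>)" by blast
      have xX: "x \<in> X" using x(1) Q(2) XM_subset_X by blast
      have low: "\<delta> * I u / exp (c1 + 1) \<le> u \<tau>" if t: "\<tau> \<in> X" "\<tau> \<in> cyl x" for \<tau>
      proof -
        have "I (indicator (cyl x)) \<le> 1"
          by (rule I_le[OF holder_indicator_cyl]) (simp split: split_indicator)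
        then have "exp (c1 + 1) * u \<tau> * I (indicator (cyl x)) \<le> exp (c1 + 1) * u \<tau> * 1"
          by (intro mult_left_mono) (simp_all add: nonneg[OF t(1)])
        then show ?thesis
          using cone_times_mass_le(2)[OF u'(1,2) t] x(2) by (simp add: pos_divide_le_eq mult.commute)
      qed
      have "0 < \<delta> * I u / exp (c1 + 1)" using \<delta> Ipos by simp
      \<comment> \<open>This places the cylinder in sector \<open>j\<close>: its representative
        \<open>x\<close> is a point of \<open>X\<close> at which \<open>u\<close> does not
        vanish.\<close>
      then have "u x \<noteq> 0" using low[OF xX] by (simp add: cyl_def)
      then have xQ: "x \<in> Q'" using u'(3) xX x(1) unfolding supported_def Q'_def by blast
      let ?s = "\<delta> * I u / exp (c1 + 1)"
      have "?s * \<eta> \<le> ?s * (T ^^ n) (indicator (cyl x)) \<omega>"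
        using \<eta>(2)[OF xQ] w \<delta> Ipos by (intro mult_left_mono) simp_all
      also have "\<dots> = (T ^^ n) (\<lambda>\<tau>. ?s * indicator (cyl x) \<tau>) \<omega>"
        by (rule T_pow_scale[OF bounded_by_indicator w(1), symmetric])
      also have "\<dots> \<le> (T ^^ n) u \<omega>"
      proof (rule T_pow_mono[OF _ u'(2) _ w(1)])
        show "bounded_by ?s (\<lambda>\<tau>. ?s * indicator (cyl x) \<tau>)"
          by (rule bounded_byI) (use \<delta> Ipos in \<open>simp split: split_indicator\<close>)
        show "?s * indicator (cyl x) \<tau> \<le> u \<tau>" if "\<tau> \<in> X" for \<tau>
          using low[OF that] nonneg[OF that] by (simp split: split_indicator)
      qed
      finally show ?thesis by (simp add: mult_ac)
    qed
  qed
  then show ?thesis using n \<eta>(1) \<delta> by (intro exI[of _ n] exI[of _ "\<eta> * (\<delta> / exp (c1 + 1))"]) simp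
qed

text \<open>
  The strict inclusion of the cone with constant \<open>c1 + \<theta>\<close> in the one with constant \<open>c1 + 1\<close> leaves room
  for subtracting a small multiple of the indicator of a cylinder.
\<close>

lemma cone_subtract:
  assumes v: "cone (c1 + \<theta>) v" and low: "\<And>\<omega>. \<omega> \<in> X \<Longrightarrow> \<omega> \<in> cyl y \<Longrightarrow> \<eta> \<le> v \<omega>"
    and q: "q \<le> \<eta>" "(c1 + 1) * exp (c1 + 1) * q \<le> (1 - \<theta>) * \<eta>"
  shows "cone (c1 + 1) (\<lambda>\<omega>. v \<omega> - q * indicator (cyl y) \<omega>)"
  unfolding cone_def
proof (intro conjI ballI impI)
  fix \<omega> assume "\<omega> \<in> X"
  then show "0 \<le> v \<omega> - q * indicator (cyl y) \<omega>"
    using low[of \<omega>] q(1) coneD(1)[OF v, of \<omega>] by (cases "\<omega> \<in> cyl y") simp_all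
next
  fix \<omega> \<upsilon> assume w: "\<omega> \<in> X" "\<upsilon> \<in> X" "agree k \<omega> \<upsilon>"
  let ?c = "c1 + 1" and ?c' = "c1 + \<theta>" and ?d = "d \<omega> \<upsilon>"
  have cyl: "\<omega> \<in> cyl y \<longleftrightarrow> \<upsilon> \<in> cyl y" by (rule cyl_local[OF w(3)])
  show "v \<omega> - q * indicator (cyl y) \<omega> \<le> exp (?c * ?d) * (v \<upsilon> - q * indicator (cyl y) \<upsilon>)"
  proof (cases "\<upsilon> \<in> cyl y")
    case False
    then show ?thesis using cyl coneD(2)[OF cone_mono[OF v, of ?c] w] theta by simp
  next
    case True
    have c: "0 \<le> ?c" "0 \<le> ?c'" using c1_nonneg theta by simp_all
    have vy: "\<eta> \<le> v \<upsilon>" by (rule low[OF w(2) True])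
    have v0: "0 \<le> v \<upsilon>" by (rule coneD(1)[OF v w(2)])
    \<comment> \<open>The larger cone constant gains at least \<open>(1 - \<theta>) * d\<close>. The
      loss caused by the subtraction is also linear in the distance, so the two can be
      compared.\<close>
    have "exp (?c' * ?d) - exp (?c * ?d) \<le> exp (?c' * ?d) * (?c' * ?d - ?c * ?d)" by (rule exp_diff_le)
    also have "\<dots> = - (exp (?c' * ?d) * ((1 - \<theta>) * ?d))" by (simp add: algebra_simps)
    also have "\<dots> \<le> - (1 * ((1 - \<theta>) * ?d))"
      using theta c by (intro le_imp_neg_le mult_right_mono) simp_all
    finally have gap: "(1 - \<theta>) * ?d \<le> exp (?c * ?d) - exp (?c' * ?d)" by simp
    have growth: "q * (exp (?c * ?d) - 1) \<le> (1 - \<theta>) * ?d * v \<upsilon>"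
    proof (cases "0 \<le> q")
      case True
      have "exp (?c * ?d) - 1 \<le> exp (?c * ?d) * (?c * ?d)"
        using exp_diff_le[of "?c * ?d" 0] by simp
      also have "\<dots> \<le> exp ?c * (?c * ?d)"
        using c d_le_1[of \<omega> \<upsilon>] by (intro mult_right_mono) (simp_all add: mult_left_le)
      finally have "q * (exp (?c * ?d) - 1) \<le> q * (exp ?c * (?c * ?d))" using True by (rule mult_left_mono)
      also have "\<dots> = (?c * exp ?c * q) * ?d" by (simp only: mult_ac)
      also have "\<dots> \<le> ((1 - \<theta>) * \<eta>) * ?d" by (rule mult_right_mono[OF q(2) d_nonneg])
      also have "\<dots> = ((1 - \<theta>) * ?d) * \<eta>" by (simp only: mult_ac)
      also have "\<dots> \<le> ((1 - \<theta>) * ?d) * v \<upsilon>" using theta by (intro mult_left_mono vy) simp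
      finally show ?thesis .
    next
      case False
      have "q * (exp (?c * ?d) - 1) \<le> 0" using False c by (intro mult_nonpos_nonneg) simp_all
      also have "0 \<le> (1 - \<theta>) * ?d * v \<upsilon>" using theta v0 by simp
      finally show ?thesis .
    qed
    have "v \<omega> \<le> exp (?c' * ?d) * v \<upsilon>" by (rule coneD(2)[OF v w])
    moreover have "(1 - \<theta>) * ?d * v \<upsilon> \<le> (exp (?c * ?d) - exp (?c' * ?d)) * v \<upsilon>"
      by (rule mult_right_mono[OF gap v0])
    ultimately show ?thesis using growth True cyl by (simp add: algebra_simps)
  qed
qed

section \<open>The coupling step and its iteration\<close>

lemma normal_classD:
  assumes "u \<in> normal_class j B"
  shows "cone (c1 + 1) u" "bounded_by (B * I u) u" "supported j u" "0 \<le> I u"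
  using assms coneD(1) by (auto simp: normal_class_def intro!: I_nonneg)

text \<open>The minorisation allows \<open>q * I u\<close> times an indicator to be split off, and
  the remainder is again in the class: its sup is at most \<open>(B / 4 + K) * I u\<close>, hence at
  most half of \<open>B * I u\<close> if \<open>B \<ge> 4 * K\<close>, while its integral is
  \<open>r * I u\<close> with \<open>r \<ge> 1/2\<close>. Allowing every large \<open>B\<close> lets
  the class be enlarged later until it contains the starting functions.\<close>

lemma one_step:
  assumes j: "j < p"
  shows "\<exists>B0. \<forall>B\<ge>B0. 0 < B \<longrightarrow> (\<exists>n>0. \<exists>q r. \<exists>y. 0 < r \<and> r < 1 \<and>
    (\<forall>u\<in>normal_class j B. \<exists>v\<in>normal_class j B. I v = r * I u \<and>
       (\<forall>\<omega>\<in>X. (T ^^ n) u \<omega> = v \<omega> + q * I u * indicator (cyl y) \<omega>)))"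
proof -
  obtain K where K: "0 \<le> K" "\<And>u b n \<omega>. cone (c1 + 1) u \<Longrightarrow> bounded_by b u \<Longrightarrow> k \<le> n \<Longrightarrow> \<omega> \<in> X \<Longrightarrow>
      (T ^^ n) u \<omega> \<le> b / 4 + K * I u"
    using uniform_lyapunov by blast
  obtain y where y: "y \<in> XM" "y \<in> sector j" "0 < I (indicator (cyl y))"
    using cylinder_mass_exists[OF j] by blast
  let ?m = "I (indicator (cyl y))"
  have m1: "?m \<le> 1" by (rule I_le[OF holder_indicator_cyl]) (simp split: split_indicator)
  have "\<exists>n>0. \<exists>q r. \<exists>y. 0 < r \<and> r < 1 \<and>
    (\<forall>u\<in>normal_class j B. \<exists>v\<in>normal_class j B. I v = r * I u \<and>
       (\<forall>\<omega>\<in>X. (T ^^ n) u \<omega> = v \<omega> + q * I u * indicator (cyl y) \<omega>))"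
    if B: "4 * K \<le> B" "0 < B" for B
  proof -
    obtain n \<eta> where n: "k \<le> n" "p dvd n" and \<eta>: "0 < \<eta>"
      "\<And>u \<omega>. u \<in> normal_class j B \<Longrightarrow> \<omega> \<in> X \<Longrightarrow> \<omega> \<in> cyl y \<Longrightarrow> \<eta> * I u \<le> (T ^^ n) u \<omega>"
      using small_set[OF j y(1,2) B(2)] by blast
    \<comment> \<open>The ratio of \<open>q\<close> to \<eta> at which the subtraction uses up the
      whole gap between the two cones.\<close>
    define \<tau> where "\<tau> = (1 - \<theta>) / ((c1 + 1) * exp (c1 + 1))"
    have cpos: "0 < (c1 + 1) * exp (c1 + 1)" using c1_nonneg by simp
    have \<tau>: "0 < \<tau>" using cpos theta by (simp add: \<tau>_def)
    \<comment> \<open>The bound 1/2 keeps half of the integral, as the cylinder has mass at most 1;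
      \<eta> keeps the remainder nonnegative, and \<open>\<tau> * \<eta>\<close> keeps it in the
      cone.\<close>
    define q where "q = min (1/2) (min \<eta> (\<tau> * \<eta>))"
    have q: "0 < q" "q \<le> 1/2" "q \<le> \<eta>" "q \<le> \<tau> * \<eta>" using \<eta>(1) \<tau> by (simp_all add: q_def)
    have "(c1 + 1) * exp (c1 + 1) * q \<le> (c1 + 1) * exp (c1 + 1) * (\<tau> * \<eta>)"
      using q(4) cpos by (intro mult_left_mono) simp_all
    also have "\<dots> = ((c1 + 1) * exp (c1 + 1) * \<tau>) * \<eta>" by (simp only: mult.assoc)
    also have "(c1 + 1) * exp (c1 + 1) * \<tau> = 1 - \<theta>"
      unfolding \<tau>_def using cpos by (intro nonzero_mult_div_cancel_left[THEN trans[OF times_divide_eq_right]]) linarith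
    finally have q5: "(c1 + 1) * exp (c1 + 1) * q \<le> (1 - \<theta>) * \<eta>" .
    define r where "r = 1 - q * ?m"
    have qm: "q * ?m \<le> 1/2" "0 < q * ?m" using q m1 y(3) mult_mono[of q "1/2" ?m 1] by simp_all
    have r: "1/2 \<le> r" "r < 1" using qm by (simp_all add: r_def)
    have "\<exists>v\<in>normal_class j B. I v = r * I u \<and>
       (\<forall>\<omega>\<in>X. (T ^^ n) u \<omega> = v \<omega> + q * I u * indicator (cyl y) \<omega>)" if u: "u \<in> normal_class j B" for u
    proof -
      note uD = normal_classD[OF u]
      note hb = cone_holder[OF uD(1,2)]
      have b': "0 \<le> (1 + (c1 + 1) * exp (c1 + 1)) * (B * I u)" using B uD(4) c1_nonneg by simp
      note hT = holder_bound_T_pow[OF hb b', of n]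
      let ?v = "\<lambda>\<omega>. 1 * (T ^^ n) u \<omega> + (- (q * I u)) * indicator (cyl y) \<omega>"
      have Iv: "I ?v = r * I u"
        using I_linear[OF hT holder_indicator_cyl, of 1 "- (q * I u)" y] I_T_pow[OF hb b', of n]
        by (simp add: r_def algebra_simps)
      have "cone (c1 + \<theta>) ((T ^^ n) u)"
        using n(1) k_ge_1 by (intro cone_T_pow_strict[OF uD(1,2)]) simp
      then have "cone (c1 + 1) (\<lambda>\<omega>. (T ^^ n) u \<omega> - (q * I u) * indicator (cyl y) \<omega>)"
      proof (rule cone_subtract[where \<eta> = "\<eta> * I u"])
        show "q * I u \<le> \<eta> * I u" using q(3) uD(4) by (rule mult_right_mono)
        show "(c1 + 1) * exp (c1 + 1) * (q * I u) \<le> (1 - \<theta>) * (\<eta> * I u)"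
          using mult_right_mono[OF q5 uD(4)] by (simp add: mult_ac)
      qed (rule \<eta>(2)[OF u])
      then have cv: "cone (c1 + 1) ?v" by simp
      have "bounded_by (B * I ?v) ?v"
      proof (rule bounded_byI)
        fix \<omega> assume w: "\<omega> \<in> X"
        have "?v \<omega> \<le> (T ^^ n) u \<omega>" using q uD(4) by (simp split: split_indicator)
        also have "\<dots> \<le> B * I u / 4 + K * I u" by (rule K(2)[OF uD(1,2) n(1) w])
        also have "K * I u \<le> B / 4 * I u" using B uD(4) by (intro mult_right_mono) simp_all
        also have "B * I u / 4 + B / 4 * I u = B * I u * (1/2)" by simp
        also have "\<dots> \<le> B * I u * r" using B uD(4) r by (intro mult_left_mono) simp_all
        finally have "?v \<omega> \<le> B * I ?v" unfolding Iv by (simp only: mult_ac)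
        then show "\<bar>?v \<omega>\<bar> \<le> B * I ?v" using coneD(1)[OF cv w] by (simp only: abs_of_nonneg)
      qed
      moreover have "supported j ?v"
        unfolding supported_def
      proof (intro ballI impI)
        fix \<omega> assume w: "\<omega> \<in> X" "\<omega> \<notin> sector j"
        \<comment> \<open>The time is a multiple of \<open>p\<close>, so functions return to their
          sector.\<close>
        have "(j + n) mod p = j" using n(2) j by (metis dvd_eq_mod_eq_0 mod_add_right_eq mod_less add_0_right)
        then have "(T ^^ n) u \<omega> = 0" using supported_T_pow[OF uD(3) j, of n] w by (simp add: supported_def)
        moreover have "\<omega> \<notin> cyl y" using w(2) y(2) sector_local[of \<omega> y j] by (auto simp: cyl_def)
        ultimately show "?v \<omega> = 0" by simp
      qed
      ultimately have "?v \<in> normal_class j B" using cv by (simp add: normal_class_def)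
      then show ?thesis using Iv by (intro bexI[of _ ?v]) simp_all
    qed
    then show ?thesis using r n(1) k_ge_1 by (intro exI[of _ n] conjI exI[of _ q] exI[of _ r] exI[of _ y]) simp_all
  qed
  then show ?thesis by blast
qed

text \<open>What is split off depends on a function only through its integral, so it is the same for
  both functions and cancels in the difference. The integrals remain equal, and the step can be
  repeated.\<close>

lemma coupling:
  assumes step: "\<And>u. u \<in> normal_class j B \<Longrightarrow> \<exists>v\<in>normal_class j B. I v = r * I u \<and>
       (\<forall>\<omega>\<in>X. (T ^^ n) u \<omega> = v \<omega> + q * I u * indicator (cyl y) \<omega>)"
    and u: "u \<in> normal_class j B" "u' \<in> normal_class j B" "I u = I u'"
  shows "\<exists>v\<in>normal_class j B. \<exists>v'\<in>normal_class j B. I v = r ^ i * I u \<and> I v' = r ^ i * I u \<and>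
           (\<forall>\<omega>\<in>X. (T ^^ (n * i)) (\<lambda>\<omega>. u \<omega> - u' \<omega>) \<omega> = v \<omega> - v' \<omega>)"
proof (induction i)
  case 0
  show ?case using u by (intro bexI[of _ u] bexI[of _ u']) simp_all
next
  case (Suc i)
  then obtain v v' where v: "v \<in> normal_class j B" "v' \<in> normal_class j B"
    "I v = r ^ i * I u" "I v' = r ^ i * I u"
    "\<And>\<omega>. \<omega> \<in> X \<Longrightarrow> (T ^^ (n * i)) (\<lambda>\<omega>. u \<omega> - u' \<omega>) \<omega> = v \<omega> - v' \<omega>" by blast
  obtain z where z: "z \<in> normal_class j B" "I z = r * I v"
    "\<And>\<omega>. \<omega> \<in> X \<Longrightarrow> (T ^^ n) v \<omega> = z \<omega> + q * I v * indicator (cyl y) \<omega>" using step[OF v(1)] by blast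
  obtain z' where z': "z' \<in> normal_class j B" "I z' = r * I v'"
    "\<And>\<omega>. \<omega> \<in> X \<Longrightarrow> (T ^^ n) v' \<omega> = z' \<omega> + q * I v' * indicator (cyl y) \<omega>" using step[OF v(2)] by blast
  have "(T ^^ (n * Suc i)) (\<lambda>\<omega>. u \<omega> - u' \<omega>) \<omega> = z \<omega> - z' \<omega>" if w: "\<omega> \<in> X" for \<omega>
  proof -
    have "(T ^^ (n * Suc i)) (\<lambda>\<omega>. u \<omega> - u' \<omega>) \<omega> = (T ^^ n) ((T ^^ (n * i)) (\<lambda>\<omega>. u \<omega> - u' \<omega>)) \<omega>"
      by (simp add: funpow_add)
    also have "\<dots> = (T ^^ n) (\<lambda>\<omega>. v \<omega> - v' \<omega>) \<omega>" by (rule T_pow_cong[OF v(5) w])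
    also have "\<dots> = (T ^^ n) v \<omega> - (T ^^ n) v' \<omega>"
      by (rule T_pow_diff[OF normal_classD(2)[OF v(1)] normal_classD(2)[OF v(2)] w])
    finally show ?thesis using z(3)[OF w] z'(3)[OF w] v(3,4) by simp
  qed
  then show ?case using z(1,2) z'(1,2) v(3,4) by (intro bexI[of _ z] bexI[of _ z']) simp_all
qed

text \<open>
  Adding the constant \<open>t\<close> on the sector moves \<open>w\<close> into the cone: there \<open>w + t \<ge> b / (c1 + 1)\<close>, which
  absorbs the H\<ouml>lder constant \<open>b\<close> of \<open>w\<close>.
\<close>

lemma sector_normal_class:
  assumes j: "j < p" and w: "holder_bound A \<theta> k b w" "supported j w" "I w = 0" and b: "0 \<le> b"
    and B: "2 / I (indicator (sector j)) \<le> B"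
  defines "t \<equiv> b + b / (c1 + 1)"
  shows "(\<lambda>\<omega>. w \<omega> + t * indicator (sector j) \<omega>) \<in> normal_class j B"
    and "(\<lambda>\<omega>. t * indicator (sector j) \<omega>) \<in> normal_class j B"
    and "I (\<lambda>\<omega>. w \<omega> + t * indicator (sector j) \<omega>) = t * I (indicator (sector j))"
    and "I (\<lambda>\<omega>. t * indicator (sector j) \<omega>) = t * I (indicator (sector j))"
proof -
  let ?m = "I (indicator (sector j))"
  let ?u = "\<lambda>\<omega>. w \<omega> + t * indicator (sector j) \<omega>" and ?u' = "\<lambda>\<omega>. t * indicator (sector j) \<omega>"
  have c: "0 < c1 + 1" using c1_nonneg by simp
  have t: "0 \<le> t" "b \<le> t" using b c by (simp_all add: t_def)
  have m: "0 < ?m" by (rule sector_mass_pos[OF j])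
  \<comment> \<open>Both functions have sup at most \<open>2 * t\<close> and integral
    \<open>t\<close> times the mass of the sector, which explains the lower bound required of
    \<open>B\<close>.\<close>
  have Bm: "2 \<le> B * ?m" using B m by (simp add: pos_divide_le_eq)
  have tB: "2 * t \<le> B * (t * ?m)" using mult_right_mono[OF Bm t(1)] by (simp add: mult_ac)
  show I': "I ?u' = t * ?m" by simp
  show Iu: "I ?u = t * ?m"
    using I_linear[OF w(1) holder_indicator_sector, of 1 t j] w(3) by simp
  have "cone (c1 + 1) ?u'"
    using cone_indicator[OF sector_local, of j] t(1) unfolding cone_def
    by (auto simp: mult_left_mono mult.left_commute)
  moreover have "bounded_by (B * (t * ?m)) ?u'"
    by (rule bounded_byI) (use t tB in \<open>simp split: split_indicator\<close>)
  ultimately show "?u' \<in> normal_class j B" by (simp add: normal_class_def I' supported_def)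
  have "cone (c1 + 1) ?u"
    unfolding cone_def
  proof (intro conjI ballI impI)
    fix \<omega> assume "\<omega> \<in> X"
    then show "0 \<le> ?u \<omega>"
      using holder_boundD(1)[OF w(1), of \<omega>] w(2) t by (auto simp: supported_def split: split_indicator)
  next
    fix \<omega> \<upsilon> assume o: "\<omega> \<in> X" "\<upsilon> \<in> X" "agree k \<omega> \<upsilon>"
    show "?u \<omega> \<le> exp ((c1 + 1) * d \<omega> \<upsilon>) * ?u \<upsilon>"
    proof (cases "\<upsilon> \<in> sector j")
      case False
      then show ?thesis using sector_local[OF o(3), of j] w(2) o by (simp add: supported_def)
    next
      case True
      then have True': "\<omega> \<in> sector j" using sector_local[OF o(3)] by simp
      have "- b \<le> w \<upsilon>" using holder_boundD(1)[OF w(1) o(2)] by simp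
      then have low: "b / (c1 + 1) \<le> ?u \<upsilon>" using True by (simp add: t_def)
      have nn: "0 \<le> ?u \<upsilon>" using order_trans[OF _ low, of 0] b c by simp
      have "?u \<omega> \<le> ?u \<upsilon> + b * d \<omega> \<upsilon>"
        using holder_boundD(2)[OF w(1) o] True True' by simp
      also have "b * d \<omega> \<upsilon> \<le> ((c1 + 1) * ?u \<upsilon>) * d \<omega> \<upsilon>"
        using low c by (intro mult_right_mono) (simp_all add: pos_divide_le_eq mult.commute)
      also have "?u \<upsilon> + ((c1 + 1) * ?u \<upsilon>) * d \<omega> \<upsilon> = (1 + (c1 + 1) * d \<omega> \<upsilon>) * ?u \<upsilon>" by (simp add: algebra_simps)
      also have "\<dots> \<le> exp ((c1 + 1) * d \<omega> \<upsilon>) * ?u \<upsilon>"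
        by (rule mult_right_mono[OF exp_ge_add_one_self nn])
      finally show ?thesis by simp
    qed
  qed
  moreover have "bounded_by (B * (t * ?m)) ?u"
  proof (rule bounded_byI)
    fix \<omega> assume "\<omega> \<in> X"
    then have "\<bar>w \<omega>\<bar> \<le> t" using holder_boundD(1)[OF w(1)] t(2) by fastforce
    then have "\<bar>?u \<omega>\<bar> \<le> 2 * t" using t(1) by (cases "\<omega> \<in> sector j") (simp_all add: abs_le_iff)
    then show "\<bar>?u \<omega>\<bar> \<le> B * (t * ?m)" using tB by linarith
  qed
  ultimately show "?u \<in> normal_class j B" using w(2) by (simp add: normal_class_def Iu supported_def)
qed

text \<open>\<open>w\<close> is the difference of two functions of the class with equal integrals.
  After \<open>i\<close> coupling steps these integrals have shrunk by \<open>r ^ i\<close>, and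
  within the class the integral bounds the Hoelder norm.\<close>

lemma sector_decay_steps:
  assumes j: "j < p"
  shows "\<exists>n>0. \<exists>C\<ge>0. \<exists>r>0. r < 1 \<and> (\<forall>w b i. holder_bound A \<theta> k b w \<longrightarrow> supported j w \<longrightarrow> I w = 0 \<longrightarrow> 0 \<le> b \<longrightarrow>
           holder_bound A \<theta> k (C * r ^ i * b) ((T ^^ (n * i)) w))"
proof -
  let ?m = "I (indicator (sector j))"
  have m: "0 < ?m" by (rule sector_mass_pos[OF j])
  obtain B0 where B0: "\<And>B. B0 \<le> B \<Longrightarrow> 0 < B \<Longrightarrow> \<exists>n>0. \<exists>q r. \<exists>y. 0 < r \<and> r < 1 \<and>
    (\<forall>u\<in>normal_class j B. \<exists>v\<in>normal_class j B. I v = r * I u \<and>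
       (\<forall>\<omega>\<in>X. (T ^^ n) u \<omega> = v \<omega> + q * I u * indicator (cyl y) \<omega>))"
    using one_step[OF j] by blast
  \<comment> \<open>\<open>B0\<close> makes the coupling step available, and \<open>2 / ?m\<close>
    puts the starting functions into the class.\<close>
  define B where "B = max B0 (2 / ?m)"
  have B: "B0 \<le> B" "2 / ?m \<le> B" by (simp_all add: B_def)
  have Bpos: "0 < B" using less_le_trans[OF _ B(2), of 0] m by simp
  obtain n q r y where nr: "0 < n" "0 < r" "r < 1"
    and step: "\<And>u. u \<in> normal_class j B \<Longrightarrow> \<exists>v\<in>normal_class j B. I v = r * I u \<and>
       (\<forall>\<omega>\<in>X. (T ^^ n) u \<omega> = v \<omega> + q * I u * indicator (cyl y) \<omega>)"
    using B0[OF B(1) Bpos] by blast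
  define G where "G = (1 + (c1 + 1) * exp (c1 + 1)) * B"
  have G: "0 \<le> G" using Bpos c1_nonneg by (simp add: G_def)
  define C where "C = 2 * G * ((1 + 1 / (c1 + 1)) * ?m)"
  have C: "0 \<le> C" using G m c1_nonneg by (simp add: C_def)
  have "holder_bound A \<theta> k (C * r ^ i * b) ((T ^^ (n * i)) w)"
    if w: "holder_bound A \<theta> k b w" "supported j w" "I w = 0" "0 \<le> b" for w b i
  proof -
    let ?t = "b + b / (c1 + 1)"
    note sn = sector_normal_class[OF j w B(2)]
    obtain v v' where v: "v \<in> normal_class j B" "v' \<in> normal_class j B"
      "I v = r ^ i * (?t * ?m)" "I v' = r ^ i * (?t * ?m)"
      "\<And>\<omega>. \<omega> \<in> X \<Longrightarrow> (T ^^ (n * i)) (\<lambda>\<omega>. (w \<omega> + ?t * indicator (sector j) \<omega>) - ?t * indicator (sector j) \<omega>) \<omega> = v \<omega> - v' \<omega>"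
      using coupling[OF step sn(1,2), of i] sn(3,4) by auto
    have hv: "holder_bound A \<theta> k (G * (r ^ i * (?t * ?m))) z" if "z \<in> normal_class j B" "I z = r ^ i * (?t * ?m)" for z
      using cone_holder[OF normal_classD(1,2)[OF that(1)]] that(2) by (simp add: G_def mult.assoc)
    have "holder_bound A \<theta> k (G * (r ^ i * (?t * ?m)) + G * (r ^ i * (?t * ?m))) (\<lambda>\<omega>. v \<omega> - v' \<omega>)"
      by (rule holder_bound_diff[OF hv[OF v(1,3)] hv[OF v(2,4)]])
    moreover have "G * (r ^ i * (?t * ?m)) + G * (r ^ i * (?t * ?m)) = C * r ^ i * b"
      by (simp add: C_def algebra_simps)
    ultimately show ?thesis using holder_bound_cong[of A "(T ^^ (n * i)) w" "\<lambda>\<omega>. v \<omega> - v' \<omega>" \<theta> k] v(5) by simp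
  qed
  then show ?thesis using nr C by (intro exI[of _ n] conjI exI[of _ C] exI[of _ r]) simp_all
qed

text \<open>Passage from multiples of \<open>n\<close> to all times: fewer than \<open>n\<close>
  further steps cost at most \<open>G ^ n\<close>.\<close>

lemma sector_decay:
  assumes j: "j < p"
  shows "\<exists>C\<ge>0. \<exists>\<rho>>0. \<rho> < 1 \<and> (\<forall>w b i. holder_bound A \<theta> k b w \<longrightarrow> supported j w \<longrightarrow> I w = 0 \<longrightarrow> 0 \<le> b \<longrightarrow>
           holder_bound A \<theta> k (C * \<rho> ^ i * b) ((T ^^ i) w))"
proof -
  obtain n C r where n: "0 < n" and C: "0 \<le> C" and r: "0 < r" "r < 1"
    and dec: "\<And>w b i. holder_bound A \<theta> k b w \<Longrightarrow> supported j w \<Longrightarrow> I w = 0 \<Longrightarrow> 0 \<le> b \<Longrightarrow>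
           holder_bound A \<theta> k (C * r ^ i * b) ((T ^^ (n * i)) w)"
    using sector_decay_steps[OF j] by blast
  define \<rho> where "\<rho> = root n r"
  have \<rho>: "0 < \<rho>" "\<rho> < 1" "\<rho> ^ n = r"
    using n r by (simp_all add: \<rho>_def real_root_gt_zero real_root_pow_pos2)
  define G where "G = E * (1 + \<Phi>)"
  have G: "1 \<le> G" unfolding G_def using E_ge_1 Phi_nonneg mult_mono[of 1 E 1 "1 + \<Phi>"] by simp
  have "holder_bound A \<theta> k (G ^ n * C / r * \<rho> ^ i * b) ((T ^^ i) w)"
    if w: "holder_bound A \<theta> k b w" "supported j w" "I w = 0" "0 \<le> b" for w b i
  proof -
    let ?q = "i div n" and ?s = "i mod n"
    have i: "i = ?s + n * ?q" by simp
    have pos: "0 \<le> C * r ^ ?q * b" using C r w(4) by simp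
    have "holder_bound A \<theta> k (G ^ ?s * (C * r ^ ?q * b)) ((T ^^ ?s) ((T ^^ (n * ?q)) w))"
      unfolding G_def by (rule holder_bound_T_pow[OF dec[OF w] pos])
    moreover have "(T ^^ ?s) ((T ^^ (n * ?q)) w) = (T ^^ i) w"
      using i by (metis funpow_add o_apply)
    moreover have "G ^ ?s * (C * r ^ ?q * b) \<le> G ^ n * C / r * \<rho> ^ i * b"
    proof -
      have "?s < n" using n by simp
      have "\<rho> ^ i = \<rho> ^ ?s * r ^ ?q" by (subst i) (simp only: power_add power_mult \<rho>(3))
      \<comment> \<open>The factor \<open>1 / r\<close> in the constant comes from here.\<close>
      moreover have "r \<le> \<rho> ^ ?s"
        unfolding \<rho>(3)[symmetric] using \<rho> \<open>?s < n\<close> by (intro power_decreasing) simp_all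
      ultimately have "r * r ^ ?q \<le> \<rho> ^ i" using r by (simp add: mult_right_mono)
      then have 1: "r ^ ?q \<le> \<rho> ^ i / r" using r by (simp add: pos_le_divide_eq mult.commute)
      have "G ^ ?s \<le> G ^ n" using G \<open>?s < n\<close> by (intro power_increasing) simp_all
      then have "G ^ ?s * (C * r ^ ?q * b) \<le> G ^ n * (C * (\<rho> ^ i / r) * b)"
        using 1 C w(4) G r \<rho>(1) by (intro mult_mono mult_nonneg_nonneg) simp_all
      then show ?thesis by simp
    qed
    ultimately show ?thesis using holder_bound_mono[OF _ _ theta(1)] by simp
  qed
  then show ?thesis using \<rho> C G r
    by (intro exI[of _ "G ^ n * C / r"] conjI exI[of _ \<rho>]) simp_all
qed

text \<open>\<open>w\<close> need not vanish off the sectors. However, \<open>T\<close> evaluates it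
  only at points with first letter in \<open>S0\<close>, where the sector indicators sum to 1, so
  from the first step on \<open>w\<close> may be replaced by the sum of its sector parts. Time 0 is
  covered by the 1 added to the constant.\<close>

theorem decay:
  "\<exists>C\<ge>0. \<exists>\<rho>>0. \<rho> < 1 \<and> (\<forall>w b i. holder_bound A \<theta> k b w \<longrightarrow> 0 \<le> b \<longrightarrow>
      (\<forall>j<p. I (\<lambda>\<omega>. w \<omega> * indicator (sector j) \<omega>) = 0) \<longrightarrow>
      holder_bound A \<theta> k (C * \<rho> ^ i * b) ((T ^^ i) w))"
proof -
  have "\<forall>j\<in>{..<p}. \<exists>C \<rho>. 0 \<le> C \<and> 0 < \<rho> \<and> \<rho> < 1 \<and>
     (\<forall>w b i. holder_bound A \<theta> k b w \<longrightarrow> supported j w \<longrightarrow> I w = 0 \<longrightarrow> 0 \<le> b \<longrightarrow>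
           holder_bound A \<theta> k (C * \<rho> ^ i * b) ((T ^^ i) w))"
    using sector_decay by (meson lessThan_iff)
  then obtain C \<rho> where C: "\<And>j. j < p \<Longrightarrow> 0 \<le> C j" and \<rho>: "\<And>j. j < p \<Longrightarrow> 0 < \<rho> j \<and> \<rho> j < (1::real)"
    and dec: "\<And>j w b i. j < p \<Longrightarrow> holder_bound A \<theta> k b w \<Longrightarrow> supported j w \<Longrightarrow> I w = 0 \<Longrightarrow> 0 \<le> b \<Longrightarrow>
           holder_bound A \<theta> k (C j * \<rho> j ^ i * b) ((T ^^ i) w)"
    unfolding bchoice_iff by (metis lessThan_iff)
  define R where "R = Max (\<rho> ` {..<p})"
  have ne: "\<rho> ` {..<p} \<noteq> {}" using p_pos by auto
  have "R \<in> \<rho> ` {..<p}" unfolding R_def by (rule Max_in) (use ne in simp_all)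
  then have R: "0 < R" "R < 1" using \<rho> by auto
  have \<rho>R: "\<rho> j \<le> R" if "j < p" for j unfolding R_def by (rule Max_ge) (use that in simp_all)
  let ?C = "\<Sum>j<p. C j"
  have C0: "0 \<le> ?C" by (rule sum_nonneg) (simp add: C)
  have "holder_bound A \<theta> k ((?C + 1) * R ^ i * b) ((T ^^ i) w)"
    if w: "holder_bound A \<theta> k b w" "0 \<le> b" "\<And>j. j < p \<Longrightarrow> I (\<lambda>\<omega>. w \<omega> * indicator (sector j) \<omega>) = 0" for w b i
  proof (cases i)
    case 0
    have "1 * b \<le> (?C + 1) * b" using C0 w(2) by (intro mult_right_mono) simp_all
    then show ?thesis using 0 holder_bound_mono[OF w(1) _ theta(1)] by simp
  next
    case (Suc m)
    let ?w = "\<lambda>j \<omega>. w \<omega> * indicator (sector j) \<omega>"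
    have hw: "holder_bound A \<theta> k b (?w j)" for j
      by (rule holder_bound_restrict[OF w(1,2) theta(1) sector_local])
    have bw: "\<exists>b. bounded_by b (?w j)" for j using holder_bound_imp_bounded[OF hw] by blast
    have Tw: "T w = T (\<lambda>\<omega>. \<Sum>j<p. ?w j \<omega>)"
    proof
      fix \<omega>
      have "w (prepend a \<omega>) = (\<Sum>j<p. ?w j (prepend a \<omega>))" if "M a (\<omega> 0) = 1" for a
      proof -
        have "(\<Sum>j<p. indicator (sector j) (prepend a \<omega>) :: real) = 1"
          by (rule sum_sectors) (use M_S0[OF that] in simp)
        then show ?thesis by (simp only: sum_distrib_left[symmetric] mult_1_right)
      qed
      then have "(\<Sum>\<^sub>\<infinity>a\<in>{a. M a (\<omega> 0) = 1}. exp (\<phi> (prepend a \<omega>)) * w (prepend a \<omega>)) =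
        (\<Sum>\<^sub>\<infinity>a\<in>{a. M a (\<omega> 0) = 1}. exp (\<phi> (prepend a \<omega>)) * (\<Sum>j<p. ?w j (prepend a \<omega>)))"
        by (intro infsum_cong) simp_all
      then show "T w \<omega> = T (\<lambda>\<omega>. \<Sum>j<p. ?w j \<omega>) \<omega>"
        unfolding real_transfer_def by simp
    qed
    have eq: "(T ^^ i) w \<omega> = (\<Sum>j<p. (T ^^ i) (?w j) \<omega>)" if "\<omega> \<in> X" for \<omega>
    proof -
      have "(T ^^ i) w = (T ^^ i) (\<lambda>\<omega>. \<Sum>j<p. ?w j \<omega>)" by (simp only: Suc funpow_Suc_right o_apply Tw)
      then show ?thesis using T_pow_sum[of "{..<p}" ?w \<omega> i] bw that by simp
    qed
    have "holder_bound A \<theta> k (\<Sum>j<p. C j * \<rho> j ^ i * b) (\<lambda>\<omega>. \<Sum>j<p. (T ^^ i) (?w j) \<omega>)"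
      by (rule holder_bound_sum) (auto intro!: dec hw w simp: supported_def)
    moreover have "(\<Sum>j<p. C j * \<rho> j ^ i * b) \<le> (\<Sum>j<p. C j * R ^ i * b)"
      using C \<rho> \<rho>R w(2) by (intro sum_mono mult_right_mono mult_left_mono power_mono) (simp_all add: less_imp_le)
    moreover have "(\<Sum>j<p. C j * R ^ i * b) \<le> (?C + 1) * R ^ i * b"
      using R w(2) by (simp add: distrib_right flip: sum_distrib_right)
    ultimately have "holder_bound A \<theta> k ((?C + 1) * R ^ i * b) (\<lambda>\<omega>. \<Sum>j<p. (T ^^ i) (?w j) \<omega>)"
      using holder_bound_mono[OF _ _ theta(1)] by (meson order_trans)
    then show ?thesis using eq holder_bound_cong[of A "(T ^^ i) w" "\<lambda>\<omega>. \<Sum>j<p. (T ^^ i) (?w j) \<omega>"] by simp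
  qed
  moreover have "0 \<le> ?C + 1" using C0 by simp
  ultimately show ?thesis using R by (intro exI[of _ "?C + 1"] conjI exI[of _ R]) simp_all
qed

end

section \<open>The H\<ouml>lder norm\<close>

lemma holder_seminorm_le:
  assumes "0 < \<theta>" "\<theta> < 1" "0 \<le> b" "holder_bound A \<theta> k b f"
  shows "holder_seminorm A \<theta> k f \<le> ennreal b"
  unfolding holder_seminorm_def
proof (rule SUP_least)
  fix n assume n: "n \<in> {k..}"
  have "variation A n f \<le> ennreal (b * \<theta> ^ n)"
    unfolding variation_def
  proof (rule SUP_least, clarsimp)
    fix \<omega> \<upsilon> assume w: "\<omega> \<in> full_shift A" "\<upsilon> \<in> full_shift A" "\<forall>i<n. \<omega> i = \<upsilon> i"
    have "agree k \<omega> \<upsilon>" using w(3) n by (simp add: agree_def)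
    then have "norm (f \<omega> - f \<upsilon>) \<le> b * dist_theta \<theta> \<omega> \<upsilon>" by (rule holder_boundD(2)[OF assms(4) w(1,2)])
    also have "\<dots> \<le> b * \<theta> ^ n"
      using dist_theta_le_power[OF assms(1,2), of n \<omega> \<upsilon>] w(3) assms(3) by (simp add: agree_def mult_left_mono)
    finally show "ennreal (norm (f \<omega> - f \<upsilon>)) \<le> ennreal (b * \<theta> ^ n)" by (rule ennreal_leI)
  qed
  then have "variation A n f / ennreal (\<theta> ^ n) \<le> ennreal (b * \<theta> ^ n) / ennreal (\<theta> ^ n)"
    by (rule divide_right_mono_ennreal)
  also have "\<dots> = ennreal b" using assms by (simp add: divide_ennreal)
  finally show "variation A n f / ennreal (\<theta> ^ n) \<le> ennreal b" .
qed

text \<open>For distinct points the first index \<open>n\<close> at which they differ satisfies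
  \<open>n \<ge> k\<close> and \<open>d = \<theta> ^ n\<close>, so the variation quotient at this
  very \<open>n\<close> gives the claim.\<close>

lemma holder_seminorm_bound:
  assumes "0 < \<theta>" "\<theta> < 1" "holder_seminorm A \<theta> k f < \<infinity>"
    and w: "\<omega> \<in> full_shift A" "\<upsilon> \<in> full_shift A" "agree k \<omega> \<upsilon>"
  shows "norm (f \<omega> - f \<upsilon>) \<le> enn2real (holder_seminorm A \<theta> k f) * dist_theta \<theta> \<omega> \<upsilon>"
proof (cases "\<omega> = \<upsilon>")
  case False
  then obtain n where n: "agree n \<omega> \<upsilon>" "\<omega> n \<noteq> \<upsilon> n" "dist_theta \<theta> \<omega> \<upsilon> = \<theta> ^ n"
    by (rule dist_theta_first_difference)
  have "k \<le> n" using n(2) w(3) by (meson agree_def not_le)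
  have "ennreal (norm (f \<omega> - f \<upsilon>)) \<le> variation A n f"
    unfolding variation_def using w(1,2) n(1) by (intro SUP_upper2[of "(\<omega>, \<upsilon>)"]) (simp_all add: agree_def)
  then have "ennreal (norm (f \<omega> - f \<upsilon>)) / ennreal (\<theta> ^ n) \<le> variation A n f / ennreal (\<theta> ^ n)"
    by (rule divide_right_mono_ennreal)
  also have "\<dots> \<le> holder_seminorm A \<theta> k f"
    unfolding holder_seminorm_def using \<open>k \<le> n\<close> by (intro SUP_upper) simp
  finally have "ennreal (norm (f \<omega> - f \<upsilon>) / \<theta> ^ n) \<le> holder_seminorm A \<theta> k f"
    using assms(1) by (simp add: divide_ennreal)
  then have "norm (f \<omega> - f \<upsilon>) / \<theta> ^ n \<le> enn2real (holder_seminorm A \<theta> k f)"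
    using assms(1,3) enn2real_mono[of "ennreal (norm (f \<omega> - f \<upsilon>) / \<theta> ^ n)"] by simp
  then show ?thesis using assms(1) n(3) by (simp add: pos_divide_le_eq)
qed simp

section \<open>The metric topology and membership in the Hoelder space\<close>

lemma openin_shift_topology:
  assumes "0 < \<theta>" "\<theta> < 1"
  shows "openin (shift_topology A \<theta>) U \<longleftrightarrow> U \<subseteq> full_shift A \<and>
    (\<forall>\<omega>\<in>U. \<exists>r>0. \<forall>\<upsilon>\<in>full_shift A. dist_theta \<theta> \<omega> \<upsilon> < r \<longrightarrow> \<upsilon> \<in> U)"
proof -
  interpret Metric_space "full_shift A" "dist_theta \<theta>" by (rule Metric_space_dist_theta[OF assms])
  have ball: "mball \<omega> r \<subseteq> U \<longleftrightarrow> (\<forall>\<upsilon>\<in>full_shift A. dist_theta \<theta> \<omega> \<upsilon> < r \<longrightarrow> \<upsilon> \<in> U)"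
    if "\<omega> \<in> full_shift A" for \<omega> r
    using that unfolding subset_eq Ball_def in_mball by (simp add: imp_conjL)
  have "(\<forall>\<omega>. \<omega> \<in> U \<longrightarrow> (\<exists>r>0. mball \<omega> r \<subseteq> U)) \<longleftrightarrow>
    (\<forall>\<omega>\<in>U. \<exists>r>0. \<forall>\<upsilon>\<in>full_shift A. dist_theta \<theta> \<omega> \<upsilon> < r \<longrightarrow> \<upsilon> \<in> U)" if "U \<subseteq> full_shift A"
    unfolding Ball_def[of U] using subsetD[OF that] by (simp add: ball cong: imp_cong)
  then show ?thesis unfolding shift_topology_def openin_mtopology by (rule conj_cong[OF refl])
qed

lemma topspace_shift_topology:
  assumes "0 < \<theta>" "\<theta> < 1"
  shows "topspace (shift_topology A \<theta>) = full_shift A"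
proof -
  interpret Metric_space "full_shift A" "dist_theta \<theta>" by (rule Metric_space_dist_theta[OF assms])
  show ?thesis by (simp add: shift_topology_def)
qed

lemma agree_if_close:
  assumes "0 < \<theta>" "\<theta> < 1" "dist_theta \<theta> \<omega> \<upsilon> < \<theta> ^ k"
  shows "agree k \<omega> \<upsilon>"
proof (cases "\<omega> = \<upsilon>")
  case False
  then obtain n where n: "agree n \<omega> \<upsilon>" "dist_theta \<theta> \<omega> \<upsilon> = \<theta> ^ n"
    by (rule dist_theta_first_difference)
  have "k \<le> n"
  proof (rule ccontr)
    assume "\<not> k \<le> n"
    then have "\<theta> ^ k \<le> \<theta> ^ n" using assms by (intro power_decreasing) simp_all
    then show False using n(2) assms(3) by simp
  qed
  then show ?thesis using n(1) by (simp add: agree_def)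
qed simp

lemma holder_bound_continuous:
  fixes f :: "'s point \<Rightarrow> 'b::real_normed_vector"
  assumes "0 < \<theta>" "\<theta> < 1" "holder_bound A \<theta> k b f"
  shows "continuous_map (shift_topology A \<theta>) euclidean f"
  unfolding continuous_map_def topspace_shift_topology[OF assms(1,2)]
proof (intro conjI allI impI)
  fix U :: "'b set" assume "openin euclidean U"
  then have U: "open U" by simp
  show "openin (shift_topology A \<theta>) {x \<in> full_shift A. f x \<in> U}"
    unfolding openin_shift_topology[OF assms(1,2)]
  proof (intro conjI ballI)
    fix \<omega> assume w: "\<omega> \<in> {x \<in> full_shift A. f x \<in> U}"
    then obtain \<epsilon> where \<epsilon>: "0 < \<epsilon>" "\<And>y. dist y (f \<omega>) < \<epsilon> \<Longrightarrow> y \<in> U"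
      using U unfolding open_dist by blast
    \<comment> \<open>\<open>\<theta> ^ k\<close> forces both points into one
      \<open>k\<close>-cylinder, where the Lipschitz bound applies; the added 1 avoids division by
      zero.\<close>
    define r where "r = min (\<theta> ^ k) (\<epsilon> / (\<bar>b\<bar> + 1))"
    have r: "0 < r" using assms(1) \<epsilon>(1) by (simp add: r_def)
    have "\<upsilon> \<in> {x \<in> full_shift A. f x \<in> U}" if v: "\<upsilon> \<in> full_shift A" "dist_theta \<theta> \<omega> \<upsilon> < r" for \<upsilon>
    proof -
      have ag: "agree k \<omega> \<upsilon>" using v(2) by (intro agree_if_close[OF assms(1,2)]) (simp add: r_def)
      have "norm (f \<omega> - f \<upsilon>) \<le> b * dist_theta \<theta> \<omega> \<upsilon>" using holder_boundD(2)[OF assms(3) _ v(1) ag] w by simp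
      also have "\<dots> \<le> (\<bar>b\<bar> + 1) * dist_theta \<theta> \<omega> \<upsilon>"
        by (intro mult_right_mono dist_theta_nonneg[OF assms(1)]) simp
      also have "\<dots> < (\<bar>b\<bar> + 1) * (\<epsilon> / (\<bar>b\<bar> + 1))"
        using v(2) by (intro mult_strict_left_mono) (simp_all add: r_def)
      also have "\<dots> = \<epsilon>" by (simp add: add_nonneg_eq_0_iff)
      finally show ?thesis using v(1) \<epsilon>(2)[of "f \<upsilon>"] by (simp add: dist_norm norm_minus_commute)
    qed
    then show "\<exists>r>0. \<forall>\<upsilon>\<in>full_shift A. dist_theta \<theta> \<omega> \<upsilon> < r \<longrightarrow> \<upsilon> \<in> {x \<in> full_shift A. f x \<in> U}"
      using r by blast
  qed simp
qed simp

lemma sup_norm_le: "(\<And>\<omega>. \<omega> \<in> full_shift A \<Longrightarrow> norm (f \<omega>) \<le> b) \<Longrightarrow> sup_norm A f \<le> ennreal b"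
  unfolding sup_norm_def by (intro SUP_least ennreal_leI)

lemma sup_norm_bound:
  assumes "sup_norm A f < \<infinity>" "\<omega> \<in> full_shift A"
  shows "norm (f \<omega>) \<le> enn2real (sup_norm A f)"
proof -
  have "ennreal (norm (f \<omega>)) \<le> sup_norm A f" unfolding sup_norm_def using assms(2) by (rule SUP_upper)
  then show ?thesis using enn2real_mono[of "ennreal (norm (f \<omega>))" "sup_norm A f"] assms(1) by simp
qed

text \<open>Continuity and finiteness of both suprema follow from one bound, so membership in the
  space reduces to \<open>holder_bound\<close> and vanishing off \<open>X\<close>.\<close>

lemma holder_fun_iff:
  assumes "0 < \<theta>" "\<theta> < 1"
  shows "f \<in> holder_fun A \<theta> k \<longleftrightarrow> (\<forall>\<omega>. \<omega> \<notin> full_shift A \<longrightarrow> f \<omega> = 0) \<and> (\<exists>b\<ge>0. holder_bound A \<theta> k b f)"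
    (is "_ \<longleftrightarrow> ?Z \<and> ?B")
proof
  assume f: "f \<in> holder_fun A \<theta> k"
  then have fin: "sup_norm A f < \<infinity>" "holder_seminorm A \<theta> k f < \<infinity>" and Z: ?Z
    by (auto simp: holder_fun_def bounded_cont_fun_def cont_fun_def)
  let ?b = "max (enn2real (sup_norm A f)) (enn2real (holder_seminorm A \<theta> k f))"
  have "holder_bound A \<theta> k ?b f"
  proof (rule holder_boundI)
    fix \<omega> \<upsilon> assume w: "\<omega> \<in> full_shift A" "\<upsilon> \<in> full_shift A" "agree k \<omega> \<upsilon>"
    have "norm (f \<omega> - f \<upsilon>) \<le> enn2real (holder_seminorm A \<theta> k f) * dist_theta \<theta> \<omega> \<upsilon>"
      by (rule holder_seminorm_bound[OF assms fin(2) w])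
    also have "\<dots> \<le> ?b * dist_theta \<theta> \<omega> \<upsilon>"
      by (intro mult_right_mono dist_theta_nonneg[OF assms(1)]) simp
    finally show "norm (f \<omega> - f \<upsilon>) \<le> ?b * dist_theta \<theta> \<omega> \<upsilon>" .
  qed (use sup_norm_bound[OF fin(1)] in \<open>simp add: le_max_iff_disj\<close>)
  moreover have "0 \<le> ?b" by (simp add: le_max_iff_disj)
  ultimately show "?Z \<and> ?B" using Z by blast
next
  assume "?Z \<and> ?B"
  then obtain b where Z: ?Z and b: "0 \<le> b" "holder_bound A \<theta> k b f" by blast
  have "sup_norm A f < \<infinity>"
    using sup_norm_le[of A f b] holder_boundD(1)[OF b(2)] ennreal_less_top[of b] by (simp add: le_less_trans)
  moreover have "holder_seminorm A \<theta> k f < \<infinity>"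
    using holder_seminorm_le[OF assms b] ennreal_less_top[of b] by (simp add: le_less_trans)
  ultimately show "f \<in> holder_fun A \<theta> k"
    using Z holder_bound_continuous[OF assms b(2)] by (simp add: holder_fun_def bounded_cont_fun_def cont_fun_def)
qed

lemma holder_norm_le:
  assumes "0 < \<theta>" "\<theta> < 1" "0 \<le> b" "holder_bound A \<theta> k b f"
  shows "holder_norm A \<theta> k f \<le> ennreal (2 * b)"
proof -
  have "holder_norm A \<theta> k f \<le> ennreal b + ennreal b"
    unfolding holder_norm_def
    using sup_norm_le[of A f b] holder_boundD(1)[OF assms(4)] holder_seminorm_le[OF assms] by (simp add: add_mono)
  also have "\<dots> = ennreal (2 * b)" using assms(3) by (simp flip: ennreal_plus)
  finally show ?thesis .
qed

text \<open>The norm itself serves as the bound, without loss; the factor 2 arises only in the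
  opposite direction, in \<open>holder_norm_le\<close>.\<close>

lemma holder_norm_bound:
  assumes "0 < \<theta>" "\<theta> < 1" "f \<in> holder_fun A \<theta> k"
  obtains x where "0 \<le> x" "holder_norm A \<theta> k f = ennreal x" "holder_bound A \<theta> k x f"
proof
  let ?x = "enn2real (holder_norm A \<theta> k f)"
  have fin: "sup_norm A f < \<infinity>" "holder_seminorm A \<theta> k f < \<infinity>"
    using assms(3) by (auto simp: holder_fun_def bounded_cont_fun_def)
  then have "holder_norm A \<theta> k f < \<infinity>" by (simp add: holder_norm_def)
  then show "holder_norm A \<theta> k f = ennreal ?x" by simp
  have x: "?x = enn2real (sup_norm A f) + enn2real (holder_seminorm A \<theta> k f)"
    using fin by (simp add: holder_norm_def enn2real_plus)
  show "holder_bound A \<theta> k ?x f"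
  proof (rule holder_boundI)
    fix \<omega> \<upsilon> assume w: "\<omega> \<in> full_shift A" "\<upsilon> \<in> full_shift A" "agree k \<omega> \<upsilon>"
    have "norm (f \<omega> - f \<upsilon>) \<le> enn2real (holder_seminorm A \<theta> k f) * dist_theta \<theta> \<omega> \<upsilon>"
      by (rule holder_seminorm_bound[OF assms(1,2) fin(2) w])
    also have "\<dots> \<le> ?x * dist_theta \<theta> \<omega> \<upsilon>"
      unfolding x by (intro mult_right_mono dist_theta_nonneg[OF assms(1)]) simp
    finally show "norm (f \<omega> - f \<upsilon>) \<le> ?x * dist_theta \<theta> \<omega> \<upsilon>" .
  qed (use sup_norm_bound[OF fin(1)] in \<open>simp add: x add_increasing2\<close>)
qed simp

section \<open>Neumann series and spectral decomposition\<close>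

locale holder_space =
  fixes A :: "'s \<Rightarrow> 's \<Rightarrow> nat" and \<theta> :: real and k :: nat
  assumes theta: "0 < \<theta>" "\<theta> < 1"
begin

abbreviation "V \<equiv> holder_fun A \<theta> k"
abbreviation "N \<equiv> holder_norm A \<theta> k"
abbreviation "hb b (f :: 's point \<Rightarrow> complex) \<equiv> holder_bound A \<theta> k b f"

lemma V_I: "(\<And>\<omega>. \<omega> \<notin> full_shift A \<Longrightarrow> f \<omega> = 0) \<Longrightarrow> 0 \<le> b \<Longrightarrow> hb b f \<Longrightarrow> f \<in> V"
  using holder_fun_iff[OF theta] by blast

lemma V_E: assumes "f \<in> V" obtains b where "0 \<le> b" "hb b f"
  using holder_fun_iff[OF theta] assms by blast

lemma V_zero: "f \<in> V \<Longrightarrow> \<omega> \<notin> full_shift A \<Longrightarrow> f \<omega> = 0"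
  using holder_fun_iff[OF theta] by blast

lemma V_linear:
  assumes "f \<in> V" "u \<in> V"
  shows "(\<lambda>\<omega>. a * f \<omega> + c * u \<omega>) \<in> V"
proof -
  obtain b where b1: "0 \<le> b" "hb b f" using V_E[OF assms(1)] .
  obtain b' where b2: "0 \<le> b'" "hb b' u" using V_E[OF assms(2)] .
  note b = b1 b2
  from holder_bound_add[OF holder_bound_scale[OF b(2)] holder_bound_scale[OF b(4)], of a c]
  show ?thesis by (rule V_I[rotated 2]) (use b in \<open>simp_all add: V_zero[OF assms(1)] V_zero[OF assms(2)]\<close>)
qed

lemma V_scale: "f \<in> V \<Longrightarrow> (\<lambda>\<omega>. a * f \<omega>) \<in> V"
  using V_linear[of f f a 0] by simp

lemma V_diff: "f \<in> V \<Longrightarrow> u \<in> V \<Longrightarrow> (\<lambda>\<omega>. f \<omega> - u \<omega>) \<in> V"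
  using V_linear[of f u 1 "-1"] by simp

lemma V_0: "(\<lambda>\<omega>. 0) \<in> V"
  by (rule V_I[of _ 0]) (use theta in \<open>simp_all add: holder_bound_def\<close>)

lemma V_sum: "finite J \<Longrightarrow> (\<And>i. i \<in> J \<Longrightarrow> f i \<in> V) \<Longrightarrow> (\<lambda>\<omega>. \<Sum>i\<in>J. f i \<omega>) \<in> V"
proof (induction J rule: finite_induct)
  case (insert i J)
  then show ?case using V_linear[of "f i" "\<lambda>\<omega>. \<Sum>i\<in>J. f i \<omega>" 1 1] by simp
qed (simp add: V_0)

definition linear_V :: "(('s point \<Rightarrow> complex) \<Rightarrow> 's point \<Rightarrow> complex) \<Rightarrow> bool" where
  "linear_V T \<longleftrightarrow> (\<forall>f\<in>V. T f \<in> V) \<and>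
     (\<forall>f\<in>V. \<forall>u\<in>V. \<forall>a c. T (\<lambda>\<omega>. a * f \<omega> + c * u \<omega>) = (\<lambda>\<omega>. a * T f \<omega> + c * T u \<omega>))"

lemma linear_VD:
  assumes "linear_V T"
  shows "\<And>f. f \<in> V \<Longrightarrow> T f \<in> V"
    and "\<And>f u a c. f \<in> V \<Longrightarrow> u \<in> V \<Longrightarrow> T (\<lambda>\<omega>. a * f \<omega> + c * u \<omega>) = (\<lambda>\<omega>. a * T f \<omega> + c * T u \<omega>)"
  using assms by (auto simp: linear_V_def)

lemma linear_V_scale: "linear_V T \<Longrightarrow> f \<in> V \<Longrightarrow> T (\<lambda>\<omega>. a * f \<omega>) = (\<lambda>\<omega>. a * T f \<omega>)"
  using linear_VD(2)[of T f f a 0] by simp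

lemma linear_V_diff: "linear_V T \<Longrightarrow> f \<in> V \<Longrightarrow> u \<in> V \<Longrightarrow> T (\<lambda>\<omega>. f \<omega> - u \<omega>) = (\<lambda>\<omega>. T f \<omega> - T u \<omega>)"
  using linear_VD(2)[of T f u 1 "-1"] by simp

lemma linear_V_sum:
  assumes "linear_V T" "finite J" "\<And>i. i \<in> J \<Longrightarrow> f i \<in> V"
  shows "T (\<lambda>\<omega>. \<Sum>i\<in>J. f i \<omega>) = (\<lambda>\<omega>. \<Sum>i\<in>J. T (f i) \<omega>)"
  using assms(2,3)
proof (induction J rule: finite_induct)
  case empty
  show ?case using linear_V_scale[OF assms(1) V_0, of 0] by simp
next
  case (insert i J)
  then show ?case
    using linear_VD(2)[OF assms(1), of "f i" "\<lambda>\<omega>. \<Sum>i\<in>J. f i \<omega>" 1 1] V_sum[of J f] by simp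
qed

lemma linear_V_pow: "linear_V T \<Longrightarrow> f \<in> V \<Longrightarrow> (T ^^ n) f \<in> V"
  by (induction n) (simp_all add: linear_VD(1))

lemma bounded_operatorI:
  assumes "linear_V T" "0 \<le> C" "\<And>f b. f \<in> V \<Longrightarrow> 0 \<le> b \<Longrightarrow> hb b f \<Longrightarrow> hb (C * b) (T f)"
  shows "bounded_operator V N T"
proof -
  have "N (T f) \<le> ennreal (2 * C) * N f" if f: "f \<in> V" for f
  proof -
    obtain x where x: "0 \<le> x" "N f = ennreal x" "hb x f" by (rule holder_norm_bound[OF theta f])
    have "N (T f) \<le> ennreal (2 * (C * x))"
      by (rule holder_norm_le[OF theta _ assms(3)[OF f x(1,3)]]) (use assms(2) x(1) in simp)
    also have "\<dots> = ennreal (2 * C) * N f"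
      unfolding x(2) using assms(2) x(1) by (simp add: mult.assoc flip: ennreal_mult)
    finally show ?thesis .
  qed
  then show ?thesis using assms(1) unfolding bounded_operator_def linear_V_def by blast
qed

text \<open>A Weierstrass test for Hoelder bounds: both estimates sum term by term. Completeness of
  the space thus enters only through pointwise sums.\<close>

lemma hb_suminf:
  assumes "\<And>m. hb (a m) (F m)" "summable a"
  shows "\<And>\<omega>. \<omega> \<in> full_shift A \<Longrightarrow> summable (\<lambda>m. F m \<omega>)"
    and "hb (\<Sum>m. a m) (\<lambda>\<omega>. \<Sum>m. F m \<omega>)"
proof -
  have sn: "summable (\<lambda>m. norm (F m \<omega>))" if "\<omega> \<in> full_shift A" for \<omega>
    by (rule summable_comparison_test'[OF assms(2), of 0]) (use holder_boundD(1)[OF assms(1) that] in simp)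
  show s: "summable (\<lambda>m. F m \<omega>)" if "\<omega> \<in> full_shift A" for \<omega>
    using sn[OF that] by (rule summable_norm_cancel)
  show "hb (\<Sum>m. a m) (\<lambda>\<omega>. \<Sum>m. F m \<omega>)"
  proof (rule holder_boundI)
    fix \<omega> assume w: "\<omega> \<in> full_shift A"
    have "norm (\<Sum>m. F m \<omega>) \<le> (\<Sum>m. norm (F m \<omega>))" by (rule summable_norm[OF sn[OF w]])
    also have "\<dots> \<le> (\<Sum>m. a m)" by (intro suminf_le sn[OF w] assms(2) holder_boundD(1)[OF assms(1) w])
    finally show "norm (\<Sum>m. F m \<omega>) \<le> (\<Sum>m. a m)" .
  next
    fix \<omega> \<upsilon> assume w: "\<omega> \<in> full_shift A" "\<upsilon> \<in> full_shift A" "agree k \<omega> \<upsilon>"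
    let ?d = "dist_theta \<theta> \<omega> \<upsilon>"
    have sd: "summable (\<lambda>m. a m * ?d)" using assms(2) by (rule summable_mult2)
    have le: "norm (F m \<omega> - F m \<upsilon>) \<le> a m * ?d" for m by (rule holder_boundD(2)[OF assms(1) w])
    have sn': "summable (\<lambda>m. norm (F m \<omega> - F m \<upsilon>))"
      by (rule summable_comparison_test'[OF sd, of 0]) (use le in simp)
    have "norm (\<Sum>m. F m \<omega> - F m \<upsilon>) \<le> (\<Sum>m. norm (F m \<omega> - F m \<upsilon>))" by (rule summable_norm[OF sn'])
    also have "\<dots> \<le> (\<Sum>m. a m * ?d)" by (intro suminf_le sn' sd le)
    also have "\<dots> = (\<Sum>m. a m) * ?d" by (rule suminf_mult2[OF assms(2), symmetric])
    finally show "norm ((\<Sum>m. F m \<omega>) - (\<Sum>m. F m \<upsilon>)) \<le> (\<Sum>m. a m) * ?d"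
      using suminf_diff[OF s[OF w(1)] s[OF w(2)]] by simp
  qed
qed

text \<open>The inverse of \<open>R - z\<close> is minus the sum of the terms
  \<open>inverse z ^ Suc m * (R ^^ m) f\<close>, which the geometric decay of the powers makes
  converge for \<open>\<rho> < norm z\<close>.\<close>

lemma not_in_spectrum:
  assumes R: "linear_V R" and C: "0 \<le> C" and \<rho>: "0 < \<rho>"
    and dec: "\<And>f b m. f \<in> V \<Longrightarrow> 0 \<le> b \<Longrightarrow> hb b f \<Longrightarrow> hb (C * \<rho> ^ m * b) ((R ^^ m) f)"
    and z: "\<rho> < norm z"
  shows "z \<notin> op_spectrum V N R"
proof -
  define F where "F f m = (\<lambda>\<omega>. inverse z ^ Suc m * (R ^^ m) f \<omega>)" for f m
  define B where "B f = (\<lambda>\<omega>. - (\<Sum>m. F f m \<omega>))" for f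
  define s where "s = \<rho> / norm z"
  have z0: "z \<noteq> 0" using z \<rho> by auto
  have nz: "0 < norm z" using z \<rho> by linarith
  have s: "0 < s" "s < 1" using z \<rho> nz by (simp_all add: s_def)
  \<comment> \<open>A majorant of the terms that is linear in \<open>b\<close>, so that its sum
    gives an operator bound.\<close>
  define a where "a b m = C * b / norm z * s ^ m" for b m
  have sa: "summable (a b)" for b unfolding a_def using s by (intro summable_mult summable_geometric) simp
  have hF: "hb (a b m) (F f m)" if "f \<in> V" "0 \<le> b" "hb b f" for f b m
  proof -
    have "norm (inverse z ^ Suc m) * (C * \<rho> ^ m * b) = a b m"
      by (simp add: a_def s_def norm_power norm_inverse norm_mult divide_inverse power_mult_distrib mult_ac)
    then show ?thesis unfolding F_def using holder_bound_scale[OF dec[OF that, of m], of "inverse z ^ Suc m"] by simp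
  qed
  have sF: "summable (\<lambda>m. F f m \<omega>)" if "f \<in> V" for f \<omega>
  proof (cases "\<omega> \<in> full_shift A")
    case True
    obtain b where "0 \<le> b" "hb b f" using V_E[OF \<open>f \<in> V\<close>] .
    from hb_suminf(1)[OF hF[OF that this] sa True] show ?thesis .
  next
    case False
    then show ?thesis using V_zero[OF linear_V_pow[OF R that] False] by (simp add: F_def)
  qed
  have hB: "hb ((\<Sum>m. a 1 m) * b) (B f)" if "f \<in> V" "0 \<le> b" "hb b f" for f b
  proof -
    have "a b = (\<lambda>m. a 1 m * b)" by (simp add: a_def fun_eq_iff)
    then have "(\<Sum>m. a b m) = (\<Sum>m. a 1 m) * b"
      using suminf_mult2[OF sa[of 1], of b] by simp
    then show ?thesis unfolding B_def
      using holder_bound_scale[OF hb_suminf(2)[OF hF[OF that] sa], of "-1"] by simp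
  qed
  have a1: "0 \<le> (\<Sum>m. a 1 m)" using C s by (intro suminf_nonneg sa) (simp add: a_def)
  have BV: "B f \<in> V" if f: "f \<in> V" for f
  proof -
    obtain b where b: "0 \<le> b" "hb b f" using V_E[OF f] .
    show ?thesis
      by (rule V_I[OF _ _ hB[OF f b]]) (use V_zero[OF linear_V_pow[OF R f]] a1 b in \<open>simp_all add: B_def F_def\<close>)
  qed
  have powlin: "(R ^^ m) (\<lambda>\<omega>. c * f \<omega> + c' * u \<omega>) = (\<lambda>\<omega>. c * (R ^^ m) f \<omega> + c' * (R ^^ m) u \<omega>)"
    if "f \<in> V" "u \<in> V" for f u c c' m
    by (induction m) (simp_all add: linear_VD(2)[OF R] linear_V_pow[OF R] that)
  have Blin: "B (\<lambda>\<omega>. c * f \<omega> + c' * u \<omega>) = (\<lambda>\<omega>. c * B f \<omega> + c' * B u \<omega>)"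
    if "f \<in> V" "u \<in> V" for f u c c'
  proof
    fix \<omega>
    have "F (\<lambda>\<omega>. c * f \<omega> + c' * u \<omega>) m \<omega> = c * F f m \<omega> + c' * F u m \<omega>" for m
      unfolding F_def powlin[OF that] by (simp only: algebra_simps)
    then show "B (\<lambda>\<omega>. c * f \<omega> + c' * u \<omega>) \<omega> = c * B f \<omega> + c' * B u \<omega>"
      unfolding B_def using sF[OF that(1), of \<omega>] sF[OF that(2), of \<omega>]
      by (simp add: suminf_add[symmetric] suminf_mult summable_mult)
  qed
  have linB: "linear_V B" using BV Blin by (simp add: linear_V_def)
  have FSuc: "z * F f (Suc m) \<omega> = inverse z ^ Suc m * (R ^^ Suc m) f \<omega>" for f m \<omega>
    using z0 by (simp add: F_def)
  have F0: "z * F f 0 \<omega> = f \<omega>" for f \<omega>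
    using z0 by (simp add: F_def)
  have sFS: "summable (\<lambda>m. F f (Suc m) \<omega>)" if "f \<in> V" for f \<omega>
    using sF[OF that, of \<omega>] summable_Suc_iff[of "\<lambda>m. F f m \<omega>"] by simp
  have shiftsum: "- (\<Sum>m. z * F f (Suc m) \<omega>) = z * B f \<omega> + f \<omega>" if f: "f \<in> V" for f \<omega>
  proof -
    have "(\<Sum>m. F f (Suc m) \<omega>) = (\<Sum>m. F f m \<omega>) - F f 0 \<omega>"
      using suminf_split_head[OF sF[OF f]] .
    then have "(\<Sum>m. z * F f (Suc m) \<omega>) = z * ((\<Sum>m. F f m \<omega>) - F f 0 \<omega>)"
      using suminf_mult[OF sFS[OF f], of z] by simp
    then show ?thesis by (simp add: B_def right_diff_distrib F0)
  qed
  have BR: "B (R f) \<omega> = z * B f \<omega> + f \<omega>" if f: "f \<in> V" for f \<omega>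
  proof -
    have "F (R f) m \<omega> = z * F f (Suc m) \<omega>" for m
      unfolding FSuc by (simp add: F_def funpow_swap1)
    then show ?thesis using shiftsum[OF f, of \<omega>] by (simp add: B_def)
  qed
  \<comment> \<open>Linearity moves \<open>R\<close> past finite sums only. The tails of the series
    have Hoelder bounds that tend to 0, and \<open>dec\<close> with exponent 1 bounds
    \<open>R\<close> on them, which allows the passage to the limit.\<close>
  have RB: "R (B f) \<omega> = z * B f \<omega> + f \<omega>" if f: "f \<in> V" for f \<omega>
  proof (cases "\<omega> \<in> full_shift A")
    case False
    then show ?thesis
      by (simp add: V_zero[OF f] V_zero[OF BV[OF f]] V_zero[OF linear_VD(1)[OF R BV[OF f]]])
  next
    case True
    obtain b where b: "0 \<le> b" "hb b f" using V_E[OF f] .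
    define P where "P n = (\<lambda>\<omega>. \<Sum>m<n. F f m \<omega>)" for n
    have FV: "F f m \<in> V" for m unfolding F_def by (rule V_scale[OF linear_V_pow[OF R f]])
    have PV: "P n \<in> V" for n unfolding P_def by (rule V_sum) (simp_all add: FV)
    have RF: "R (F f m) \<omega> = z * F f (Suc m) \<omega>" for m
      unfolding FSuc unfolding F_def using linear_V_scale[OF R linear_V_pow[OF R f]] by simp
    \<comment> \<open>Since \<open>B f\<close> is minus the full sum, this is the remainder after
      \<open>n\<close> terms.\<close>
    define tail where "tail n = (\<lambda>\<omega>. (-1) * B f \<omega> + (-1) * P n \<omega>)" for n
    have tV: "tail n \<in> V" for n unfolding tail_def by (rule V_linear[OF BV[OF f] PV])
    have ht: "hb (\<Sum>m. a b (m + n)) (tail n)" for n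
    proof -
      have "tail n = (\<lambda>\<omega>. \<Sum>m. F f (m + n) \<omega>)"
        using suminf_minus_initial_segment[OF sF[OF f]] by (simp add: tail_def B_def P_def)
      then show ?thesis
        using hb_suminf(2)[of "\<lambda>m. a b (m + n)" "\<lambda>m. F f (m + n)"] hF[OF f b] sa summable_ignore_initial_segment by simp
    qed
    have Rt: "R (tail n) \<omega> = - R (B f) \<omega> - (\<Sum>m<n. z * F f (Suc m) \<omega>)" for n
      using linear_VD(2)[OF R BV[OF f] PV, of "-1" "-1" n] linear_V_sum[OF R, of "{..<n}" "F f"] FV RF
      by (simp add: tail_def P_def)
    have "(\<lambda>n. R (tail n) \<omega>) \<longlonglongrightarrow> 0"
    proof (rule Lim_null_comparison)
      have "norm (R (tail n) \<omega>) \<le> C * \<rho> * (\<Sum>m. a b (m + n))" for n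
      proof -
        have pos: "0 \<le> (\<Sum>m. a b (m + n))"
          using C s b by (intro suminf_nonneg summable_ignore_initial_segment sa) (simp add: a_def)
        show ?thesis using holder_boundD(1)[OF dec[OF tV pos ht, of "Suc 0"] True] by simp
      qed
      then show "\<forall>\<^sub>F n in sequentially. norm (R (tail n) \<omega>) \<le> C * \<rho> * (\<Sum>m. a b (m + n))" by simp
      have "(\<lambda>n. \<Sum>m. a b (m + n)) \<longlonglongrightarrow> 0" using suminf_exist_split2[OF sa] .
      then show "(\<lambda>n. C * \<rho> * (\<Sum>m. a b (m + n))) \<longlonglongrightarrow> 0" by (rule tendsto_mult_right_zero)
    qed
    moreover have "(\<lambda>n. \<Sum>m<n. z * F f (Suc m) \<omega>) \<longlonglongrightarrow> (\<Sum>m. z * F f (Suc m) \<omega>)"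
      by (intro summable_LIMSEQ summable_mult sFS[OF f])
    then have "(\<lambda>n. R (tail n) \<omega>) \<longlonglongrightarrow> - R (B f) \<omega> - (\<Sum>m. z * F f (Suc m) \<omega>)"
      unfolding Rt by (intro tendsto_intros)
    ultimately have "- R (B f) \<omega> - (\<Sum>m. z * F f (Suc m) \<omega>) = 0" by (rule LIMSEQ_unique[symmetric])
    then have "- R (B f) \<omega> = (\<Sum>m. z * F f (Suc m) \<omega>)" by (rule eq_iff_diff_eq_0[THEN iffD2])
    then have "R (B f) \<omega> = - (\<Sum>m. z * F f (Suc m) \<omega>)" by (metis add.inverse_inverse)
    then show ?thesis using shiftsum[OF f, of \<omega>] by simp
  qed
  have "bounded_operator V N B" by (rule bounded_operatorI[OF linB a1 hB])
  moreover have "B (op_minus_scalar R z f) = f \<and> op_minus_scalar R z (B f) = f" if f: "f \<in> V" for f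
  proof
    have "op_minus_scalar R z f = (\<lambda>\<omega>. 1 * R f \<omega> + (- z) * f \<omega>)" by (simp add: op_minus_scalar_def)
    then have "B (op_minus_scalar R z f) = (\<lambda>\<omega>. 1 * B (R f) \<omega> + (- z) * B f \<omega>)"
      by (simp only: Blin[OF linear_VD(1)[OF R f] f])
    then show "B (op_minus_scalar R z f) = f" by (simp add: BR[OF f])
    show "op_minus_scalar R z (B f) = f" using RB[OF f] by (simp add: op_minus_scalar_def fun_eq_iff)
  qed
  ultimately show ?thesis unfolding op_spectrum_def by blast
qed

end

section \<open>Spectral decomposition from a biorthogonal system\<close>

text \<open>The \<open>h i\<close> and \<open>l i\<close> are biorthogonal eigenvectors of
  \<open>L\<close> and of its dual, with distinct eigenvalues of one modulus, and the powers of
  \<open>L\<close> decay at a smaller rate on the common kernel of the \<open>l i\<close>. These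
  facts alone yield the decomposition.\<close>

locale peripheral_spectrum = holder_space A \<theta> k
  for A :: "'s \<Rightarrow> 's \<Rightarrow> nat" and \<theta> :: real and k :: nat +
  fixes L :: "('s point \<Rightarrow> complex) \<Rightarrow> 's point \<Rightarrow> complex"
    and lam \<rho> C\<^sub>L C\<^sub>l C :: real and p :: nat and \<mu> :: "nat \<Rightarrow> complex"
    and h :: "nat \<Rightarrow> 's point \<Rightarrow> complex" and l :: "nat \<Rightarrow> ('s point \<Rightarrow> complex) \<Rightarrow> complex"
  assumes L: "linear_V L"
    and C\<^sub>L: "0 \<le> C\<^sub>L" "\<And>f b. f \<in> V \<Longrightarrow> 0 \<le> b \<Longrightarrow> hb b f \<Longrightarrow> hb (C\<^sub>L * b) (L f)"
    and h_V: "\<And>i. i < p \<Longrightarrow> h i \<in> V"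
    and L_h: "\<And>i. i < p \<Longrightarrow> L (h i) = (\<lambda>\<omega>. \<mu> i * h i \<omega>)"
    and l_linear: "\<And>i f u a c. i < p \<Longrightarrow> f \<in> V \<Longrightarrow> u \<in> V \<Longrightarrow> l i (\<lambda>\<omega>. a * f \<omega> + c * u \<omega>) = a * l i f + c * l i u"
    and C\<^sub>l: "0 \<le> C\<^sub>l" "\<And>i f b. i < p \<Longrightarrow> f \<in> V \<Longrightarrow> 0 \<le> b \<Longrightarrow> hb b f \<Longrightarrow> norm (l i f) \<le> C\<^sub>l * b"
    and l_L: "\<And>i f. i < p \<Longrightarrow> f \<in> V \<Longrightarrow> l i (L f) = \<mu> i * l i f"
    and l_h: "\<And>i j. i < p \<Longrightarrow> j < p \<Longrightarrow> l i (h j) = (if i = j then 1 else 0)"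
    and norm_\<mu>: "\<And>i. i < p \<Longrightarrow> norm (\<mu> i) = lam"
    and inj_\<mu>: "inj_on \<mu> {..<p}"
    and \<rho>: "0 < \<rho>" "\<rho> < lam" and C: "0 \<le> C"
    and decay: "\<And>f b m. f \<in> V \<Longrightarrow> 0 \<le> b \<Longrightarrow> hb b f \<Longrightarrow> (\<And>i. i < p \<Longrightarrow> l i f = 0) \<Longrightarrow>
                  hb (C * \<rho> ^ m * b) ((L ^^ m) f)"
begin

definition S :: "(nat \<Rightarrow> complex) \<Rightarrow> 's point \<Rightarrow> complex" where
  "S c = (\<lambda>\<omega>. \<Sum>i<p. c i * h i \<omega>)"

definition R :: "('s point \<Rightarrow> complex) \<Rightarrow> 's point \<Rightarrow> complex" where
  "R f = (\<lambda>\<omega>. L f \<omega> - S (\<lambda>i. \<mu> i * l i f) \<omega>)"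

text \<open>The projection onto the common kernel of the \<open>l i\<close> along the span of the
  \<open>h i\<close>; on \<open>V\<close> the remainder \<open>R\<close> is \<open>L\<close>
  composed with it.\<close>

definition Q :: "('s point \<Rightarrow> complex) \<Rightarrow> 's point \<Rightarrow> complex" where
  "Q f = (\<lambda>\<omega>. f \<omega> - S (\<lambda>i. l i f) \<omega>)"

lemma S_V: "S c \<in> V"
  unfolding S_def by (rule V_sum) (simp_all add: V_scale h_V)

lemma l_diff: "i < p \<Longrightarrow> f \<in> V \<Longrightarrow> u \<in> V \<Longrightarrow> l i (\<lambda>\<omega>. f \<omega> - u \<omega>) = l i f - l i u"
  using l_linear[of i f u 1 "-1"] by simp

lemma l_scale: "i < p \<Longrightarrow> f \<in> V \<Longrightarrow> l i (\<lambda>\<omega>. c * f \<omega>) = c * l i f"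
  using l_linear[of i f f c 0] by simp

lemma l_0: "i < p \<Longrightarrow> l i (\<lambda>\<omega>. 0) = 0"
  using l_scale[OF _ V_0, of i 0] by simp

lemma l_sum:
  assumes "i < p" "finite J" "\<And>j. j \<in> J \<Longrightarrow> f j \<in> V"
  shows "l i (\<lambda>\<omega>. \<Sum>j\<in>J. f j \<omega>) = (\<Sum>j\<in>J. l i (f j))"
  using assms(2,3)
proof (induction J rule: finite_induct)
  case (insert j J)
  then show ?case using l_linear[OF assms(1), of "f j" "\<lambda>\<omega>. \<Sum>j\<in>J. f j \<omega>" 1 1] V_sum[of J f] by simp
qed (simp add: l_0 assms(1))

lemma l_S: "i < p \<Longrightarrow> l i (S c) = c i"
proof -
  assume i: "i < p"
  have "l i (S c) = (\<Sum>j<p. l i (\<lambda>\<omega>. c j * h j \<omega>))"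
    unfolding S_def by (rule l_sum[OF i]) (simp_all add: V_scale h_V)
  also have "\<dots> = (\<Sum>j<p. if i = j then c j else 0)"
    by (rule sum.cong) (simp_all add: l_scale[OF i h_V] l_h[OF i])
  also have "\<dots> = c i" using i by simp
  finally show ?thesis .
qed

lemma L_S: "L (S c) = S (\<lambda>i. \<mu> i * c i)"
proof -
  have "L (S c) = (\<lambda>\<omega>. \<Sum>j<p. L (\<lambda>\<omega>. c j * h j \<omega>) \<omega>)"
    unfolding S_def by (rule linear_V_sum[OF L]) (simp_all add: V_scale h_V)
  also have "\<dots> = S (\<lambda>i. \<mu> i * c i)"
    unfolding S_def by (rule ext, rule sum.cong) (simp_all add: linear_V_scale[OF L h_V] L_h)
  finally show ?thesis .
qed

lemma S_linear: "a * S c \<omega> + b * S c' \<omega> = S (\<lambda>i. a * c i + b * c' i) \<omega>"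
  by (simp add: S_def sum_distrib_left sum.distrib algebra_simps)

lemma Q_V: "f \<in> V \<Longrightarrow> Q f \<in> V"
  unfolding Q_def by (rule V_diff[OF _ S_V])

lemma l_Q: "i < p \<Longrightarrow> f \<in> V \<Longrightarrow> l i (Q f) = 0"
  unfolding Q_def by (simp add: l_diff S_V l_S)

lemma R_linear: "linear_V R"
  unfolding linear_V_def
proof (intro conjI ballI allI)
  show "R f \<in> V" if "f \<in> V" for f
    unfolding R_def by (rule V_diff[OF linear_VD(1)[OF L that] S_V])
  fix f u a c assume fu: "f \<in> V" "u \<in> V"
  have "S (\<lambda>i. \<mu> i * l i (\<lambda>\<omega>. a * f \<omega> + c * u \<omega>)) \<omega> =
      a * S (\<lambda>i. \<mu> i * l i f) \<omega> + c * S (\<lambda>i. \<mu> i * l i u) \<omega>" for \<omega>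
    unfolding S_linear unfolding S_def by (rule sum.cong) (simp_all add: l_linear fu algebra_simps)
  then show "R (\<lambda>\<omega>. a * f \<omega> + c * u \<omega>) = (\<lambda>\<omega>. a * R f \<omega> + c * R u \<omega>)"
    unfolding R_def linear_VD(2)[OF L fu] by (simp add: algebra_simps)
qed

lemma R_eq_L:
  assumes "\<And>i. i < p \<Longrightarrow> l i f = 0"
  shows "R f = L f"
proof -
  have "S (\<lambda>i. \<mu> i * l i f) \<omega> = 0" for \<omega>
    unfolding S_def by (rule sum.neutral) (simp add: assms)
  then show ?thesis by (simp add: R_def)
qed

lemma R_eq_L_Q: "f \<in> V \<Longrightarrow> R f = L (Q f)"
  unfolding R_def Q_def by (simp add: linear_V_diff[OF L _ S_V] L_S)

lemma l_L_pow: "i < p \<Longrightarrow> f \<in> V \<Longrightarrow> l i ((L ^^ m) f) = \<mu> i ^ m * l i f"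
  by (induction m) (simp_all add: l_L linear_V_pow[OF L])

text \<open>\<open>L\<close> preserves the common kernel of the functionals, and there
  \<open>R\<close> equals \<open>L\<close>, so one projection at the start suffices. The formula
  begins with exponent 1, as \<open>R ^^ 0\<close> is the identity and not \<open>Q\<close>.\<close>

lemma R_pow: "f \<in> V \<Longrightarrow> (R ^^ Suc m) f = (L ^^ Suc m) (Q f)"
proof (induction m)
  case 0
  then show ?case by (simp add: R_eq_L_Q)
next
  case (Suc m)
  have "R ((L ^^ Suc m) (Q f)) = L ((L ^^ Suc m) (Q f))"
    by (rule R_eq_L) (simp only: l_L_pow Q_V l_Q Suc.prems mult_zero_right)
  then show ?case using Suc by simp
qed

lemma l_R: "i < p \<Longrightarrow> f \<in> V \<Longrightarrow> l i (R f) = 0"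
  by (simp add: R_eq_L_Q l_L Q_V l_Q)

lemma rank_one_bound:
  obtains H where "0 \<le> H" "\<And>i f b. i < p \<Longrightarrow> f \<in> V \<Longrightarrow> 0 \<le> b \<Longrightarrow> hb b f \<Longrightarrow> hb (H * b) (\<lambda>\<omega>. l i f * h i \<omega>)"
proof -
  have "\<forall>i\<in>{..<p}. \<exists>H\<ge>0. hb H (h i)" using h_V V_E by (metis lessThan_iff)
  then obtain H where H: "\<And>i. i < p \<Longrightarrow> 0 \<le> H i" "\<And>i. i < p \<Longrightarrow> hb (H i) (h i)"
    unfolding bchoice_iff by (metis lessThan_iff)
  let ?H = "C\<^sub>l * (\<Sum>i<p. H i)"
  show ?thesis
  proof
    show "0 \<le> ?H" using C\<^sub>l(1) H(1) by (intro mult_nonneg_nonneg sum_nonneg) simp_all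
    fix i f b assume a: "i < p" "f \<in> V" "0 \<le> b" "hb b f"
    have "H i \<le> (\<Sum>i<p. H i)" by (rule member_le_sum) (use a H in simp_all)
    then have "norm (l i f) * H i \<le> (C\<^sub>l * b) * (\<Sum>i<p. H i)"
      using C\<^sub>l(2)[OF a] H(1)[OF a(1)] C\<^sub>l(1) a(3) by (intro mult_mono) simp_all
    then show "hb (?H * b) (\<lambda>\<omega>. l i f * h i \<omega>)"
      by (intro holder_bound_mono[OF holder_bound_scale[OF H(2)[OF a(1)]] _ theta(1)]) (simp add: mult_ac)
  qed
qed

lemma Q_bound:
  obtains K where "0 \<le> K" "\<And>f b. f \<in> V \<Longrightarrow> 0 \<le> b \<Longrightarrow> hb b f \<Longrightarrow> hb (K * b) (Q f)"
proof -
  obtain H where H: "0 \<le> H"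
    "\<And>i f b. i < p \<Longrightarrow> f \<in> V \<Longrightarrow> 0 \<le> b \<Longrightarrow> hb b f \<Longrightarrow> hb (H * b) (\<lambda>\<omega>. l i f * h i \<omega>)"
    by (rule rank_one_bound) blast
  show ?thesis
  proof
    show "0 \<le> 1 + real p * H" using H(1) by simp
    fix f b assume f: "f \<in> V" "0 \<le> b" "hb b f"
    have "hb (\<Sum>i<p. H * b) (S (\<lambda>i. l i f))"
      unfolding S_def by (rule holder_bound_sum) (simp_all add: H(2)[OF _ f])
    from holder_bound_diff[OF f(3) this] show "hb ((1 + real p * H) * b) (Q f)"
      unfolding Q_def by (simp add: algebra_simps)
  qed
qed

text \<open>The decay of \<open>L\<close> on the range of \<open>Q\<close>, transferred by
  \<open>R_pow\<close>; the summand 1 in the constant covers exponent 0.\<close>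

lemma R_decay:
  obtains C' where "0 \<le> C'" "\<And>f b m. f \<in> V \<Longrightarrow> 0 \<le> b \<Longrightarrow> hb b f \<Longrightarrow> hb (C' * \<rho> ^ m * b) ((R ^^ m) f)"
proof -
  obtain K where K: "0 \<le> K" "\<And>f b. f \<in> V \<Longrightarrow> 0 \<le> b \<Longrightarrow> hb b f \<Longrightarrow> hb (K * b) (Q f)"
    by (rule Q_bound) blast
  show ?thesis
  proof
    show "0 \<le> 1 + C * K" using C K(1) by simp
    fix f b m assume f: "f \<in> V" "0 \<le> b" "hb b f"
    show "hb ((1 + C * K) * \<rho> ^ m * b) ((R ^^ m) f)"
    proof (cases m)
      case 0
      have "1 * b \<le> (1 + C * K) * b" using C K(1) f(2) by (intro mult_right_mono) simp_all
      then show ?thesis using 0 holder_bound_mono[OF f(3) _ theta(1)] by simp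
    next
      case (Suc n)
      have "hb (C * \<rho> ^ m * (K * b)) ((L ^^ m) (Q f))"
        by (rule decay[OF Q_V[OF f(1)] _ K(2)[OF f] l_Q[OF _ f(1)]]) (use K(1) f(2) in simp)
      moreover have "C * \<rho> ^ m * (K * b) \<le> (1 + C * K) * \<rho> ^ m * b"
        using mult_nonneg_nonneg[of "\<rho> ^ m" b] \<rho>(1) f(2) by (simp add: algebra_simps)
      ultimately have "hb ((1 + C * K) * \<rho> ^ m * b) ((L ^^ m) (Q f))"
        using holder_bound_mono[OF _ _ theta(1)] by blast
      then show ?thesis unfolding Suc R_pow[OF f(1)] .
    qed
  qed
qed

lemma R_bounded: "bounded_operator V N R"
proof -
  obtain C' where C': "0 \<le> C'" "\<And>f b m. f \<in> V \<Longrightarrow> 0 \<le> b \<Longrightarrow> hb b f \<Longrightarrow> hb (C' * \<rho> ^ m * b) ((R ^^ m) f)"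
    by (rule R_decay) blast
  show ?thesis
    by (rule bounded_operatorI[OF R_linear, of "C' * \<rho>"]) (use C'(1) C'(2)[of _ _ "Suc 0"] \<rho> in simp_all)
qed

lemma R_spectral_radius: "spectral_radius V N R < ennreal lam"
proof -
  obtain C' where C': "0 \<le> C'" "\<And>f b m. f \<in> V \<Longrightarrow> 0 \<le> b \<Longrightarrow> hb b f \<Longrightarrow> hb (C' * \<rho> ^ m * b) ((R ^^ m) f)"
    by (rule R_decay) blast
  have "spectral_radius V N R \<le> ennreal \<rho>"
    unfolding spectral_radius_def
  proof (rule SUP_least, rule ennreal_leI)
    fix z assume "z \<in> op_spectrum V N R"
    then show "norm z \<le> \<rho>" using not_in_spectrum[OF R_linear C'(1) \<rho>(1) C'(2), of z] by (meson not_le)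
  qed
  also have "\<dots> < ennreal lam" using \<rho> by (simp add: ennreal_lessI)
  finally show ?thesis .
qed

lemma rank_one_linear: "i < p \<Longrightarrow> linear_V (tensor_op (h i) (l i))"
  unfolding linear_V_def tensor_op_def
  by (intro conjI ballI allI V_scale h_V) (simp_all add: l_linear ring_distribs mult.assoc)

lemma projection: "i < p \<Longrightarrow> projection_operator V N (tensor_op (h i) (l i))"
proof -
  assume i: "i < p"
  obtain H where H: "0 \<le> H"
    "\<And>i f b. i < p \<Longrightarrow> f \<in> V \<Longrightarrow> 0 \<le> b \<Longrightarrow> hb b f \<Longrightarrow> hb (H * b) (\<lambda>\<omega>. l i f * h i \<omega>)"
    by (rule rank_one_bound) blast
  have "bounded_operator V N (tensor_op (h i) (l i))"
    by (rule bounded_operatorI[OF rank_one_linear[OF i] H(1)]) (simp add: tensor_op_def H(2)[OF i])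
  then show ?thesis
    unfolding projection_operator_def by (simp add: tensor_op_def l_scale h_V l_h i)
qed

text \<open>On the common kernel, an eigenfunction for an eigenvalue of modulus \<open>lam\<close>
  would have iterates of size \<open>lam ^ m\<close>, against the decay
  \<open>\<rho> ^ m\<close>.\<close>

lemma eigen_zero:
  assumes u: "u \<in> V" "\<And>j. j < p \<Longrightarrow> l j u = 0" and i: "i < p" and eig: "L u = (\<lambda>\<omega>. \<mu> i * u \<omega>)"
  shows "u = (\<lambda>\<omega>. 0)"
proof
  fix \<omega>
  show "u \<omega> = 0"
  proof (cases "\<omega> \<in> full_shift A")
    case True
    obtain b where b: "0 \<le> b" "hb b u" using V_E[OF u(1)] .
    have pow: "(L ^^ m) u = (\<lambda>\<omega>. \<mu> i ^ m * u \<omega>)" for m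
      by (induction m) (simp_all add: linear_V_scale[OF L u(1)] eig mult.left_commute mult.assoc)
    have lam: "0 < lam" using \<rho> by simp
    have "norm (u \<omega>) \<le> C * b * (\<rho> / lam) ^ m" for m
    proof -
      have "lam ^ m * norm (u \<omega>) \<le> C * \<rho> ^ m * b"
        using holder_boundD(1)[OF decay[OF u(1) b u(2), of m] True]
        by (simp add: pow norm_mult norm_power norm_\<mu>[OF i])
      then show ?thesis using lam by (simp add: power_divide pos_le_divide_eq mult_ac)
    qed
    moreover have "(\<lambda>m. C * b * (\<rho> / lam) ^ m) \<longlonglongrightarrow> 0"
      using \<rho> lam by (intro tendsto_mult_right_zero LIMSEQ_power_zero) simp
    ultimately have "norm (u \<omega>) \<le> 0" by (intro LIMSEQ_le_const) auto
    then show ?thesis by simp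
  qed (rule V_zero[OF u(1)])
qed

abbreviation "\<Delta> i \<equiv> op_minus_scalar L (\<mu> i)"

lemma Delta_linear: "linear_V (\<Delta> i)"
  unfolding linear_V_def op_minus_scalar_def
  by (intro conjI ballI allI V_diff V_scale linear_VD(1)[OF L])
    (simp_all add: linear_VD(2)[OF L] right_diff_distrib distrib_left mult.left_commute fun_eq_iff)

text \<open>\<open>\<Delta> i\<close> maps the common kernel into itself and is injective there by
  \<open>eigen_zero\<close>, so the factors can be removed one at a time.\<close>

lemma Delta_kernel:
  assumes "u \<in> V" "\<And>j. j < p \<Longrightarrow> l j u = 0" "i < p" "(\<Delta> i ^^ n) u = (\<lambda>\<omega>. 0)"
  shows "u = (\<lambda>\<omega>. 0)"
  using assms(1,2,4)
proof (induction n arbitrary: u)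
  case (Suc n)
  have DV: "\<Delta> i u \<in> V" by (rule linear_VD(1)[OF Delta_linear Suc.prems(1)])
  have lD: "l j (\<Delta> i u) = 0" if "j < p" for j
    unfolding op_minus_scalar_def
    using that Suc.prems(1,2) by (simp add: l_diff linear_VD(1)[OF L] V_scale l_L l_scale)
  have "(\<Delta> i ^^ n) (\<Delta> i u) = (\<lambda>\<omega>. 0)" using Suc.prems(3) by (simp add: funpow_swap1)
  from Suc.IH[OF DV lD this] have "L u = (\<lambda>\<omega>. \<mu> i * u \<omega>)" by (simp add: op_minus_scalar_def fun_eq_iff)
  from eigen_zero[OF Suc.prems(1) Suc.prems(2) assms(3) this] show ?case .
qed simp

lemma eigenfunction: "i < p \<Longrightarrow> eigenfunction V L (\<mu> i) (h i)"
  unfolding eigenfunction_def using h_V L_h l_h[of i i] l_0[of i] by force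

text \<open>Applying \<open>\<Delta> i\<close> multiplies \<open>l j\<close> by
  \<open>\<mu> j - \<mu> i\<close>, which is nonzero for \<open>j \<noteq> i\<close>; hence on a
  generalised eigenvector \<open>f\<close> only \<open>l i f\<close> can survive. Subtracting
  \<open>l i f\<close> times \<open>h i\<close> leads into the common kernel, where
  \<open>Delta_kernel\<close> applies.\<close>

lemma simple: "i < p \<Longrightarrow> simple_eigenvalue V L (\<mu> i)"
proof -
  assume i: "i < p"
  have Dh: "\<Delta> i (h i) = (\<lambda>\<omega>. 0)" by (simp add: op_minus_scalar_def L_h[OF i])
  have "{f \<in> V. \<exists>n. (\<Delta> i ^^ n) f = (\<lambda>x. 0)} = range (\<lambda>(c::complex) x. c * h i x)"
  proof (intro equalityI subsetI)
    fix f assume "f \<in> range (\<lambda>(c::complex) x. c * h i x)"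
    then obtain c where f: "f = (\<lambda>x. c * h i x)" by blast
    have "(\<Delta> i ^^ Suc 0) f = (\<lambda>x. 0)"
      by (simp add: f linear_V_scale[OF Delta_linear h_V[OF i]] Dh)
    then show "f \<in> {f \<in> V. \<exists>n. (\<Delta> i ^^ n) f = (\<lambda>x. 0)}" using f V_scale[OF h_V[OF i]] by blast
  next
    fix f assume "f \<in> {f \<in> V. \<exists>n. (\<Delta> i ^^ n) f = (\<lambda>x. 0)}"
    then obtain n where f: "f \<in> V" and n: "(\<Delta> i ^^ n) f = (\<lambda>x. 0)" by blast
    have D0: "\<Delta> i (\<lambda>x. 0) = (\<lambda>x. 0)" using linear_V_scale[OF Delta_linear V_0, of i 0] by simp
    \<comment> \<open>One extra power makes sure that the multiple of \<open>h i\<close> is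
      annihilated as well, even when \<open>n = 0\<close>.\<close>
    then have n': "(\<Delta> i ^^ Suc n) f = (\<lambda>x. 0)" using n by simp
    have lD: "l j ((\<Delta> i ^^ m) f) = (\<mu> j - \<mu> i) ^ m * l j f" if j: "j < p" for j m
    proof (induction m)
      case (Suc m)
      have "(\<Delta> i ^^ m) f \<in> V" by (rule linear_V_pow[OF Delta_linear f])
      then have "l j (\<Delta> i ((\<Delta> i ^^ m) f)) = (\<mu> j - \<mu> i) * l j ((\<Delta> i ^^ m) f)"
        unfolding op_minus_scalar_def[of L "\<mu> i" "(\<Delta> i ^^ m) f"]
        using j by (simp add: l_diff linear_VD(1)[OF L] V_scale l_L l_scale left_diff_distrib)
      then show ?case using Suc by simp
    qed simp
    have lf: "l j f = 0" if "j < p" "j \<noteq> i" for j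
    proof -
      have "\<mu> j \<noteq> \<mu> i" using inj_onD[OF inj_\<mu>, of j i] that i by auto
      moreover have "(\<mu> j - \<mu> i) ^ Suc n * l j f = 0" using lD[OF that(1), of "Suc n"] l_0[OF that(1)] n' by simp
      ultimately show ?thesis by simp
    qed
    let ?u = "\<lambda>\<omega>. f \<omega> - l i f * h i \<omega>"
    have hV: "(\<lambda>\<omega>. l i f * h i \<omega>) \<in> V" by (rule V_scale[OF h_V[OF i]])
    have lu: "l j ?u = 0" if "j < p" for j
      using that lf[of j] by (cases "j = i") (simp_all add: l_diff[OF _ f hV] l_scale h_V i l_h)
    have Dpow0: "(\<Delta> i ^^ m) (\<lambda>x. 0) = (\<lambda>x. 0)" for m by (induction m) (simp_all add: D0)
    have Dpow_diff: "(\<Delta> i ^^ m) (\<lambda>\<omega>. f \<omega> - u \<omega>) = (\<lambda>\<omega>. (\<Delta> i ^^ m) f \<omega> - (\<Delta> i ^^ m) u \<omega>)" if "u \<in> V" for u m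
      by (induction m) (simp_all add: linear_V_diff[OF Delta_linear] linear_V_pow[OF Delta_linear] f that)
    have "(\<Delta> i ^^ Suc n) (\<lambda>\<omega>. l i f * h i \<omega>) = (\<Delta> i ^^ n) (\<Delta> i (\<lambda>\<omega>. l i f * h i \<omega>))"
      by (simp add: funpow_swap1)
    also have "\<dots> = (\<lambda>x. 0)" by (simp add: linear_V_scale[OF Delta_linear h_V[OF i]] Dh Dpow0)
    finally have "(\<Delta> i ^^ Suc n) ?u = (\<lambda>x. 0)" unfolding Dpow_diff[OF hV] n' by simp
    from Delta_kernel[OF V_diff[OF f hV] lu i this] have "f = (\<lambda>x. l i f * h i x)" by (simp add: fun_eq_iff)
    then show "f \<in> range (\<lambda>(c::complex) x. c * h i x)" by (rule range_eqI[where f = "\<lambda>(c::complex) x. c * h i x"])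
  qed
  then show ?thesis unfolding simple_eigenvalue_def using eigenfunction[OF i] by blast
qed

theorem spectral_decomposition:
  defines "P \<equiv> \<lambda>i. tensor_op (h i) (l i)"
  shows "bounded_operator V N R"
    and "\<And>f. f \<in> V \<Longrightarrow> L f = (\<lambda>\<omega>. (\<Sum>i<p. \<mu> i * P i f \<omega>) + R f \<omega>)"
    and "\<And>i. i < p \<Longrightarrow> simple_eigenvalue V L (\<mu> i) \<and> projection_operator V N (P i) \<and> eigenfunction V L (\<mu> i) (h i)"
    and "\<And>i f. i < p \<Longrightarrow> f \<in> V \<Longrightarrow> R (P i f) = (\<lambda>\<omega>. 0) \<and> P i (R f) = (\<lambda>\<omega>. 0)"
    and "\<And>i j f. i < p \<Longrightarrow> j < p \<Longrightarrow> j \<noteq> i \<Longrightarrow> f \<in> V \<Longrightarrow> P i (P j f) = (\<lambda>\<omega>. 0)"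
    and "spectral_radius V N R < ennreal lam"
proof -
  show "bounded_operator V N R" by (rule R_bounded)
  show "spectral_radius V N R < ennreal lam" by (rule R_spectral_radius)
  show "simple_eigenvalue V L (\<mu> i) \<and> projection_operator V N (P i) \<and> eigenfunction V L (\<mu> i) (h i)" if "i < p" for i
    unfolding P_def using simple[OF that] projection[OF that] eigenfunction[OF that] by blast
  show "L f = (\<lambda>\<omega>. (\<Sum>i<p. \<mu> i * P i f \<omega>) + R f \<omega>)" if "f \<in> V" for f
    by (simp add: R_def S_def P_def tensor_op_def mult.assoc)
  show "P i (P j f) = (\<lambda>\<omega>. 0)" if "i < p" "j < p" "j \<noteq> i" "f \<in> V" for i j f
    using that by (simp add: P_def tensor_op_def l_scale h_V l_h)
  show "R (P i f) = (\<lambda>\<omega>. 0) \<and> P i (R f) = (\<lambda>\<omega>. 0)" if i: "i < p" and f: "f \<in> V" for i f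
  proof
    have "S (\<lambda>j. \<mu> j * l j (h i)) = (\<lambda>\<omega>. \<mu> i * h i \<omega>)"
    proof
      fix \<omega>
      have "S (\<lambda>j. \<mu> j * l j (h i)) \<omega> = (\<Sum>j<p. if j = i then \<mu> j * h j \<omega> else 0)"
        unfolding S_def by (rule sum.cong) (simp_all add: l_h i)
      then show "S (\<lambda>j. \<mu> j * l j (h i)) \<omega> = \<mu> i * h i \<omega>" using i by simp
    qed
    then have "R (h i) = (\<lambda>\<omega>. 0)" by (simp add: R_def L_h i)
    then show "R (P i f) = (\<lambda>\<omega>. 0)"
      by (simp add: P_def tensor_op_def linear_V_scale[OF R_linear h_V[OF i]])
    show "P i (R f) = (\<lambda>\<omega>. 0)" by (simp add: P_def tensor_op_def l_R i f)
  qed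
qed

end

section \<open>The complex transfer operator\<close>

lemma holder_bound_Re:
  assumes "holder_bound A \<theta> k b (f :: 's point \<Rightarrow> complex)"
  shows "holder_bound A \<theta> k b (\<lambda>\<omega>. Re (f \<omega>))" "holder_bound A \<theta> k b (\<lambda>\<omega>. Im (f \<omega>))"
proof -
  have "\<bar>Re z\<bar> \<le> b" "\<bar>Im z\<bar> \<le> b" if "norm z \<le> b" for z :: complex and b
    using that abs_Re_le_cmod[of z] abs_Im_le_cmod[of z] by linarith+
  note 1 = this
  note 2 = 1[of "x - y" for x y, unfolded minus_complex.sel]
  show "holder_bound A \<theta> k b (\<lambda>\<omega>. Re (f \<omega>))" "holder_bound A \<theta> k b (\<lambda>\<omega>. Im (f \<omega>))"
    using holder_boundD[OF assms] by (auto intro!: holder_boundI 1 2)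
qed

lemma holder_bound_complex:
  assumes "holder_bound A \<theta> k b (\<lambda>\<omega>. Re (f \<omega>))" "holder_bound A \<theta> k b (\<lambda>\<omega>. Im (f \<omega>))"
  shows "holder_bound A \<theta> k (2 * b) f"
proof (rule holder_boundI)
  fix \<omega> assume "\<omega> \<in> full_shift A"
  then show "norm (f \<omega>) \<le> 2 * b"
    using cmod_le[of "f \<omega>"] holder_boundD(1)[OF assms(1)] holder_boundD(1)[OF assms(2)] by fastforce
next
  fix \<omega> \<upsilon> assume w: "\<omega> \<in> full_shift A" "\<upsilon> \<in> full_shift A" "agree k \<omega> \<upsilon>"
  show "norm (f \<omega> - f \<upsilon>) \<le> 2 * b * dist_theta \<theta> \<omega> \<upsilon>"
    using cmod_le[of "f \<omega> - f \<upsilon>"] holder_boundD(2)[OF assms(1) w] holder_boundD(2)[OF assms(2) w] by simp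
qed

section \<open>Real and imaginary parts of the complex operator\<close>

context transfer_system
begin

abbreviation "Lc \<equiv> transfer_op A M \<phi>"

lemma Lc_summable:
  assumes "bounded_by b (\<lambda>\<omega>. norm (f \<omega>))" "\<omega> \<in> X"
  shows "(\<lambda>a. complex_of_real (exp (\<phi> (prepend a \<omega>))) * f (prepend a \<omega>)) summable_on {a. M a (\<omega> 0) = 1}"
proof (rule abs_summable_summable)
  show "(\<lambda>a. norm (complex_of_real (exp (\<phi> (prepend a \<omega>))) * f (prepend a \<omega>))) summable_on {a. M a (\<omega> 0) = 1}"
    using T_summable[OF assms] by (simp add: norm_mult)
qed

lemma Lc_components:
  assumes "bounded_by b (\<lambda>\<omega>. norm (f \<omega>))"
  shows "Re (Lc f \<omega>) = T (\<lambda>\<omega>. Re (f \<omega>)) \<omega>" "Im (Lc f \<omega>) = T (\<lambda>\<omega>. Im (f \<omega>)) \<omega>"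
  using infsum_Re[OF Lc_summable[OF assms, of \<omega>]] infsum_Im[OF Lc_summable[OF assms, of \<omega>]]
  by (simp_all add: transfer_op_def real_transfer_def)

lemma bounded_by_components:
  assumes "bounded_by b (\<lambda>\<omega>. norm (f \<omega>))"
  shows "bounded_by b (\<lambda>\<omega>. Re (f \<omega>))" "bounded_by b (\<lambda>\<omega>. Im (f \<omega>))"
  using bounded_byD[OF assms] abs_Re_le_cmod abs_Im_le_cmod by (auto intro!: bounded_byI intro: order_trans)

lemma holder_bound_imp_bounded_norm: "holder_bound A \<theta> k b f \<Longrightarrow> bounded_by b (\<lambda>\<omega>. norm (f \<omega>))"
  for f :: "'s point \<Rightarrow> complex"
  by (rule bounded_byI) (simp add: holder_boundD(1))

lemma Lc_pow_components:
  assumes "0 \<le> b" "bounded_by b (\<lambda>\<omega>. norm (f \<omega>))" "\<omega> \<in> X"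
  shows "Re ((Lc ^^ m) f \<omega>) = (T ^^ m) (\<lambda>\<omega>. Re (f \<omega>)) \<omega> \<and> Im ((Lc ^^ m) f \<omega>) = (T ^^ m) (\<lambda>\<omega>. Im (f \<omega>)) \<omega>"
  using assms(3)
proof (induction m arbitrary: \<omega>)
  case (Suc m)
  note bd = bounded_by_components[OF assms(2)]
  have bound: "bounded_by (2 * (E ^ m * b)) (\<lambda>\<omega>. norm ((Lc ^^ m) f \<omega>))"
  proof (rule bounded_byI)
    fix \<omega> assume w: "\<omega> \<in> X"
    show "\<bar>norm ((Lc ^^ m) f \<omega>)\<bar> \<le> 2 * (E ^ m * b)"
      using cmod_le[of "(Lc ^^ m) f \<omega>"] Suc.IH[OF w]
        bounded_byD[OF T_pow_bounded[OF bd(1) assms(1)] w, of m] bounded_byD[OF T_pow_bounded[OF bd(2) assms(1)] w, of m]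
      by simp
  qed
  show ?case
    unfolding funpow.simps o_apply Lc_components[OF bound]
    using T_cong[of "\<lambda>\<omega>. Re ((Lc ^^ m) f \<omega>)" "(T ^^ m) (\<lambda>\<omega>. Re (f \<omega>))"]
      T_cong[of "\<lambda>\<omega>. Im ((Lc ^^ m) f \<omega>)" "(T ^^ m) (\<lambda>\<omega>. Im (f \<omega>))"] Suc.IH by simp
qed simp

lemma holder_bound_Lc_pow_components:
  assumes "0 \<le> b" "bounded_by b (\<lambda>\<omega>. norm (f \<omega>))"
    and "holder_bound A \<theta> k c ((T ^^ m) (\<lambda>\<omega>. Re (f \<omega>)))" "holder_bound A \<theta> k c ((T ^^ m) (\<lambda>\<omega>. Im (f \<omega>)))"
  shows "holder_bound A \<theta> k (2 * c) ((Lc ^^ m) f)"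
proof (rule holder_bound_complex)
  show "holder_bound A \<theta> k c (\<lambda>\<omega>. Re ((Lc ^^ m) f \<omega>))"
    using assms(3) Lc_pow_components[OF assms(1,2)]
      holder_bound_cong[of A "\<lambda>\<omega>. Re ((Lc ^^ m) f \<omega>)" "(T ^^ m) (\<lambda>\<omega>. Re (f \<omega>))"] by simp
  show "holder_bound A \<theta> k c (\<lambda>\<omega>. Im ((Lc ^^ m) f \<omega>))"
    using assms(4) Lc_pow_components[OF assms(1,2)]
      holder_bound_cong[of A "\<lambda>\<omega>. Im ((Lc ^^ m) f \<omega>)" "(T ^^ m) (\<lambda>\<omega>. Im (f \<omega>))"] by simp
qed

lemma holder_bound_Lc:
  assumes "holder_bound A \<theta> k b f" "0 \<le> b"
  shows "holder_bound A \<theta> k (2 * (E * (1 + \<Phi>) * b)) (Lc f)"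
  using holder_bound_Lc_pow_components[OF assms(2) holder_bound_imp_bounded_norm[OF assms(1)],
      of "E * (1 + \<Phi>) * b" "Suc 0"]
    holder_bound_T[OF holder_bound_Re(1)[OF assms(1)] assms(2)] holder_bound_T[OF holder_bound_Re(2)[OF assms(1)] assms(2)]
  by simp

lemma Lc_linear:
  assumes "bounded_by b (\<lambda>\<omega>. norm (f \<omega>))" "bounded_by b' (\<lambda>\<omega>. norm (u \<omega>))"
  shows "Lc (\<lambda>\<omega>. s * f \<omega> + t * u \<omega>) \<omega> = s * Lc f \<omega> + t * Lc u \<omega>"
proof (cases "\<omega> \<in> X")
  case True
  let ?S = "{a. M a (\<omega> 0) = 1}" and ?e = "\<lambda>a. complex_of_real (exp (\<phi> (prepend a \<omega>)))"
  note sf = Lc_summable[OF assms(1) True] and su = Lc_summable[OF assms(2) True]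
  have "Lc (\<lambda>\<omega>. s * f \<omega> + t * u \<omega>) \<omega> =
      (\<Sum>\<^sub>\<infinity>a\<in>?S. s * (?e a * f (prepend a \<omega>)) + t * (?e a * u (prepend a \<omega>)))"
    using True by (simp add: transfer_op_def algebra_simps)
  also have "\<dots> = s * Lc f \<omega> + t * Lc u \<omega>"
    using True sf su by (simp add: transfer_op_def infsum_add infsum_cmult_right summable_on_cmult_right)
  finally show ?thesis .
qed (simp add: transfer_op_def)

end

section \<open>Integrals over sectors\<close>

context invariant_system
begin

text \<open>The functionals \<open>\<nu>s i\<close> of the final theorem are the discrete Fourier
  transform of these numbers in the cyclic index \<open>j\<close>.\<close>

definition sector_integral :: "nat \<Rightarrow> ('s point \<Rightarrow> complex) \<Rightarrow> complex" where
  "sector_integral j f = (LINT \<omega>|\<nu>. f \<omega> * indicator (sector j) \<omega>)"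

lemma holder_integrable_complex:
  assumes "holder_bound A \<theta> k b (f :: 's point \<Rightarrow> complex)"
  shows "integrable \<nu> f"
proof (rule integrable_const_bound[of _ b])
  show "AE x in \<nu>. norm (f x) \<le> b" by (rule AE_I2) (simp add: space_nu holder_boundD(1)[OF assms])
  show "f \<in> borel_measurable \<nu>"
    unfolding borel_measurable_complex_iff
    using measurable_holder[OF holder_bound_Re(1)[OF assms]] measurable_holder[OF holder_bound_Re(2)[OF assms]] by simp
qed

lemma holder_bound_sector:
  assumes "holder_bound A \<theta> k b (f :: 's point \<Rightarrow> complex)" "0 \<le> b"
  shows "holder_bound A \<theta> k b (\<lambda>\<omega>. f \<omega> * indicator (sector j) \<omega>)"
  by (rule holder_bound_restrict[OF assms theta(1) sector_local])

lemma sector_integral_components: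
  assumes "holder_bound A \<theta> k b f" "0 \<le> b"
  shows "I (\<lambda>\<omega>. Re (f \<omega>) * indicator (sector j) \<omega>) = Re (sector_integral j f)"
    and "I (\<lambda>\<omega>. Im (f \<omega>) * indicator (sector j) \<omega>) = Im (sector_integral j f)"
proof -
  note i = holder_integrable_complex[OF holder_bound_sector[OF assms, of j]]
  have "Re (f \<omega>) * indicator (sector j) \<omega> = Re (f \<omega> * indicator (sector j) \<omega>)"
    "Im (f \<omega>) * indicator (sector j) \<omega> = Im (f \<omega> * indicator (sector j) \<omega>)" for \<omega>
    by (simp_all split: split_indicator)
  then show "I (\<lambda>\<omega>. Re (f \<omega>) * indicator (sector j) \<omega>) = Re (sector_integral j f)"
    and "I (\<lambda>\<omega>. Im (f \<omega>) * indicator (sector j) \<omega>) = Im (sector_integral j f)"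
    using integral_Re[OF i] integral_Im[OF i] by (simp_all add: sector_integral_def)
qed

lemma complex_decay:
  obtains C \<rho> where "0 \<le> C" "0 < \<rho>" "\<rho> < 1"
    "\<And>f b m. holder_bound A \<theta> k b f \<Longrightarrow> 0 \<le> b \<Longrightarrow> (\<And>j. j < p \<Longrightarrow> sector_integral j f = 0) \<Longrightarrow>
       holder_bound A \<theta> k (C * \<rho> ^ m * b) ((Lc ^^ m) f)"
proof -
  obtain C \<rho> where C: "0 \<le> C" and \<rho>: "0 < \<rho>" "\<rho> < 1"
    and dec: "\<And>w b i. holder_bound A \<theta> k b w \<Longrightarrow> 0 \<le> b \<Longrightarrow>
      (\<forall>j<p. I (\<lambda>\<omega>. w \<omega> * indicator (sector j) \<omega>) = 0) \<Longrightarrow> holder_bound A \<theta> k (C * \<rho> ^ i * b) ((T ^^ i) w)"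
    using decay by blast
  have "holder_bound A \<theta> k (2 * C * \<rho> ^ m * b) ((Lc ^^ m) f)"
    if f: "holder_bound A \<theta> k b f" "0 \<le> b" "\<And>j. j < p \<Longrightarrow> sector_integral j f = 0" for f b m
    using holder_bound_Lc_pow_components[OF f(2) holder_bound_imp_bounded_norm[OF f(1)]
        dec[OF holder_bound_Re(1)[OF f(1)] f(2), of m] dec[OF holder_bound_Re(2)[OF f(1)] f(2), of m]]
      sector_integral_components[OF f(1,2)] f(3) by (simp add: mult.assoc)
  then show ?thesis using that[of "2 * C" \<rho>] C \<rho> by simp
qed

lemma sector_integral_linear:
  assumes "holder_bound A \<theta> k b f" "0 \<le> b" "holder_bound A \<theta> k b' u" "0 \<le> b'"
  shows "sector_integral j (\<lambda>\<omega>. s * f \<omega> + t * u \<omega>) = s * sector_integral j f + t * sector_integral j u"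
  using holder_integrable_complex[OF holder_bound_sector[OF assms(1,2), of j]]
    holder_integrable_complex[OF holder_bound_sector[OF assms(3,4), of j]]
  by (simp add: sector_integral_def distrib_right mult.assoc)

lemma norm_sector_integral_le:
  assumes "holder_bound A \<theta> k b f" "0 \<le> b"
  shows "norm (sector_integral j f) \<le> b"
proof -
  note hb = holder_bound_sector[OF assms, of j]
  note i = holder_integrable_complex[OF hb]
  have "norm (sector_integral j f) \<le> (LINT \<omega>|\<nu>. norm (f \<omega> * indicator (sector j) \<omega>))"
    unfolding sector_integral_def by (rule integral_norm_bound)
  also have "\<dots> \<le> b"
    using i by (intro integral_le_const integrable_norm AE_I2) (simp_all only: space_nu holder_boundD(1)[OF hb])
  finally show ?thesis .
qed

text \<open>An allowed preimage lies in sector \<open>j\<close> exactly when the point lies in the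
  next sector, so the indicator can be taken out of the sum.\<close>

lemma Lc_sector:
  assumes "j < p" "\<omega> \<in> X"
  shows "Lc (\<lambda>\<omega>. f \<omega> * indicator (sector j) \<omega>) \<omega> = Lc f \<omega> * indicator (sector (Suc j mod p)) \<omega>"
proof -
  have "complex_of_real (exp (\<phi> (prepend a \<omega>))) * (f (prepend a \<omega>) * indicator (sector j) (prepend a \<omega>)) =
    complex_of_real (exp (\<phi> (prepend a \<omega>))) * f (prepend a \<omega>) * indicator (sector (Suc j mod p)) \<omega>"
    if "M a (\<omega> 0) = 1" for a
    using class_step[OF that assms(1)] by (simp add: sector_def indicator_def)
  then have "(\<Sum>\<^sub>\<infinity>a\<in>{a. M a (\<omega> 0) = 1}. complex_of_real (exp (\<phi> (prepend a \<omega>))) * (f (prepend a \<omega>) * indicator (sector j) (prepend a \<omega>))) =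
    (\<Sum>\<^sub>\<infinity>a\<in>{a. M a (\<omega> 0) = 1}. complex_of_real (exp (\<phi> (prepend a \<omega>))) * f (prepend a \<omega>) * indicator (sector (Suc j mod p)) \<omega>)"
    by (intro infsum_cong) simp
  then show ?thesis using assms(2) by (simp add: transfer_op_def infsum_cmult_left')
qed

text \<open>Invariance is assumed for this one function, because \<open>f\<close> will range over
  bounded continuous functions, beyond the Hoelder functions covered by the locale.\<close>

lemma sector_integral_step:
  assumes "j < p"
    and "(LINT \<omega>|\<nu>. Lc (\<lambda>\<omega>. f \<omega> * indicator (sector j) \<omega>) \<omega>) = (LINT \<omega>|\<nu>. f \<omega> * indicator (sector j) \<omega>)"
  shows "sector_integral (Suc j mod p) (Lc f) = sector_integral j f"
proof -
  have "sector_integral (Suc j mod p) (Lc f) = (LINT \<omega>|\<nu>. Lc (\<lambda>\<omega>. f \<omega> * indicator (sector j) \<omega>) \<omega>)"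
    unfolding sector_integral_def
    by (rule Bochner_Integration.integral_cong) (simp_all add: space_nu Lc_sector[OF assms(1)])
  then show ?thesis using assms(2) by (simp add: sector_integral_def)
qed

text \<open>The sectors partition \<open>X_M\<close>, which has full measure; on the rest of
  \<open>X\<close> the indicators need not sum to 1.\<close>

lemma sum_sector_integral:
  assumes "holder_bound A \<theta> k b f" "0 \<le> b"
  shows "(\<Sum>j<p. sector_integral j f) = (LINT \<omega>|\<nu>. f \<omega>)"
proof -
  have i: "integrable \<nu> (\<lambda>\<omega>. f \<omega> * indicator (sector j) \<omega>)" for j
    by (rule holder_integrable_complex[OF holder_bound_sector[OF assms]])
  have "(\<Sum>j<p. sector_integral j f) = (LINT \<omega>|\<nu>. (\<Sum>j<p. f \<omega> * indicator (sector j) \<omega>))"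
    unfolding sector_integral_def by (rule Bochner_Integration.integral_sum[symmetric]) (rule i)
  also have "\<dots> = (LINT \<omega>|\<nu>. f \<omega>)"
  proof (rule integral_cong_AE)
    show "AE \<omega> in \<nu>. (\<Sum>j<p. f \<omega> * indicator (sector j) \<omega>) = f \<omega>"
      using nu_support
    proof eventually_elim
      fix \<omega> assume "\<omega> \<in> XM"
      then have "\<omega> 0 \<in> S0" by (simp add: subshift_def)
      then have "complex_of_real (\<Sum>j<p. indicator (sector j) \<omega>) = 1" by (simp only: sum_sectors of_real_1)
      moreover have "complex_of_real (\<Sum>j<p. indicator (sector j) \<omega>) = (\<Sum>j<p. indicator (sector j) \<omega>)"
        unfolding of_real_sum by (rule sum.cong) (simp_all add: indicator_def)
      ultimately show "(\<Sum>j<p. f \<omega> * indicator (sector j) \<omega>) = f \<omega>"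
        by (simp only: sum_distrib_left[symmetric] mult_1_right)
    qed
    show "(\<lambda>\<omega>. \<Sum>j<p. f \<omega> * indicator (sector j) \<omega>) \<in> borel_measurable \<nu>"
      using i by (intro borel_measurable_sum) (rule borel_measurable_integrable)
    show "f \<in> borel_measurable \<nu>" by (rule borel_measurable_integrable[OF holder_integrable_complex[OF assms(1)]])
  qed
  finally show ?thesis .
qed

end

section \<open>Roots of unity\<close>

lemma root_kappa_pow: "root_kappa p ^ n = exp (2 * complex_of_real pi * \<i> * of_nat n / of_nat p)"
  by (simp add: root_kappa_def exp_of_nat_mult[symmetric] mult_ac)

lemma root_kappa_pow_eq: "0 < p \<Longrightarrow> root_kappa p ^ m = root_kappa p ^ n \<longleftrightarrow> m mod p = n mod p"
  unfolding root_kappa_pow by (rule complex_root_unity_eq) simp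

lemma root_kappa_nonzero: "root_kappa p \<noteq> 0"
  by (simp add: root_kappa_def)

lemma norm_root_kappa: "norm (root_kappa p) = 1"
  unfolding root_kappa_def norm_exp_eq_Re by simp

text \<open>A geometric sum over a \<open>p\<close>-th root of unity that equals 1 only for
  \<open>a = b\<close> in this range. Powers of the inverse stand in for negative exponents.\<close>

lemma root_kappa_orthogonal:
  assumes "a < p" "b < p"
  shows "(\<Sum>j<p. root_kappa p ^ (j * a) * inverse (root_kappa p) ^ (j * b)) = (if a = b then of_nat p else 0)"
proof -
  define w where "w = root_kappa p ^ a * inverse (root_kappa p) ^ b"
  have p: "0 < p" using assms by simp
  have summand: "root_kappa p ^ (j * a) * inverse (root_kappa p) ^ (j * b) = w ^ j" for j
    by (simp add: w_def power_mult_distrib mult.commute[of j] flip: power_mult)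
  show ?thesis
  proof (cases "a = b")
    case True
    then have "w = 1" using root_kappa_nonzero[of p] by (simp add: w_def flip: power_mult_distrib)
    then show ?thesis using True unfolding summand by simp
  next
    case False
    have "w \<noteq> 1"
    proof
      assume "w = 1"
      then have "root_kappa p ^ a = root_kappa p ^ b"
        using root_kappa_nonzero[of p] by (simp add: w_def power_inverse divide_eq_eq flip: divide_inverse)
      then show False using root_kappa_pow_eq[OF p] assms False by simp
    qed
    moreover have "w ^ p = 1"
    proof -
      have "root_kappa p ^ p = 1" using root_kappa_pow_eq[OF p, of p 0] by simp
      then have 1: "(root_kappa p ^ m) ^ p = 1" for m by (simp add: mult.commute[of m] power_mult flip: power_mult[of _ m])
      then show ?thesis by (simp add: w_def power_mult_distrib power_inverse)
    qed
    ultimately show ?thesis using False by (simp add: summand geometric_sum)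
  qed
qed

lemma sum_Suc_mod:
  fixes F :: "nat \<Rightarrow> 'b::comm_monoid_add"
  shows "(\<Sum>j<p. F (Suc j mod p)) = (\<Sum>j<p. F j)"
proof (cases p)
  case (Suc n)
  have "(\<Sum>j<Suc n. F (Suc j mod Suc n)) = (\<Sum>j<n. F (Suc j)) + F 0" by simp
  also have "\<dots> = (\<Sum>j<Suc n. F j)" by (simp only: sum.lessThan_Suc_shift add.commute)
  finally show ?thesis using Suc by simp
qed simp

section \<open>The cyclic decomposition\<close>

lemma class_cylinders_eq: "class_cylinders A D j = {\<omega> \<in> full_shift A. \<omega> 0 \<in> D j}"
  by (auto simp: class_cylinders_def cylinder_def)

lemma irreducible_successor:
  assumes "irreducible_matrix T B" "a \<in> T"
  shows "\<exists>b\<in>T. B a b = 1"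
proof -
  obtain n where "1 \<le> n" "path_of_length T B a a n" using assms unfolding irreducible_matrix_def by blast
  then obtain w where w: "length w = n + 1" "set w \<subseteq> T" "hd w = a" "\<forall>i<n. B (w ! i) (w ! Suc i) = 1" and n: "1 \<le> n"
    unfolding path_of_length_def by blast
  have "B (w ! 0) (w ! Suc 0) = 1" using w(4) n by simp
  moreover have "w ! 0 = a" using w(1,3) by (cases w) auto
  moreover have "w ! Suc 0 \<in> T" using w(1,2) n nth_mem[of "Suc 0" w] by auto
  ultimately show ?thesis by auto
qed

lemma irreducible_extend:
  assumes "irreducible_matrix T B" "b \<in> T"
  shows "\<exists>x\<in>subshift T B. x 0 = b"
proof -
  obtain s where s: "\<And>a. a \<in> T \<Longrightarrow> s a \<in> T \<and> B a (s a) = 1"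
    using irreducible_successor[OF assms(1)] by metis
  have T: "(s ^^ n) b \<in> T" for n by (induction n) (simp_all add: assms(2) s)
  then have "(\<lambda>n. (s ^^ n) b) \<in> subshift T B" by (simp add: subshift_def s)
  then show ?thesis by (intro bexI[of _ "\<lambda>n. (s ^^ n) b"]) simp_all
qed

text \<open>Forward, the image of a class under the shift is applied to a point of
  \<open>X_M\<close> that starts with \<open>a\<close> and \<open>b\<close>. Backward,
  \<open>a\<close> lies in some class \<open>j\<close>, and disjointness forces \<open>j + 1\<close>
  and \<open>i + 1\<close> to agree modulo \<open>p\<close>.\<close>

lemma cyclic_step:
  assumes dec: "cyclic_decomposition A \<theta> S0 M p D" and irr: "irreducible_matrix S0 M"
    and M_A: "\<And>a b. M a b = 1 \<Longrightarrow> A a b = 1" and M_S0: "\<And>a b. M a b = 1 \<Longrightarrow> a \<in> S0 \<and> b \<in> S0"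
    and ab: "M a b = 1" and i: "i < p"
  shows "a \<in> D i \<longleftrightarrow> b \<in> D (Suc i mod p)"
proof -
  have U: "(\<Union>i<p. D i) = S0" and disj: "disjoint_family_on D {..<p}"
    and sh: "\<And>i. i < p \<Longrightarrow> shift ` (subshift S0 M \<inter> class_cylinders A D i) = subshift S0 M \<inter> class_cylinders A D (Suc i mod p)"
    using dec by (simp_all add: cyclic_decomposition_def)
  obtain y where y: "y \<in> subshift S0 M" "y 0 = b" using irreducible_extend[OF irr] M_S0[OF ab] by blast
  have x: "prepend a y \<in> subshift S0 M"
    using y M_S0[OF ab] ab by (auto simp: subshift_def prepend_def split: nat.split)
  have fwd: "b \<in> D (Suc j mod p)" if "j < p" "a \<in> D j" for j
  proof -
    have "prepend a y \<in> full_shift A" using x M_A by (simp add: subshift_def)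
    then have "prepend a y \<in> subshift S0 M \<inter> class_cylinders A D j" using x that(2) by (simp add: class_cylinders_eq)
    then have "shift (prepend a y) \<in> subshift S0 M \<inter> class_cylinders A D (Suc j mod p)"
      unfolding sh[OF that(1), symmetric] by (rule imageI)
    then show ?thesis using y(2) by (simp add: class_cylinders_eq)
  qed
  show ?thesis
  proof
    assume b: "b \<in> D (Suc i mod p)"
    obtain j where j: "j < p" "a \<in> D j" using M_S0[OF ab] U by blast
    have "Suc j mod p = Suc i mod p"
    proof (rule ccontr)
      assume "Suc j mod p \<noteq> Suc i mod p"
      moreover have "Suc j mod p < p" "Suc i mod p < p" using i by simp_all
      ultimately have "D (Suc j mod p) \<inter> D (Suc i mod p) = {}" using disj by (simp add: disjoint_family_on_def)
      then show False using b fwd[OF j] by blast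
    qed
    then have "j = i" using i j(1) by (auto simp: mod_Suc split: if_splits)
    then show "a \<in> D i" using j(2) by simp
  qed (rule fwd[OF i])
qed

text \<open>The shift maps the preceding class onto the class of \<open>b\<close>, so a point of
  \<open>X_M\<close> that starts with \<open>b\<close> has a preimage in \<open>X_M\<close>.\<close>

lemma cyclic_predecessor:
  assumes dec: "cyclic_decomposition A \<theta> S0 M p D" and irr: "irreducible_matrix S0 M"
    and M_A: "\<And>a b. M a b = 1 \<Longrightarrow> A a b = 1" and b: "b \<in> S0"
  shows "\<exists>a. M a b = 1"
proof -
  have U: "(\<Union>i<p. D i) = S0"
    and sh: "\<And>i. i < p \<Longrightarrow> shift ` (subshift S0 M \<inter> class_cylinders A D i) = subshift S0 M \<inter> class_cylinders A D (Suc i mod p)"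
    using dec by (simp_all add: cyclic_decomposition_def)
  obtain y where y: "y \<in> subshift S0 M" "y 0 = b" using irreducible_extend[OF irr b] by blast
  obtain j where j: "j < p" "b \<in> D j" using b U by blast
  \<comment> \<open>\<open>j - 1\<close> modulo \<open>p\<close>; for \<open>j = 0\<close> the index
    wraps around to the last class.\<close>
  define i where "i = (if j = 0 then p - 1 else j - 1)"
  have i: "i < p" "Suc i mod p = j" using j(1) by (auto simp: i_def)
  have "y \<in> full_shift A" using y(1) M_A by (simp add: subshift_def)
  then have "y \<in> shift ` (subshift S0 M \<inter> class_cylinders A D i)"
    unfolding sh[OF i(1)] i(2) using y j(2) by (simp add: class_cylinders_eq)
  then obtain x where x: "x \<in> subshift S0 M" "y = shift x" by blast
  have "M (x 0) (x (Suc 0)) = 1" using x(1) by (simp add: subshift_def)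
  moreover have "x (Suc 0) = b" using x(2) y(2) by (simp add: shift_def)
  ultimately show ?thesis by blast
qed

text \<open>Topological mixing is applied to the traces of two \<open>k\<close>-cylinders on the
  class; they are open because a ball of radius \<open>\<theta> ^ k\<close> stays in one
  \<open>k\<close>-cylinder.\<close>

lemma cyclic_mixing:
  assumes dec: "cyclic_decomposition A \<theta> S0 M p D" and theta: "0 < \<theta>" "\<theta> < 1"
    and M_A: "\<And>a b. M a b = 1 \<Longrightarrow> A a b = 1" and i: "i < p"
    and x: "x \<in> subshift S0 M" "x 0 \<in> D i" and y: "y \<in> subshift S0 M" "y 0 \<in> D i"
  shows "\<exists>N. \<forall>n\<ge>N. \<exists>z\<in>subshift S0 M. agree k z x \<and> agree k ((shift ^^ (p * n)) z) y"
proof -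
  let ?Y = "subshift S0 M \<inter> class_cylinders A D i"
  let ?U = "\<lambda>x. ?Y \<inter> {z. agree k z x}"
  have mix: "topologically_mixing (subtopology (shift_topology A \<theta>) ?Y) (shift ^^ p)"
    using dec i by (simp add: cyclic_decomposition_def)
  have "openin (shift_topology A \<theta>) {z \<in> full_shift A. agree k z x}" for x
    unfolding openin_shift_topology[OF theta]
  proof (intro conjI ballI)
    fix \<omega> assume w: "\<omega> \<in> {z \<in> full_shift A. agree k z x}"
    have "\<upsilon> \<in> {z \<in> full_shift A. agree k z x}" if "\<upsilon> \<in> full_shift A" "dist_theta \<theta> \<omega> \<upsilon> < \<theta> ^ k" for \<upsilon>
      using that agree_trans[OF agree_sym[OF agree_if_close[OF theta that(2)]]] w by simp
    then show "\<exists>r>0. \<forall>\<upsilon>\<in>full_shift A. dist_theta \<theta> \<omega> \<upsilon> < r \<longrightarrow> \<upsilon> \<in> {z \<in> full_shift A. agree k z x}"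
      using theta by (intro exI[of _ "\<theta> ^ k"]) simp
  qed simp
  moreover have "?U x = ?Y \<inter> {z \<in> full_shift A. agree k z x}" for x by (auto simp: class_cylinders_eq)
  ultimately have op: "openin (subtopology (shift_topology A \<theta>) ?Y) (?U x)" for x
    by (simp add: openin_subtopology_Int2)
  have X: "z \<in> full_shift A" if "z \<in> subshift S0 M" for z using that M_A by (simp add: subshift_def)
  have "x \<in> ?U x" "y \<in> ?U y" using x y X by (simp_all add: class_cylinders_eq)
  then have ne: "?U x \<noteq> {}" "?U y \<noteq> {}" by blast+
  obtain N where N: "\<And>n. N \<le> n \<Longrightarrow> ((shift ^^ p) ^^ n) ` ?U x \<inter> ?U y \<noteq> {}"
    using mix op[of x] op[of y] ne unfolding topologically_mixing_def by blast
  have "\<exists>z\<in>subshift S0 M. agree k z x \<and> agree k ((shift ^^ (p * n)) z) y" if Nn: "N \<le> n" for n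
  proof -
    obtain z where "z \<in> ?U x" "((shift ^^ p) ^^ n) z \<in> ?U y" using N[OF Nn] by blast
    then show ?thesis by (intro bexI[of _ z]) (simp_all add: funpow_mult mult.commute)
  qed
  then show ?thesis by blast
qed

section \<open>Measurability and continuity\<close>

lemma openin_imp_measurable:
  assumes "0 < \<theta>" "\<theta> < 1" "sets \<nu> = sets (shift_borel A \<theta>)" "openin (shift_topology A \<theta>) U"
  shows "U \<in> sets \<nu>"
proof -
  have "{U. openin (shift_topology A \<theta>) U} \<subseteq> Pow (full_shift A)"
    using openin_shift_topology[OF assms(1,2)] by blast
  then show ?thesis using assms(3,4) unfolding shift_borel_def by (simp add: sets_measure_of sigma_sets.Basic)
qed

lemma holder_bound_measurable:
  fixes u :: "'s point \<Rightarrow> real"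
  assumes "0 < \<theta>" "\<theta> < 1" "space \<nu> = full_shift A" "sets \<nu> = sets (shift_borel A \<theta>)" "holder_bound A \<theta> k b u"
  shows "u \<in> borel_measurable \<nu>"
proof (rule borel_measurableI)
  fix S :: "real set" assume "open S"
  then have "openin (shift_topology A \<theta>) {x \<in> full_shift A. u x \<in> S}"
    using holder_bound_continuous[OF assms(1,2,5)]
    unfolding continuous_map_def topspace_shift_topology[OF assms(1,2)] by simp
  moreover have "{x \<in> full_shift A. u x \<in> S} = u -` S \<inter> space \<nu>" using assms(3) by blast
  ultimately show "u -` S \<inter> space \<nu> \<in> sets \<nu>" using openin_imp_measurable[OF assms(1,2,4)] by simp
qed

text \<open>A violation is visible in coordinates \<open>n\<close> and \<open>n + 1\<close>, hence
  shared by all points that agree on \<open>n + 2\<close> coordinates. Openness makes the complement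
  measurable, as the support condition on \<nu> requires.\<close>

lemma subshift_complement_open:
  assumes "0 < \<theta>" "\<theta> < 1"
  shows "openin (shift_topology A \<theta>) (full_shift A - subshift T B)"
  unfolding openin_shift_topology[OF assms]
proof (intro conjI ballI)
  fix \<omega> assume "\<omega> \<in> full_shift A - subshift T B"
  then obtain n where n: "\<omega> n \<notin> T \<or> B (\<omega> n) (\<omega> (Suc n)) \<noteq> 1" unfolding subshift_def by blast
  have "\<upsilon> \<in> full_shift A - subshift T B" if v: "\<upsilon> \<in> full_shift A" "dist_theta \<theta> \<omega> \<upsilon> < \<theta> ^ Suc (Suc n)" for \<upsilon>
  proof -
    have "agree (Suc (Suc n)) \<omega> \<upsilon>" by (rule agree_if_close[OF assms v(2)])
    then have "\<upsilon> n = \<omega> n" "\<upsilon> (Suc n) = \<omega> (Suc n)" by (simp_all add: agree_def)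
    then have "\<upsilon> n \<notin> T \<or> B (\<upsilon> n) (\<upsilon> (Suc n)) \<noteq> 1" using n by simp
    then have "\<upsilon> \<notin> subshift T B" by (auto simp: subshift_def)
    then show ?thesis using v(1) by simp
  qed
  then show "\<exists>r>0. \<forall>\<upsilon>\<in>full_shift A. dist_theta \<theta> \<omega> \<upsilon> < r \<longrightarrow> \<upsilon> \<in> full_shift A - subshift T B"
    using assms by (intro exI[of _ "\<theta> ^ Suc (Suc n)"]) simp
qed blast

text \<open>Used to cut a test function off to a sector before the eigenvalue equation for \<nu> is
  applied to it.\<close>

lemma bounded_cont_fun_indicator:
  assumes "0 < \<theta>" "\<theta> < 1" "f \<in> bounded_cont_fun A \<theta>"
    and loc: "\<And>\<omega> \<upsilon>. agree k \<omega> \<upsilon> \<Longrightarrow> \<omega> \<in> E \<longleftrightarrow> \<upsilon> \<in> E"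
  shows "(\<lambda>\<omega>. f \<omega> * indicator E \<omega>) \<in> bounded_cont_fun A \<theta>"
proof -
  have f: "continuous_map (shift_topology A \<theta>) euclidean f" "\<And>\<omega>. \<omega> \<notin> full_shift A \<Longrightarrow> f \<omega> = 0" "sup_norm A f < \<infinity>"
    using assms(3) by (auto simp: bounded_cont_fun_def cont_fun_def)
  have "continuous_map (shift_topology A \<theta>) euclidean (indicator E :: _ \<Rightarrow> complex)"
    by (rule holder_bound_continuous[OF assms(1,2) holder_bound_indicator[OF assms(1) loc]])
  then have "continuous_map (shift_topology A \<theta>) euclidean (\<lambda>\<omega>. f \<omega> * indicator E \<omega>)"
    using f(1) by (simp add: continuous_map_atin tendsto_mult)
  moreover have "sup_norm A (\<lambda>\<omega>. f \<omega> * indicator E \<omega>) < \<infinity>"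
  proof -
    have "sup_norm A (\<lambda>\<omega>. f \<omega> * indicator E \<omega>) \<le> ennreal (enn2real (sup_norm A f))"
    proof (rule sup_norm_le)
      fix \<omega> assume "\<omega> \<in> full_shift A"
      then show "norm (f \<omega> * indicator E \<omega>) \<le> enn2real (sup_norm A f)"
        using sup_norm_bound[OF f(3)] by (simp add: norm_mult split: split_indicator)
    qed
    then show ?thesis by (simp add: le_less_trans[OF _ ennreal_less_top])
  qed
  ultimately show ?thesis using f(2) by (simp add: bounded_cont_fun_def cont_fun_def)
qed

lemma holder_fun_subset: "holder_fun A \<theta> k \<subseteq> bounded_cont_fun A \<theta>"
  by (auto simp: holder_fun_def)

section \<open>Reduction to eigenvalue one\<close>

lemma holder_bound_of_real:
  assumes "holder_bound A \<theta> k b (u :: 's point \<Rightarrow> real)"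
  shows "holder_bound A \<theta> k b (\<lambda>\<omega>. complex_of_real (u \<omega>))"
  using holder_boundD[OF assms] by (intro holder_boundI) (simp_all flip: of_real_diff)

text \<open>Subtracting \<open>ln lam\<close> divides every weight by \<open>lam\<close>. If the
  family is not summable, both sums are 0 by convention.\<close>

lemma transfer_op_normalise:
  assumes "0 < (lam :: real)"
  shows "transfer_op A M \<phi> f = (\<lambda>\<omega>. complex_of_real lam * transfer_op A M (\<lambda>\<omega>. \<phi> \<omega> - ln lam) f \<omega>)"
proof
  fix \<omega>
  have "exp (\<phi> \<upsilon>) = lam * exp (\<phi> \<upsilon> - ln lam)" for \<upsilon> using assms by (simp add: exp_diff)
  then have "complex_of_real (exp (\<phi> \<upsilon>)) = complex_of_real lam * complex_of_real (exp (\<phi> \<upsilon> - ln lam))" for \<upsilon>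
    by (simp only: of_real_mult)
  then show "transfer_op A M \<phi> f \<omega> = complex_of_real lam * transfer_op A M (\<lambda>\<omega>. \<phi> \<omega> - ln lam) f \<omega>"
    by (simp add: transfer_op_def mult.assoc flip: infsum_cmult_right')
qed

lemma transfer_op_pow_normalise:
  assumes "0 < (lam :: real)"
  shows "(transfer_op A M \<phi> ^^ m) f = (\<lambda>\<omega>. complex_of_real lam ^ m * (transfer_op A M (\<lambda>\<omega>. \<phi> \<omega> - ln lam) ^^ m) f \<omega>)"
proof (induction m)
  case (Suc m)
  have scale: "transfer_op A M \<psi> (\<lambda>\<omega>. c * u \<omega>) \<omega> = c * transfer_op A M \<psi> u \<omega>" for \<psi> c u \<omega>
    by (simp add: transfer_op_def mult.left_commute flip: infsum_cmult_right')
  have "(transfer_op A M \<phi> ^^ Suc m) f = transfer_op A M \<phi> (\<lambda>\<omega>. complex_of_real lam ^ m * (transfer_op A M (\<lambda>\<omega>. \<phi> \<omega> - ln lam) ^^ m) f \<omega>)"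
    by (simp only: funpow.simps o_apply Suc)
  also have "\<dots> = (\<lambda>\<omega>. complex_of_real lam ^ Suc m * (transfer_op A M (\<lambda>\<omega>. \<phi> \<omega> - ln lam) ^^ Suc m) f \<omega>)"
    by (simp only: transfer_op_normalise[OF assms, of A M \<phi>] scale funpow.simps o_apply power_Suc mult.assoc)
  finally show ?case .
qed simp

text \<open>The bridge from cylinder suprema, topology and cyclic decomposition to the locale.
  Subtracting a constant leaves Lipschitz constants unchanged, so the seminorm of \<phi> itself
  serves as \<open>\<Phi>\<close>.\<close>

lemma normalised_system:
  fixes A M :: "'s::countable \<Rightarrow> 's \<Rightarrow> nat" and lam :: real
  assumes theta: "0 < \<theta>" "\<theta> < 1"
    and A_01: "zero_one_matrix A"
    and M_le_A: "\<And>i j. M i j \<le> A i j"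
    and M_off: "\<And>i j. i \<notin> S0 \<or> j \<notin> S0 \<Longrightarrow> M i j = 0"
    and k_ge_1: "k \<ge> 1"
    and A3_summable: "summable_potential A \<phi>"
    and A3_holder: "holder_seminorm A \<theta> (k + 1) \<phi> < \<infinity>"
    and M_irr: "irreducible_matrix S0 M"
    and D_dec: "cyclic_decomposition A \<theta> S0 M p D"
    and lam: "0 < lam"
    and \<nu>_prob: "prob_space \<nu>"
    and \<nu>_borel: "space \<nu> = full_shift A" "sets \<nu> = sets (shift_borel A \<theta>)"
    and \<nu>_supp: "emeasure \<nu> (full_shift A - subshift S0 M) = 0"
    and \<nu>_eigen: "\<And>f. f \<in> bounded_cont_fun A \<theta> \<Longrightarrow>
                   (LINT \<omega>|\<nu>. transfer_op A M \<phi> f \<omega>) = complex_of_real lam * (LINT \<omega>|\<nu>. f \<omega>)"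
  shows "\<exists>e. invariant_system A M \<theta> k (\<lambda>\<omega>. \<phi> \<omega> - ln lam)
           (enn2real (holder_seminorm A \<theta> (k + 1) \<phi>)) e \<nu> S0 D p"
proof
  let ?s = "\<lambda>a. exp (SUP \<omega>\<in>cylinder A [a]. \<phi> \<omega>)"
  \<comment> \<open>On an empty cylinder the real supremum is meaningless, but such a letter starts
    no point of \<open>X\<close>, so 0 is a majorant.\<close>
  let ?e = "\<lambda>a. if cylinder A [a] \<noteq> {} then 1 / lam * ?s a else 0"
  let ?\<phi> = "\<lambda>\<omega>. \<phi> \<omega> - ln lam"
  let ?\<Phi> = "enn2real (holder_seminorm A \<theta> (k + 1) \<phi>)"
  have M_A: "A a b = 1" if "M a b = 1" for a b
  proof -
    have "A a b \<in> {0, 1}" using A_01 by (simp add: zero_one_matrix_def)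
    then show ?thesis using M_le_A[of a b] that by auto
  qed
  have M_S0: "a \<in> S0 \<and> b \<in> S0" if "M a b = 1" for a b
    using M_off[of a b] that by fastforce
  have ts: "transfer_system A M \<theta> k ?\<phi> ?\<Phi> ?e"
  proof
    show "0 < \<theta>" "\<theta> < 1" "1 \<le> k" by (fact theta k_ge_1)+
    show "0 \<le> ?e a" for a using lam by simp
    have "(\<lambda>a. 1 / lam * ?s a) summable_on {s. cylinder A [s] \<noteq> {}}"
      using A3_summable unfolding summable_potential_def by (intro summable_on_cmult_right) blast
    also have "?this \<longleftrightarrow> ?e summable_on UNIV" by (rule summable_on_cong_neutral) auto
    finally show "?e summable_on UNIV" .
    show "exp (?\<phi> \<omega>) \<le> ?e (\<omega> 0)" if "\<omega> \<in> full_shift A" for \<omega>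
    proof -
      have w: "\<omega> \<in> cylinder A [\<omega> 0]" using that by (simp add: cylinder_def)
      have "\<phi> \<omega> \<le> (SUP \<omega>\<in>cylinder A [\<omega> 0]. \<phi> \<omega>)"
        by (rule cSUP_upper[OF w]) (use A3_summable in \<open>simp add: summable_potential_def\<close>)
      then have "exp (\<phi> \<omega>) / lam \<le> ?s (\<omega> 0) / lam" using lam by (intro divide_right_mono) simp_all
      then show ?thesis using w lam by (auto simp: exp_diff)
    qed
    show "?\<phi> \<omega> - ?\<phi> \<upsilon> \<le> ?\<Phi> * dist_theta \<theta> \<omega> \<upsilon>"
      if "\<omega> \<in> full_shift A" "\<upsilon> \<in> full_shift A" "agree (Suc k) \<omega> \<upsilon>" for \<omega> \<upsilon>
      using holder_seminorm_bound[OF theta A3_holder that(1,2)] that(3) by (simp add: Suc_eq_plus1)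
  qed (use M_A in simp_all)
  have real_eigen: "(LINT \<omega>|\<nu>. real_transfer A M ?\<phi> u \<omega>) = (LINT \<omega>|\<nu>. u \<omega>)" if u: "holder_bound A \<theta> k b u" for b u
  proof (cases "full_shift A = {}")
    case True
    then show ?thesis using \<nu>_prob \<nu>_borel(1) prob_space.not_empty by blast
  next
    case False
    then have b: "0 \<le> b" using transfer_system.holder_bound_nonneg[OF ts u] by blast
    \<comment> \<open>Members of the function spaces vanish off \<open>X\<close>, while
      \<open>u\<close> is arbitrary there.\<close>
    define f where "f \<omega> = (if \<omega> \<in> full_shift A then complex_of_real (u \<omega>) else 0)" for \<omega>
    have hf: "holder_bound A \<theta> k b f"
      using holder_bound_of_real[OF u] holder_bound_cong[of A f "\<lambda>\<omega>. complex_of_real (u \<omega>)"] by (simp add: f_def)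
    have "f \<in> holder_fun A \<theta> k"
      unfolding holder_fun_iff[OF theta] using hf b by (intro conjI exI[of _ b]) (simp_all add: f_def)
    then have "f \<in> bounded_cont_fun A \<theta>" using holder_fun_subset by blast
    from \<nu>_eigen[OF this] have "(LINT \<omega>|\<nu>. transfer_op A M ?\<phi> f \<omega>) = (LINT \<omega>|\<nu>. f \<omega>)"
      unfolding transfer_op_normalise[OF lam, of A M \<phi>] using lam by simp
    moreover have "transfer_op A M ?\<phi> f \<omega> = complex_of_real (real_transfer A M ?\<phi> u \<omega>)" if w: "\<omega> \<in> full_shift A" for \<omega>
    proof (rule complex_eqI)
      note comp = transfer_system.Lc_components[OF ts transfer_system.holder_bound_imp_bounded_norm[OF ts hf], of \<omega>]
      have "real_transfer A M ?\<phi> (\<lambda>\<omega>. Re (f \<omega>)) = real_transfer A M ?\<phi> u"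
        by (rule transfer_system.T_cong[OF ts]) (simp add: f_def)
      then show "Re (transfer_op A M ?\<phi> f \<omega>) = Re (complex_of_real (real_transfer A M ?\<phi> u \<omega>))" using comp(1) by simp
      have "real_transfer A M ?\<phi> (\<lambda>\<omega>. Im (f \<omega>)) \<omega> = 0"
      proof -
        have "(\<lambda>\<omega>. Im (f \<omega>)) = (\<lambda>\<omega>. 0)" by (auto simp: f_def)
        then show ?thesis by (simp add: real_transfer_def)
      qed
      then show "Im (transfer_op A M ?\<phi> f \<omega>) = Im (complex_of_real (real_transfer A M ?\<phi> u \<omega>))" using comp(2) by simp
    qed
    then have "(LINT \<omega>|\<nu>. transfer_op A M ?\<phi> f \<omega>) = (LINT \<omega>|\<nu>. complex_of_real (real_transfer A M ?\<phi> u \<omega>))"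
      by (intro Bochner_Integration.integral_cong) (simp_all add: \<nu>_borel(1))
    moreover have "(LINT \<omega>|\<nu>. f \<omega>) = (LINT \<omega>|\<nu>. complex_of_real (u \<omega>))"
      by (intro Bochner_Integration.integral_cong) (simp_all add: \<nu>_borel(1) f_def)
    ultimately show ?thesis by simp
  qed
  have supp: "AE \<omega> in \<nu>. \<omega> \<in> subshift S0 M"
  proof (rule AE_I)
    show "{\<omega> \<in> space \<nu>. \<not> \<omega> \<in> subshift S0 M} \<subseteq> full_shift A - subshift S0 M" using \<nu>_borel(1) by blast
    show "full_shift A - subshift S0 M \<in> sets \<nu>"
      by (rule openin_imp_measurable[OF theta \<nu>_borel(2) subshift_complement_open[OF theta]])
  qed (rule \<nu>_supp)
  have classes: "(\<Union>i<p. D i) = S0" "disjoint_family_on D {..<p}"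
    using D_dec by (simp_all add: cyclic_decomposition_def)
  show "invariant_system A M \<theta> k ?\<phi> ?\<Phi> ?e \<nu> S0 D p"
  proof (intro invariant_system.intro ts \<nu>_prob invariant_system_axioms.intro)
    show "a \<in> D i \<longleftrightarrow> b \<in> D (Suc i mod p)" if "M a b = 1" "i < p" for a b i
      by (rule cyclic_step[OF D_dec M_irr M_A M_S0 that])
    show "\<exists>N. \<forall>n\<ge>N. \<exists>z\<in>subshift S0 M. agree k z x \<and> agree k ((shift ^^ (p * n)) z) y"
      if "i < p" "x \<in> subshift S0 M" "x 0 \<in> D i" "y \<in> subshift S0 M" "y 0 \<in> D i" for i x y
      by (rule cyclic_mixing[OF D_dec theta M_A that])
    show "\<exists>a. M a b = 1" if "b \<in> S0" for b
      by (rule cyclic_predecessor[OF D_dec M_irr M_A that])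
  qed (fact \<nu>_borel(1) holder_bound_measurable[OF theta \<nu>_borel] supp real_eigen M_S0
        irreducible_extend[OF M_irr] classes)+
qed

section \<open>Peripheral eigendata of the transfer operator\<close>

theorem theorem3p4:
  fixes A M :: "'s::countable \<Rightarrow> 's \<Rightarrow> nat"
    and S0 :: "'s set"
    and D :: "nat \<Rightarrow> 's set"
    and \<phi> :: "(nat \<Rightarrow> 's) \<Rightarrow> real"
    and \<theta> lam :: real
    and k p :: nat
    and g h :: "(nat \<Rightarrow> 's) \<Rightarrow> complex"
    and \<nu> :: "(nat \<Rightarrow> 's) measure"
    and \<kappa> :: complex
    and hs :: "nat \<Rightarrow> (nat \<Rightarrow> 's) \<Rightarrow> complex"
    and \<nu>s :: "nat \<Rightarrow> ((nat \<Rightarrow> 's) \<Rightarrow> complex) \<Rightarrow> complex"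
    and V :: "((nat \<Rightarrow> 's) \<Rightarrow> complex) set"
    and N :: "((nat \<Rightarrow> 's) \<Rightarrow> complex) \<Rightarrow> ennreal"
    and L :: "((nat \<Rightarrow> 's) \<Rightarrow> complex) \<Rightarrow> (nat \<Rightarrow> 's) \<Rightarrow> complex"
    and Pr :: "nat \<Rightarrow> ((nat \<Rightarrow> 's) \<Rightarrow> complex) \<Rightarrow> (nat \<Rightarrow> 's) \<Rightarrow> complex"
  assumes theta: "0 < \<theta>" "\<theta> < 1"
    and A_01: "zero_one_matrix A"
    and M_01: "zero_one_matrix M"
    and S0_ne: "S0 \<noteq> {}"
    and M_le_A: "\<And>i j. M i j \<le> A i j"
    and M_off: "\<And>i j. i \<notin> S0 \<or> j \<notin> S0 \<Longrightarrow> M i j = 0"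
    and A1: "irreducible_matrix UNIV A"
    and A2: "\<exists>\<omega>\<in>subshift S0 M. \<exists>n\<ge>1. (shift ^^ n) \<omega> = \<omega>"
    and k_ge_1: "k \<ge> 1"
    and A3_summable: "summable_potential A \<phi>"
    and A3_holder: "holder_seminorm A \<theta> (k + 1) \<phi> < \<infinity>"
    and M_irr: "irreducible_matrix S0 M"
    and p_def: "p = matrix_period S0 M"
    and \<kappa>_def: "\<kappa> = root_kappa p"
    and D_dec: "cyclic_decomposition A \<theta> S0 M p D"
    and V_def: "V = holder_fun A \<theta> k"
    and N_def: "N = holder_norm A \<theta> k"
    and L_def: "L = transfer_op A M \<phi>"
    and lam_pressure: "lam = exp (pressure A S0 M \<phi>)"
    and lam_radius: "spectral_radius V N L = ennreal lam"
    and g_cone: "g \<in> log_lipschitz_cone A \<theta> k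
                   (enn2real (holder_seminorm A \<theta> (k + 1) \<phi>) * \<theta> / (1 - \<theta>))"
    and g_norm: "sup_norm A g = 1"
    and g_eigen: "L g = (\<lambda>\<omega>. complex_of_real lam * g \<omega>)"
    and \<nu>_prob: "prob_space \<nu>"
    and \<nu>_borel: "space \<nu> = full_shift A" "sets \<nu> = sets (shift_borel A \<theta>)"
    and \<nu>_supp: "emeasure \<nu> (full_shift A - subshift S0 M) = 0"
    and \<nu>_eigen: "\<And>f. f \<in> bounded_cont_fun A \<theta> \<Longrightarrow>
                   (LINT \<omega>|\<nu>. L f \<omega>) = complex_of_real lam * (LINT \<omega>|\<nu>. f \<omega>)"
    and h_def: "h = (\<lambda>\<omega>. g \<omega> / (LINT \<omega>'|\<nu>. g \<omega>'))"
    and hs_def: "hs = peripheral_eigenfun A D p h"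
    and \<nu>s_def: "\<nu>s = peripheral_eigenmeasure A D p \<nu>"
    and Pr_def: "Pr = (\<lambda>i. tensor_op (hs i) (\<nu>s i))"
  shows "\<exists>R. bounded_operator V N R \<and>
           (\<forall>f\<in>V. L f = (\<lambda>\<omega>. (\<Sum>i<p. complex_of_real lam * \<kappa> ^ i * Pr i f \<omega>) + R f \<omega>)) \<and>
           (\<forall>i<p. simple_eigenvalue V L (complex_of_real lam * \<kappa> ^ i) \<and>
                  projection_operator V N (Pr i) \<and>
                  eigenfunction V L (complex_of_real lam * \<kappa> ^ i) (hs i) \<and>
                  dual_eigenvector (bounded_cont_fun A \<theta>) L (complex_of_real lam * \<kappa> ^ i) (\<nu>s i) \<and>
                  (\<forall>f\<in>V. R (Pr i f) = (\<lambda>\<omega>. 0) \<and> Pr i (R f) = (\<lambda>\<omega>. 0)) \<and>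
                  (\<forall>j<p. j \<noteq> i \<longrightarrow> (\<forall>f\<in>V. Pr i (Pr j f) = (\<lambda>\<omega>. 0)))) \<and>
           spectral_radius V N R < ennreal lam"
proof -
  define \<Phi> where "\<Phi> = enn2real (holder_seminorm A \<theta> (k + 1) \<phi>)"
  \<comment> \<open>For this potential \<nu> is invariant and \<open>g\<close> is a fixed function
    of the operator.\<close>
  define \<psi> where "\<psi> = (\<lambda>\<omega>. \<phi> \<omega> - ln lam)"
  have lam: "0 < lam" by (simp add: lam_pressure)
  have \<nu>_eigen': "(LINT \<omega>|\<nu>. transfer_op A M \<phi> f \<omega>) = complex_of_real lam * (LINT \<omega>|\<nu>. f \<omega>)"
    if "f \<in> bounded_cont_fun A \<theta>" for f using \<nu>_eigen[OF that] by (simp only: L_def)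
  have "\<exists>e. invariant_system A M \<theta> k \<psi> \<Phi> e \<nu> S0 D p"
    unfolding \<Phi>_def \<psi>_def
    by (rule normalised_system[OF theta A_01 M_le_A M_off k_ge_1 A3_summable A3_holder M_irr D_dec lam
        \<nu>_prob \<nu>_borel \<nu>_supp \<nu>_eigen'])
  then obtain e where "invariant_system A M \<theta> k \<psi> \<Phi> e \<nu> S0 D p" by (elim exE)
  then interpret S: invariant_system A M \<theta> k \<psi> \<Phi> e \<nu> S0 D p .
  interpret H: holder_space A \<theta> k by unfold_locales (fact theta)+
  let ?X = "full_shift A" and ?T = "transfer_op A M \<psi>"
  have VH: "V = H.V" and NH: "N = H.N" by (simp_all add: V_def N_def)
  have L_T: "L f = (\<lambda>\<omega>. complex_of_real lam * ?T f \<omega>)" for f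
    unfolding L_def \<psi>_def by (rule transfer_op_normalise[OF lam])
  have L_pow: "(L ^^ m) f = (\<lambda>\<omega>. complex_of_real lam ^ m * (?T ^^ m) f \<omega>)" for m f
    unfolding L_def \<psi>_def by (rule transfer_op_pow_normalise[OF lam])
  have ind: "indicator (class_cylinders A D j) \<omega> = (indicator (S.sector j) \<omega> :: complex)" if "\<omega> \<in> ?X" for j \<omega>
    using that by (simp add: class_cylinders_eq S.sector_def indicator_def)
  have p: "0 < p" by (rule S.p_pos)

  have g0: "\<And>\<omega>. \<omega> \<notin> ?X \<Longrightarrow> g \<omega> = 0" and g_real: "\<And>\<omega>. \<omega> \<in> ?X \<Longrightarrow> g \<omega> \<in> \<real>\<^sub>\<ge>\<^sub>0"
    and g_cone': "\<And>\<omega> \<upsilon>. \<omega> \<in> ?X \<Longrightarrow> \<upsilon> \<in> ?X \<Longrightarrow> agree k \<omega> \<upsilon> \<Longrightarrow>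
      Re (g \<omega>) \<le> exp (\<Phi> * \<theta> / (1 - \<theta>) * dist_theta \<theta> \<omega> \<upsilon>) * Re (g \<upsilon>)"
    using g_cone by (simp_all add: log_lipschitz_cone_def cont_fun_def agree_def \<Phi>_def)
  define u where "u = (\<lambda>\<omega>. Re (g \<omega>))"
  have gu: "g \<omega> = complex_of_real (u \<omega>)" "0 \<le> u \<omega>" for \<omega>
    using g0[of \<omega>] g_real[of \<omega>] by (cases "\<omega> \<in> ?X"; simp add: u_def complex_nonneg_Reals_iff complex_eq_iff)+
  have "S.cone S.c1 u"
    using g_cone' gu(2) by (simp add: S.cone_def S.c1_def u_def)
  then have u_cone: "S.cone (S.c1 + 1) u" by (rule S.cone_mono) simp
  have u_bd: "S.bounded_by 1 u"
  proof (rule S.bounded_byI)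
    fix \<omega> assume w: "\<omega> \<in> ?X"
    show "\<bar>u \<omega>\<bar> \<le> 1" using sup_norm_bound[of A g \<omega>] w by (simp add: g_norm gu(1))
  qed
  note u_hb = S.cone_holder[OF u_cone u_bd]
  define Cu where "Cu = (1 + (S.c1 + 1) * exp (S.c1 + 1)) * 1"
  have Cu: "0 \<le> Cu" using S.c1_nonneg by (simp add: Cu_def)
  have g_hb: "holder_bound A \<theta> k Cu g"
    using holder_bound_of_real[OF u_hb] unfolding Cu_def gu(1)[symmetric] .
  have Tg: "?T g = g"
  proof
    fix \<omega>
    have "complex_of_real lam * ?T g \<omega> = complex_of_real lam * g \<omega>" using fun_cong[OF g_eigen, of \<omega>] by (simp only: L_T)
    then show "?T g \<omega> = g \<omega>" using lam by simp
  qed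
  have Tu: "real_transfer A M \<psi> u = u"
  proof
    fix \<omega>
    have "real_transfer A M \<psi> u \<omega> = Re (?T g \<omega>)"
      unfolding u_def by (rule S.Lc_components(1)[OF S.holder_bound_imp_bounded_norm[OF g_hb], symmetric])
    then show "real_transfer A M \<psi> u \<omega> = u \<omega>" by (simp only: Tg u_def)
  qed
  have Tu_pow: "(real_transfer A M \<psi> ^^ m) u = u" for m by (induction m) (simp_all add: Tu)
  \<comment> \<open>If the integral were 0, the drift estimate with factor 1/2, applied to the fixed
    function \<open>u\<close>, would bound its sup by 1/2, whereas the sup is 1.\<close>
  have Iu: "0 < S.I u"
  proof (rule ccontr)
    assume "\<not> 0 < S.I u"
    moreover have "0 \<le> S.I u" by (rule S.I_nonneg) (rule gu(2))
    ultimately have Iu0: "S.I u = 0" by simp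
    have "0 < (1/2 :: real)" by simp
    from S.lyapunov[OF this] obtain K where
      K: "\<And>v b \<omega>. S.cone (S.c1 + 1) v \<Longrightarrow> S.bounded_by b v \<Longrightarrow> \<omega> \<in> ?X \<Longrightarrow>
        (real_transfer A M \<psi> ^^ k) v \<omega> \<le> 1/2 * b + K * S.I v" by blast
    have "sup_norm A g \<le> ennreal (1/2)"
      by (rule sup_norm_le) (use K[OF u_cone u_bd] in \<open>simp add: Tu_pow Iu0 gu\<close>)
    then have "ennreal 1 \<le> ennreal (1/2)" by (simp only: g_norm ennreal_1)
    then have "(1::real) \<le> 1/2" by (subst (asm) ennreal_le_iff) simp_all
    then show False by simp
  qed
  have "(LINT \<omega>|\<nu>. g \<omega>) = complex_of_real (S.I u)"
    unfolding gu(1) by (rule integral_of_real) (rule S.holder_integrable[OF u_hb])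
  then have h_g: "h = (\<lambda>\<omega>. complex_of_real (inverse (S.I u)) * g \<omega>)"
    by (simp add: h_def divide_inverse mult.commute)
  define Ch where "Ch = norm (complex_of_real (inverse (S.I u))) * Cu"
  have h_hb: "holder_bound A \<theta> k Ch h" and Ch: "0 \<le> Ch"
    unfolding h_g Ch_def using holder_bound_scale[OF g_hb] Cu by simp_all
  have h_V: "h \<in> H.V" by (rule H.V_I[OF _ Ch h_hb]) (simp add: h_g g0)
  have h_int: "(LINT \<omega>|\<nu>. h \<omega>) = 1"
    using \<open>(LINT \<omega>|\<nu>. g \<omega>) = complex_of_real (S.I u)\<close> Iu by (simp add: h_g)

  have T_lin: "H.linear_V ?T"
    unfolding H.linear_V_def
  proof (intro conjI ballI allI)
    fix f assume f: "f \<in> H.V"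
    obtain b where b: "0 \<le> b" "holder_bound A \<theta> k b f" using H.V_E[OF f] .
    show "?T f \<in> H.V"
      by (rule H.V_I[OF _ _ S.holder_bound_Lc[OF b(2,1)]])
        (use S.E_ge_1 S.Phi_nonneg b(1) in \<open>simp_all add: transfer_op_def\<close>)
    fix v s t assume v: "v \<in> H.V"
    obtain b' where b': "0 \<le> b'" "holder_bound A \<theta> k b' v" using H.V_E[OF v] .
    show "?T (\<lambda>\<omega>. s * f \<omega> + t * v \<omega>) = (\<lambda>\<omega>. s * ?T f \<omega> + t * ?T v \<omega>)"
      by (rule ext) (rule S.Lc_linear[OF S.holder_bound_imp_bounded_norm[OF b(2)] S.holder_bound_imp_bounded_norm[OF b'(2)]])
  qed
  have Th: "?T h = h" 
  proof -
    have "g \<in> H.V" by (rule H.V_I[OF g0 Cu g_hb])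
    then show ?thesis unfolding h_g by (simp add: H.linear_V_scale[OF T_lin] Tg)
  qed

  have inv: "(LINT \<omega>|\<nu>. ?T (\<lambda>\<omega>. f \<omega> * indicator (S.sector j) \<omega>) \<omega>) = (LINT \<omega>|\<nu>. f \<omega> * indicator (S.sector j) \<omega>)"
    if "f \<in> bounded_cont_fun A \<theta>" for f j
    using \<nu>_eigen[OF bounded_cont_fun_indicator[where k = k and E = "S.sector j", OF theta that S.sector_local]] lam
    unfolding L_T by simp
  have V_cont: "f \<in> bounded_cont_fun A \<theta>" if "f \<in> H.V" for f using that holder_fun_subset by blast
  have s_step: "S.sector_integral (Suc j mod p) (?T f) = S.sector_integral j f"
    if "j < p" "f \<in> bounded_cont_fun A \<theta>" for j f
    by (rule S.sector_integral_step[OF that(1) inv[OF that(2)]])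
  have s_h: "S.sector_integral j h = 1 / of_nat p" if "j < p" for j
  proof -
    \<comment> \<open>As \<open>h\<close> is fixed by the operator, its integral passes unchanged
      from each sector to the next, so \<open>p\<close> equal numbers add up to 1.\<close>
    have eq: "S.sector_integral j h = S.sector_integral 0 h" if "j < p" for j
      using that
    proof (induction j)
      case (Suc j)
      then show ?case using s_step[of j h] V_cont[OF h_V] by (simp add: Th)
    qed simp
    have "(\<Sum>j<p. S.sector_integral j h) = (\<Sum>j<p. S.sector_integral 0 h)"
      by (intro sum.cong refl eq) simp
    then have "of_nat p * S.sector_integral 0 h = 1"
      using S.sum_sector_integral[OF h_hb Ch] h_int by simp
    then show ?thesis using p eq[OF that] by (simp add: field_simps)
  qed

  \<comment> \<open>Integration over the restricted space is rewritten with an indicator; the sector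
    is measurable because its indicator is Hoelder.\<close>
  have \<nu>s_eq: "\<nu>s i f = (\<Sum>j<p. root_kappa p ^ (j * i) * S.sector_integral j f)" for i f
  proof -
    have "(LINT \<omega>|restrict_space \<nu> (class_cylinders A D j). f \<omega>) = S.sector_integral j f" for j
    proof -
      have "class_cylinders A D j \<inter> space \<nu> = S.sector j \<inter> space \<nu>"
        by (auto simp: class_cylinders_eq S.sector_def \<nu>_borel(1))
      also have "\<dots> = (indicator (S.sector j) :: _ \<Rightarrow> real) -` {1} \<inter> space \<nu>" by (auto simp: indicator_def)
      also have "\<dots> \<in> sets \<nu>"
        by (rule measurable_sets[OF S.measurable_holder[OF S.holder_indicator_sector]]) simp
      finally have "(LINT \<omega>|restrict_space \<nu> (class_cylinders A D j). f \<omega>) =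
          (LINT \<omega>|\<nu>. indicator (class_cylinders A D j) \<omega> *\<^sub>R f \<omega>)"
        by (rule integral_restrict_space)
      also have "\<dots> = S.sector_integral j f"
        unfolding S.sector_integral_def
        by (rule Bochner_Integration.integral_cong)
          (simp_all add: \<nu>_borel(1) class_cylinders_eq S.sector_def indicator_def)
      finally show ?thesis .
    qed
    then show ?thesis by (simp add: \<nu>s_def peripheral_eigenmeasure_def)
  qed
  \<comment> \<open>Off \<open>X\<close> both sides vanish together with \<open>h\<close>, so class
    cylinders may be replaced by sectors.\<close>
  have hs_eq: "hs i = (\<lambda>\<omega>. \<Sum>j<p. inverse (root_kappa p) ^ (j * i) * (h \<omega> * indicator (S.sector j) \<omega>))" for i
  proof
    fix \<omega>
    have summand: "root_kappa p powi (- int (j * i)) * h \<omega> * indicator (class_cylinders A D j) \<omega> =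
      inverse (root_kappa p) ^ (j * i) * (h \<omega> * indicator (S.sector j) \<omega>)" for j
      by (cases "\<omega> \<in> ?X") (simp_all add: ind power_int_minus power_inverse h_g g0 mult.assoc del: of_nat_mult)
    then show "hs i \<omega> = (\<Sum>j<p. inverse (root_kappa p) ^ (j * i) * (h \<omega> * indicator (S.sector j) \<omega>))"
      unfolding hs_def peripheral_eigenfun_def by (intro sum.cong refl summand)
  qed
  \<comment> \<open>Since the \<open>p\<close>-th power of the root is 1, exponents count modulo
    \<open>p\<close>: a factor \<open>root_kappa p ^ i\<close> rotates the coefficient index by
    one.\<close>
  have kappa_step: "root_kappa p ^ (j * i) * root_kappa p ^ i = root_kappa p ^ ((Suc j mod p) * i)" for i j
  proof -
    have "root_kappa p ^ ((Suc j mod p) * i) = root_kappa p ^ (Suc j * i)"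
      unfolding root_kappa_pow_eq[OF p] by (simp add: mod_mult_left_eq)
    then show ?thesis by (simp add: power_add mult.commute)
  qed
  have hj_V: "(\<lambda>\<omega>. h \<omega> * indicator (S.sector j) \<omega>) \<in> H.V" for j
    by (rule H.V_I[OF _ Ch S.holder_bound_sector[OF h_hb Ch]]) (simp add: H.V_zero[OF h_V])
  have hs_V: "hs i \<in> H.V" for i
    unfolding hs_eq by (rule H.V_sum) (simp_all add: H.V_scale hj_V)
  \<comment> \<open>The operator moves the part of \<open>h\<close> in one sector to the next;
    re-indexing the coefficients produces the eigenvalue.\<close>
  have T_hs: "?T (hs i) = (\<lambda>\<omega>. root_kappa p ^ i * hs i \<omega>)" for i
  proof
    fix \<omega>
    show "?T (hs i) \<omega> = root_kappa p ^ i * hs i \<omega>"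
    proof (cases "\<omega> \<in> ?X")
      case False
      then show ?thesis by (simp add: transfer_op_def H.V_zero[OF hs_V])
    next
      case True
      let ?c = "\<lambda>j. inverse (root_kappa p) ^ (j * i)" and ?f = "\<lambda>j \<omega>. h \<omega> * indicator (S.sector j) \<omega>"
      have c: "?c j = root_kappa p ^ i * ?c (Suc j mod p)" for j
        using kappa_step[of j i] root_kappa_nonzero[of p] by (simp add: power_inverse field_simps)
      have "?T (hs i) \<omega> = (\<Sum>j<p. ?T (\<lambda>\<omega>. ?c j * ?f j \<omega>) \<omega>)"
        unfolding hs_eq using H.linear_V_sum[OF T_lin, of "{..<p}" "\<lambda>j \<omega>. ?c j * ?f j \<omega>"] by (simp add: H.V_scale hj_V)
      also have "\<dots> = (\<Sum>j<p. ?c j * ?T (?f j) \<omega>)"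
        by (simp add: H.linear_V_scale[OF T_lin hj_V])
      also have "\<dots> = (\<Sum>j<p. root_kappa p ^ i * (?c (Suc j mod p) * ?f (Suc j mod p) \<omega>))"
      proof (rule sum.cong)
        fix j assume "j \<in> {..<p}"
        then have "?T (?f j) \<omega> = ?f (Suc j mod p) \<omega>" using S.Lc_sector[OF _ True, of j h] by (simp add: Th)
        then show "?c j * ?T (?f j) \<omega> = root_kappa p ^ i * (?c (Suc j mod p) * ?f (Suc j mod p) \<omega>)"
          by (subst c) (simp only: mult.assoc)
      qed simp
      also have "\<dots> = root_kappa p ^ i * hs i \<omega>"
        using sum_Suc_mod[of "\<lambda>j. ?c j * ?f j \<omega>" p] unfolding hs_eq by (simp add: sum_distrib_left[symmetric])
      finally show ?thesis .
    qed
  qed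
  have \<nu>s_T: "\<nu>s i (?T f) = root_kappa p ^ i * \<nu>s i f" if f: "f \<in> bounded_cont_fun A \<theta>" for i f
  proof -
    have "\<nu>s i (?T f) = (\<Sum>j<p. root_kappa p ^ ((Suc j mod p) * i) * S.sector_integral (Suc j mod p) (?T f))"
      unfolding \<nu>s_eq by (rule sum_Suc_mod[symmetric])
    also have "\<dots> = (\<Sum>j<p. root_kappa p ^ i * (root_kappa p ^ (j * i) * S.sector_integral j f))"
    proof (rule sum.cong[OF refl])
      fix j assume "j \<in> {..<p}"
      then have s: "S.sector_integral (Suc j mod p) (?T f) = S.sector_integral j f" using s_step[OF _ f] by simp
      show "root_kappa p ^ ((Suc j mod p) * i) * S.sector_integral (Suc j mod p) (?T f) =
          root_kappa p ^ i * (root_kappa p ^ (j * i) * S.sector_integral j f)"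
        unfolding s kappa_step[symmetric] by (simp only: mult_ac)
    qed
    finally show ?thesis by (simp add: \<nu>s_eq sum_distrib_left)
  qed
  have \<nu>s_L: "\<nu>s i (L f) = complex_of_real lam * root_kappa p ^ i * \<nu>s i f" if f: "f \<in> bounded_cont_fun A \<theta>" for i f
  proof -
    have "S.sector_integral j (L f) = complex_of_real lam * S.sector_integral j (?T f)" for j
      unfolding L_T S.sector_integral_def by (simp add: mult.assoc)
    then have "\<nu>s i (L f) = complex_of_real lam * \<nu>s i (?T f)"
      by (simp add: \<nu>s_eq sum_distrib_left mult.left_commute)
    then show ?thesis by (simp add: \<nu>s_T[OF f])
  qed
  have s_hs: "S.sector_integral j (hs r) = inverse (root_kappa p) ^ (j * r) * (1 / of_nat p)" if j: "j < p" for j r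
  proof -
    have eq: "hs r \<omega> * indicator (S.sector j) \<omega> = inverse (root_kappa p) ^ (j * r) * (h \<omega> * indicator (S.sector j) \<omega>)" for \<omega>
    proof (cases "\<omega> \<in> S.sector j")
      case True
      have "hs r \<omega> = (\<Sum>i<p. if i = j then inverse (root_kappa p) ^ (i * r) * h \<omega> else 0)"
        unfolding hs_eq
      proof (rule sum.cong)
        fix i assume "i \<in> {..<p}"
        then have "\<omega> \<in> S.sector i \<longleftrightarrow> i = j" using S.sector_disjoint[OF _ j _ True, of i] True by auto
        then show "inverse (root_kappa p) ^ (i * r) * (h \<omega> * indicator (S.sector i) \<omega>) =
            (if i = j then inverse (root_kappa p) ^ (i * r) * h \<omega> else 0)" by (simp add: indicator_def)
      qed simp
      then show ?thesis using True j by simp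
    qed simp
    have "S.sector_integral j (hs r) = inverse (root_kappa p) ^ (j * r) * S.sector_integral j h"
      unfolding S.sector_integral_def eq by (rule integral_mult_right_zero)
    then show ?thesis by (simp only: s_h[OF j])
  qed
  have \<nu>s_hs: "\<nu>s i (hs r) = (if i = r then 1 else 0)" if "i < p" "r < p" for i r
  proof -
    have "\<nu>s i (hs r) = (\<Sum>j<p. root_kappa p ^ (j * i) * inverse (root_kappa p) ^ (j * r)) * (1 / of_nat p)"
      unfolding \<nu>s_eq sum_distrib_right by (rule sum.cong) (simp_all add: s_hs)
    then show ?thesis using p by (simp add: root_kappa_orthogonal[OF that])
  qed
  \<comment> \<open>Summing over \<open>i\<close> with inverse powers isolates \<open>p\<close>
    times one sector integral. This turns decay under vanishing sector integrals into decay on the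
    common kernel of the functionals.\<close>
  have s_zero: "S.sector_integral m f = 0" if z: "\<And>i. i < p \<Longrightarrow> \<nu>s i f = 0" and m: "m < p" for m f
  proof -
    have "0 = (\<Sum>i<p. inverse (root_kappa p) ^ (i * m) * \<nu>s i f)" using z by simp
    also have "\<dots> = (\<Sum>i<p. \<Sum>j<p. S.sector_integral j f * (root_kappa p ^ (i * j) * inverse (root_kappa p) ^ (i * m)))"
      unfolding \<nu>s_eq sum_distrib_left by (intro sum.cong refl) (simp add: mult_ac)
    also have "\<dots> = (\<Sum>j<p. \<Sum>i<p. S.sector_integral j f * (root_kappa p ^ (i * j) * inverse (root_kappa p) ^ (i * m)))"
      by (rule sum.swap)
    also have "\<dots> = (\<Sum>j<p. if j = m then of_nat p * S.sector_integral j f else 0)"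
      unfolding sum_distrib_left[symmetric] by (intro sum.cong refl) (simp add: root_kappa_orthogonal m)
    also have "\<dots> = of_nat p * S.sector_integral m f" using m by simp
    finally show ?thesis using p by simp
  qed

  obtain C \<rho> where C: "0 \<le> C" and \<rho>: "0 < \<rho>" "\<rho> < 1"
    and dec: "\<And>f b m. holder_bound A \<theta> k b f \<Longrightarrow> 0 \<le> b \<Longrightarrow> (\<And>j. j < p \<Longrightarrow> S.sector_integral j f = 0) \<Longrightarrow>
       holder_bound A \<theta> k (C * \<rho> ^ m * b) ((?T ^^ m) f)"
    by (rule S.complex_decay) blast
  have dual: "dual_eigenvector (bounded_cont_fun A \<theta>) L (complex_of_real lam * root_kappa p ^ i) (\<nu>s i)" if "i < p" for i
    unfolding dual_eigenvector_def
  proof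
    have "\<nu>s i (hs i) \<noteq> 0" using \<nu>s_hs[OF that that] by simp
    then show "\<exists>f\<in>bounded_cont_fun A \<theta>. \<nu>s i f \<noteq> 0" by (rule bexI[OF _ V_cont[OF hs_V]])
    show "\<forall>f\<in>bounded_cont_fun A \<theta>. \<nu>s i (L f) = complex_of_real lam * root_kappa p ^ i * \<nu>s i f"
      by (rule ballI) (rule \<nu>s_L)
  qed
  \<comment> \<open>Undoing the normalisation multiplies the operator bound and the decay rate by
    \<open>lam\<close>. The bound \<open>real p\<close> reflects that each functional is a sum of
    \<open>p\<close> sector integrals with coefficients of modulus 1.\<close>
  have "peripheral_spectrum A \<theta> k L lam (lam * \<rho>) (lam * (2 * (S.E * (1 + \<Phi>)))) (real p) C p
    (\<lambda>i. complex_of_real lam * root_kappa p ^ i) hs \<nu>s"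
  proof (rule peripheral_spectrum.intro, rule H.holder_space_axioms, rule peripheral_spectrum_axioms.intro)
    show "H.linear_V L"
      unfolding H.linear_V_def L_T
      using H.V_scale[OF H.linear_VD(1)[OF T_lin]]
      by (simp add: H.linear_VD(2)[OF T_lin] distrib_left mult.left_commute)
    show "0 \<le> lam * (2 * (S.E * (1 + \<Phi>)))" using lam S.E_ge_1 S.Phi_nonneg by simp
    show "holder_bound A \<theta> k (lam * (2 * (S.E * (1 + \<Phi>))) * b) (L f)" if "0 \<le> b" "holder_bound A \<theta> k b f" for f b
      using holder_bound_scale[OF S.holder_bound_Lc[OF that(2,1)], of "complex_of_real lam"] lam
      by (simp add: L_T mult.assoc)
    show "hs i \<in> H.V" for i by (rule hs_V)
    show "L (hs i) = (\<lambda>\<omega>. complex_of_real lam * root_kappa p ^ i * hs i \<omega>)" for i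
      by (simp add: L_T T_hs mult.assoc)
    show "\<nu>s i (\<lambda>\<omega>. a * f \<omega> + c * v \<omega>) = a * \<nu>s i f + c * \<nu>s i v" if fv: "f \<in> H.V" "v \<in> H.V" for i f v a c
    proof -
      obtain b where b: "0 \<le> b" "holder_bound A \<theta> k b f" using H.V_E[OF fv(1)] .
      obtain b' where b': "0 \<le> b'" "holder_bound A \<theta> k b' v" using H.V_E[OF fv(2)] .
      show ?thesis
        unfolding \<nu>s_eq S.sector_integral_linear[OF b(2,1) b'(2,1)]
        by (simp add: distrib_left sum.distrib sum_distrib_left mult.left_commute)
    qed
    show "norm (\<nu>s i f) \<le> real p * b" if "0 \<le> b" "holder_bound A \<theta> k b f" for i f b
    proof -
      have "norm (\<nu>s i f) \<le> (\<Sum>j<p. norm (root_kappa p ^ (j * i) * S.sector_integral j f))"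
        unfolding \<nu>s_eq by (rule norm_sum)
      also have "\<dots> \<le> (\<Sum>j<p. b)"
        by (rule sum_mono) (simp add: norm_mult norm_power norm_root_kappa S.norm_sector_integral_le[OF that(2,1)])
      finally show ?thesis by simp
    qed
    show "\<nu>s i (L f) = complex_of_real lam * root_kappa p ^ i * \<nu>s i f" if "f \<in> H.V" for i f
      by (rule \<nu>s_L[OF V_cont[OF that]])
    show "\<nu>s i (hs j) = (if i = j then 1 else 0)" if "i < p" "j < p" for i j by (rule \<nu>s_hs[OF that])
    show "norm (complex_of_real lam * root_kappa p ^ i) = lam" for i
      using lam by (simp add: norm_mult norm_power norm_root_kappa)
    show "inj_on (\<lambda>i. complex_of_real lam * root_kappa p ^ i) {..<p}"
      by (rule inj_onI) (use lam root_kappa_pow_eq[OF p] in simp)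
    show "0 < lam * \<rho>" "lam * \<rho> < lam" using lam \<rho> by simp_all
    show "holder_bound A \<theta> k (C * (lam * \<rho>) ^ m * b) ((L ^^ m) f)"
      if "0 \<le> b" "holder_bound A \<theta> k b f" "\<And>i. i < p \<Longrightarrow> \<nu>s i f = 0" for f b m
    proof -
      have "holder_bound A \<theta> k (C * \<rho> ^ m * b) ((?T ^^ m) f)"
        using dec[OF that(2,1), of m] s_zero[OF that(3)] by blast
      from holder_bound_scale[OF this, of "complex_of_real lam ^ m"] show ?thesis
        unfolding L_pow using lam by (simp add: norm_power power_mult_distrib mult_ac)
    qed
    show "0 \<le> real p" by simp
    show "0 \<le> C" by (rule C)
  qed
  note sd = peripheral_spectrum.spectral_decomposition[OF this]
  let ?R = "peripheral_spectrum.R L p (\<lambda>i. complex_of_real lam * root_kappa p ^ i) hs \<nu>s"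
  let ?P = "\<lambda>i. tensor_op (hs i) (\<nu>s i)" and ?z = "\<lambda>i. complex_of_real lam * root_kappa p ^ i"
  have split: "\<forall>f\<in>H.V. L f = (\<lambda>\<omega>. (\<Sum>i<p. ?z i * ?P i f \<omega>) + ?R f \<omega>)"
    by (rule ballI, rule sd(2))
  have eig: "simple_eigenvalue H.V L (?z i) \<and> projection_operator H.V H.N (?P i) \<and>
      eigenfunction H.V L (?z i) (hs i)" if "i < p" for i
    by (rule sd(3)[OF that])
  have RP: "\<forall>f\<in>H.V. ?R (?P i f) = (\<lambda>\<omega>. 0) \<and> ?P i (?R f) = (\<lambda>\<omega>. 0)" if "i < p" for i
    by (rule ballI, rule sd(4)[OF that])
  have PP: "\<forall>j<p. j \<noteq> i \<longrightarrow> (\<forall>f\<in>H.V. ?P i (?P j f) = (\<lambda>\<omega>. 0))" if "i < p" for i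
    by (intro allI impI ballI, rule sd(5)[OF that])
  have all: "\<forall>i<p. simple_eigenvalue H.V L (?z i) \<and> projection_operator H.V H.N (?P i) \<and>
      eigenfunction H.V L (?z i) (hs i) \<and> dual_eigenvector (bounded_cont_fun A \<theta>) L (?z i) (\<nu>s i) \<and>
      (\<forall>f\<in>H.V. ?R (?P i f) = (\<lambda>\<omega>. 0) \<and> ?P i (?R f) = (\<lambda>\<omega>. 0)) \<and>
      (\<forall>j<p. j \<noteq> i \<longrightarrow> (\<forall>f\<in>H.V. ?P i (?P j f) = (\<lambda>\<omega>. 0)))"
  proof (rule allI, rule impI)
    fix i assume i: "i < p"
    from eig[OF i] show "simple_eigenvalue H.V L (?z i) \<and> projection_operator H.V H.N (?P i) \<and>
      eigenfunction H.V L (?z i) (hs i) \<and> dual_eigenvector (bounded_cont_fun A \<theta>) L (?z i) (\<nu>s i) \<and>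
      (\<forall>f\<in>H.V. ?R (?P i f) = (\<lambda>\<omega>. 0) \<and> ?P i (?R f) = (\<lambda>\<omega>. 0)) \<and>
      (\<forall>j<p. j \<noteq> i \<longrightarrow> (\<forall>f\<in>H.V. ?P i (?P j f) = (\<lambda>\<omega>. 0)))"
      by (elim conjE) (intro conjI dual[OF i] RP[OF i] PP[OF i])
  qed
  show ?thesis
    unfolding VH NH \<kappa>_def Pr_def
    by (rule exI[of _ ?R]) (rule conjI[OF sd(1) conjI[OF split conjI[OF all sd(6)]]])
qed

end
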